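(* Let $h,\lambda\in(0,\frac12]$ and $m\in[2,\infty)$. Then $$\min\left\{\max\{h\lambda^{3/2},(h\lambda)^{12/11}\},\ \lambda^2\right\}\ \lesssim_m\ \min_{A^{vKD}_{\lambda,1,m}}E^{vKD}_h\ \lesssim\ \min\{h\lambda,\lambda^2\}.$$ In the case $m=\infty$, $$\min\left\{(h\lambda)^{12/11},\ \lambda^2\right\}\ \lesssim\ \min_{A^{vKD}_{\lambda,1,\infty}}E^{vKD}_h\ \lesssim\ \min\{h\lambda,\lambda^2\}.$$
   Context: Let $I_\theta=[0,2\pi]$, $I_z=[-\frac12,\frac12]$, $\Omega=I_\theta\times I_z$ with coordinates $(\theta,z)$. $H^k_{\mathrm{per}}(\Omega)$ is the space of ($\Omega$-)periodic $L^2$-based Sobolev functions of order $k$ on $\Omega$. For a displacement $\phi=(\phi_\rho,\phi_\theta,\phi_z):\Omega\to\mathbb{R}^3$ (cylindrical components), the von Kármán–Donnell strain $\epsilon$ is the symmetric $2\times2$ matrix with entries $\epsilon_{\theta\theta}=\partial_\theta\phi_\theta+\frac12(\partial_\theta\phi_\rho)^2+\phi_\rho$, $\epsilon_{zz}=\partial_z\phi_z+\frac12(\partial_z\phi_\rho)^2$, $\epsilon_{\theta z}=\frac12(\partial_\theta\phi_z+\partial_z\phi_\theta)+\frac12\partial_\theta\phi_\rho\,\partial_z\phi_\rho$. The energy is $E^{vKD}_h(\phi)=\int_\Omega |\epsilon|^2+h^2|D^2\phi_\rho|^2\,d\theta\,dz$ (Euclidean matrix norms). The admissible set $A^{vKD}_{\lambda,\varrho,m}$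 consists of all $\phi:\Omega\to\mathbb{R}^3$ with $\phi_\rho\in H^2_{\mathrm{per}}(\Omega)$, $\phi_\theta\in H^1_{\mathrm{per}}(\Omega)$, $\phi_z+\lambda z\in H^1_{\mathrm{per}}(\Omega)$, $\phi_\rho\ge\varrho-1$, and $\max_{i\in\{\theta,z\},\,j\in\{\rho,\theta,z\}}\|\partial_i\phi_j\|_{L^\infty(\Omega)}\le m$ (no constraint if $m=\infty$); here $\varrho=1$. $\min_A E$ denotes the minimum energy value, i.e. the infimum of $E$ over $A$. $X\lesssim Y$ (resp. $X\lesssim_a Y$) means $X\le CY$ with $C>0$ a numerical constant (resp. depending only on $a$). *)

theory Defs
  imports "HOL-Probability.Probability"
begin

type_synonym point = "real \<times> real"

text \<open>Points are pairs \<open>(\<theta>, z)\<close>; \<open>Basis\<close> of this type consists of \<open>e_theta\<close> and \<open>e_z\<close>.\<close>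

definition e_theta :: point where "e_theta = (1, 0)"
definition e_z :: point where "e_z = (0, 1)"

definition Omega :: "point set" where
  "Omega = {0..2 * pi} \<times> {-1/2..1/2}"

text \<open>Sobolev functions are only determined almost everywhere, and every class has a Borel
  representative, so Borel functions with Lebesgue measure suffice.\<close>

definition Omega_measure :: "point measure" where
  "Omega_measure = restrict_space lborel Omega"

definition partial :: "point \<Rightarrow> (point \<Rightarrow> real) \<Rightarrow> point \<Rightarrow> real" where
  "partial e f = (\<lambda>x. deriv (\<lambda>t. f (x + t *\<^sub>R e)) 0)"

primrec C_k :: "nat \<Rightarrow> (point \<Rightarrow> real) \<Rightarrow> bool" where
  "C_k 0 f \<longleftrightarrow> continuous_on UNIV f"
| "C_k (Suc k) f \<longleftrightarrow>
     (\<forall>e\<in>Basis. (\<forall>x. (\<lambda>t. f (x + t *\<^sub>R e)) field_differentiable at 0) \<and> C_k k (partial e f))"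

definition smooth_functions :: "(point \<Rightarrow> real) set" where
  "smooth_functions = {f. \<forall>k. C_k k f}"

definition periodic_tests :: "(point \<Rightarrow> real) set" where
  "periodic_tests = {\<psi> \<in> smooth_functions.
     \<forall>\<theta> z. \<psi> (\<theta> + 2 * pi, z) = \<psi> (\<theta>, z) \<and> \<psi> (\<theta>, z + 1) = \<psi> (\<theta>, z)}"

definition interior_tests :: "(point \<Rightarrow> real) set" where
  "interior_tests = {\<psi> \<in> smooth_functions. closure {x. \<psi> x \<noteq> 0} \<subseteq> interior Omega}"

text \<open>Testing against \<open>interior_tests\<close> gives the usual weak derivative on the open rectangle.
  Testing against \<open>periodic_tests\<close> gives the weak derivative on the torus, which in addition
  excludes jumps across the identified sides of the rectangle.\<close>

definition weak_partial ::
  "(point \<Rightarrow> real) set \<Rightarrow> point \<Rightarrow> (point \<Rightarrow> real) \<Rightarrow> (point \<Rightarrow> real) \<Rightarrow> bool" where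
  "weak_partial T e f g \<longleftrightarrow>
     integrable Omega_measure f \<and> integrable Omega_measure g \<and>
     (\<forall>\<psi>\<in>T. (\<integral>x. f x * partial e \<psi> x \<partial>Omega_measure) = - (\<integral>x. g x * \<psi> x \<partial>Omega_measure))"

definition L2 :: "(point \<Rightarrow> real) \<Rightarrow> bool" where
  "L2 f \<longleftrightarrow> f \<in> borel_measurable Omega_measure \<and> integrable Omega_measure (\<lambda>x. (f x)\<^sup>2)"

primrec H_per :: "nat \<Rightarrow> (point \<Rightarrow> real) \<Rightarrow> bool" where
  "H_per 0 f \<longleftrightarrow> L2 f"
| "H_per (Suc k) f \<longleftrightarrow>
     L2 f \<and> (\<forall>e\<in>Basis. \<exists>g. weak_partial periodic_tests e f g \<and> H_per k g)"

text \<open>A representative of the weak derivative on the open rectangle, unique almost everywhere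
  there if it exists. The periodic notion would not do here: the axial displacement is periodic
  only up to a linear term.\<close>

definition D :: "point \<Rightarrow> (point \<Rightarrow> real) \<Rightarrow> point \<Rightarrow> real" where
  "D e f = (SOME g. weak_partial interior_tests e f g)"

definition L_infty_norm :: "(point \<Rightarrow> real) \<Rightarrow> ereal" where
  "L_infty_norm f = esssup Omega_measure (\<lambda>x. ereal \<bar>f x\<bar>)"

type_synonym displacement = "point \<Rightarrow> real \<times> real \<times> real"

definition comp_rho :: "displacement \<Rightarrow> point \<Rightarrow> real" where
  "comp_rho \<phi> = (\<lambda>x. fst (\<phi> x))"
definition comp_theta :: "displacement \<Rightarrow> point \<Rightarrow> real" where
  "comp_theta \<phi> = (\<lambda>x. fst (snd (\<phi> x)))"
definition comp_z :: "displacement \<Rightarrow> point \<Rightarrow> real" where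
  "comp_z \<phi> = (\<lambda>x. snd (snd (\<phi> x)))"

definition eps_theta_theta :: "displacement \<Rightarrow> point \<Rightarrow> real" where
  "eps_theta_theta \<phi> x =
     D e_theta (comp_theta \<phi>) x + 1/2 * (D e_theta (comp_rho \<phi>) x)\<^sup>2 + comp_rho \<phi> x"

definition eps_z_z :: "displacement \<Rightarrow> point \<Rightarrow> real" where
  "eps_z_z \<phi> x = D e_z (comp_z \<phi>) x + 1/2 * (D e_z (comp_rho \<phi>) x)\<^sup>2"

definition eps_theta_z :: "displacement \<Rightarrow> point \<Rightarrow> real" where
  "eps_theta_z \<phi> x =
     1/2 * (D e_theta (comp_z \<phi>) x + D e_z (comp_theta \<phi>) x)
     + 1/2 * D e_theta (comp_rho \<phi>) x * D e_z (comp_rho \<phi>) x"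

text \<open>The off-diagonal entry of the symmetric strain matrix contributes twice to its squared
  Euclidean norm.\<close>

definition strain_norm_sq :: "displacement \<Rightarrow> point \<Rightarrow> real" where
  "strain_norm_sq \<phi> x =
     (eps_theta_theta \<phi> x)\<^sup>2 + 2 * (eps_theta_z \<phi> x)\<^sup>2 + (eps_z_z \<phi> x)\<^sup>2"

definition hessian_norm_sq :: "(point \<Rightarrow> real) \<Rightarrow> point \<Rightarrow> real" where
  "hessian_norm_sq f x = (\<Sum>i\<in>Basis. \<Sum>j\<in>Basis. (D i (D j f) x)\<^sup>2)"

definition E_vKD :: "real \<Rightarrow> displacement \<Rightarrow> ennreal" where
  "E_vKD h \<phi> =
     (\<integral>\<^sup>+x. ennreal (strain_norm_sq \<phi> x + h\<^sup>2 * hessian_norm_sq (comp_rho \<phi>) x) \<partial>Omega_measure)"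

text \<open>Functions in \<open>H_per 2\<close> are continuous up to a null set, so the obstacle constraint may be
  imposed almost everywhere. The slope bound \<open>m\<close> is extended real; for \<open>m = \<infinity>\<close> the last condition is void.\<close>

definition A_vKD :: "real \<Rightarrow> real \<Rightarrow> ereal \<Rightarrow> displacement set" where
  "A_vKD lam \<rho> m = {\<phi>.
     H_per 2 (comp_rho \<phi>) \<and>
     H_per 1 (comp_theta \<phi>) \<and>
     H_per 1 (\<lambda>x. comp_z \<phi> x + lam * snd x) \<and>
     (AE x in Omega_measure. comp_rho \<phi> x \<ge> \<rho> - 1) \<and>
     (\<forall>i\<in>{e_theta, e_z}. \<forall>f\<in>{comp_rho \<phi>, comp_theta \<phi>, comp_z \<phi>}. L_infty_norm (D i f) \<le> m)}"

definition min_E_vKD :: "real \<Rightarrow> real \<Rightarrow> real \<Rightarrow> ereal \<Rightarrow> ennreal" where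
  "min_E_vKD h lam \<rho> m = (INF \<phi>\<in>A_vKD lam \<rho> m. E_vKD h \<phi>)"

end

theory Submission
  imports Defs
begin

text \<open>
  \<^bold>\<open>Upper bound.\<close> Pure compression, with no radial displacement, costs \<open>2 pi lam\<^sup>2\<close>. Axisymmetric
  wrinkling with about \<open>1 / sqrt h\<close> waves relaxes the axial strain completely and leaves hoop stretching and
  bending of total order \<open>h lam\<close>. These two competitors are \<open>compression_upper_bound\<close> and
  \<open>wrinkling_upper_bound\<close>.

  \<^bold>\<open>Lower bound.\<close> Let \<open>e\<close> be the energy and \<open>w \<ge> 0\<close> the radial displacement. If \<open>e > lam\<^sup>2\<close> nothing is to be
  shown. Otherwise the argument rests on two mean values.

  \<^item> The derivative of the hoop component has mean zero on each circle. Since the obstacle makes \<open>w\<close>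
  nonnegative, the hoop strain controls \<open>w\<close> in \<open>L\<^sup>1\<close> and the square of its tangential derivative in \<open>L\<^sup>1\<close>,
  both by \<open>sqrt e\<close>, and it controls the integrals of \<open>w\<close> over circles in \<open>L\<^sup>2\<close> with respect to \<open>z\<close>
  (\<open>hoop_integrals\<close>, \<open>hoop_lines\<close>).
  \<^item> The axial component is periodic up to \<open>- lam z\<close>. A small axial strain therefore forces the axial slope
  \<open>gz\<close> of \<open>w\<close> to satisfy \<open>\<integral> gz\<^sup>2 \<ge> 6 lam\<close> (\<open>axial_slope_lower\<close>).

  The bending energy bounds the axial curvature \<open>k\<close> of \<open>w\<close> by \<open>sqrt e / h\<close>. A function that is small, with small
  curvature, cannot have large slope, and interpolation makes this quantitative in two ways. If the
  slopes are bounded by \<open>m\<close>, then \<open>\<parallel>gz\<parallel>\<^sup>3 \<lesssim> m \<parallel>w\<parallel>\<^sub>1 \<parallel>k\<parallel>\<close> gives \<open>h lam^(3/2) \<lesssim> m e\<close>. Without a bound on the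
  slopes, \<open>\<parallel>gz\<parallel>\<^sup>2 \<lesssim> \<parallel>w\<parallel> \<parallel>k\<parallel>\<close> is used, where interpolation in the tangential direction gives
  \<open>\<parallel>w\<parallel>\<^sup>2 \<lesssim> e^(5/6)\<close>; together \<open>h lam \<lesssim> e^(11/12)\<close>. Every one of these inequalities is proved by cutting
  lines into blocks, estimating on each block by elementary means, and choosing the number of blocks at the
  end.

  \<^bold>\<open>Sobolev functions.\<close> The estimates on lines need Sobolev functions to be primitives of their weak
  derivatives on almost every line (\<open>absolutely_continuous_on_lines\<close>), which follows from the fundamental lemma
  of the calculus of variations for a countable family of bump functions. The same lemma shows that weak
  derivatives are unique, and the periodic extension of interior test functions makes derivatives on the
  torus derivatives on the rectangle; hence the representatives \<open>D\<close> in the energy are the derivatives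
  that membership in the Sobolev spaces supplies.
\<close>

section \<open>Smooth functions of one variable\<close>

text \<open>Iterated derivatives are the coinductive notion that matches the recursive definition of
  \<open>C_k\<close>: a set of functions in which every member has its derivative again in the set consists of
  smooth functions. The smoothness proofs below exhibit such sets.\<close>

definition smooth1 :: "(real \<Rightarrow> real) \<Rightarrow> bool" where
  "smooth1 u \<longleftrightarrow> (\<forall>n x. ((deriv ^^ n) u) field_differentiable (at x))"

lemma smooth1_coinduct:
  assumes "u \<in> S" and S: "\<And>v. v \<in> S \<Longrightarrow> \<exists>v'\<in>S. \<forall>x. (v has_real_derivative v' x) (at x)"
  shows "smooth1 u"
proof -
  have d: "deriv v \<in> S \<and> (\<forall>x. v field_differentiable (at x))" if "v \<in> S" for v
  proof -
    obtain v' where v': "v' \<in> S" "\<forall>x. (v has_real_derivative v' x) (at x)"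
      using S \<open>v \<in> S\<close> by blast
    then have "deriv v = v'" by (intro ext DERIV_imp_deriv) auto
    with v' show ?thesis by (auto simp: field_differentiable_def)
  qed
  have "(deriv ^^ n) u \<in> S" for n by (induction n) (use d assms(1) in auto)
  then show ?thesis unfolding smooth1_def using d by blast
qed

lemma smooth1_DERIV: "smooth1 u \<Longrightarrow> (u has_real_derivative deriv u x) (at x)"
  unfolding smooth1_def by (metis DERIV_deriv_iff_field_differentiable funpow_0)

lemma smooth1_deriv: "smooth1 u \<Longrightarrow> smooth1 (deriv u)"
  unfolding smooth1_def by (metis comp_apply funpow_Suc_right)

lemma smooth1_antiderivative:
  assumes "\<And>x. (u has_real_derivative v x) (at x)" "smooth1 v"
  shows "smooth1 u"
proof (rule smooth1_coinduct[where S="insert u (Collect smooth1)"])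
  fix w assume "w \<in> insert u (Collect smooth1)"
  then show "\<exists>v'\<in>insert u (Collect smooth1). \<forall>x. (w has_real_derivative v' x) (at x)"
    using assms smooth1_DERIV smooth1_deriv by blast
qed auto

lemma smooth1_continuous: "smooth1 u \<Longrightarrow> continuous_on A u"
  by (meson DERIV_isCont continuous_at_imp_continuous_on smooth1_DERIV)

lemma smooth1_measurable: "smooth1 u \<Longrightarrow> u \<in> borel_measurable borel"
  by (simp add: borel_measurable_continuous_onI smooth1_continuous)

lemma smooth1_const: "smooth1 (\<lambda>x. c)"
  by (rule smooth1_coinduct[where S="range (\<lambda>c x. c)"]) (auto intro!: bexI[of _ "\<lambda>x. 0"] derivative_eq_intros)

lemma smooth1_affine:
  assumes "smooth1 u" shows "smooth1 (\<lambda>x. u (a * x + b))"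
proof (rule smooth1_coinduct[where S="{\<lambda>x. c * u (a * x + b) |c u. smooth1 u}"])
  show "(\<lambda>x. u (a * x + b)) \<in> {\<lambda>x. c * u (a * x + b) |c u. smooth1 u}"
    using assms by (auto intro!: exI[of _ 1])
next
  fix v assume "v \<in> {\<lambda>x. c * u (a * x + b) |c u. smooth1 u}"
  then obtain c u where v: "v = (\<lambda>x. c * u (a * x + b))" and u: "smooth1 u" by blast
  have "(v has_real_derivative (c * a) * deriv u (a * x + b)) (at x)" for x
    unfolding v by (rule derivative_eq_intros refl DERIV_chain2[OF smooth1_DERIV[OF u]] | simp)+
  then show "\<exists>v'\<in>{\<lambda>x. c * u (a * x + b) |c u. smooth1 u}. \<forall>x. (v has_real_derivative v' x) (at x)"
    using smooth1_deriv[OF u] by (intro bexI[of _ "\<lambda>x. (c * a) * deriv u (a * x + b)"]) auto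
qed

text \<open>The product rule turns a product into a sum of products, so the set that is closed under
  differentiation has to be the ring generated by the smooth functions.\<close>

inductive_set smooth1_ring :: "(real \<Rightarrow> real) set" where
  gen: "smooth1 u \<Longrightarrow> u \<in> smooth1_ring"
| add: "u \<in> smooth1_ring \<Longrightarrow> v \<in> smooth1_ring \<Longrightarrow> (\<lambda>x. u x + v x) \<in> smooth1_ring"
| mult: "u \<in> smooth1_ring \<Longrightarrow> v \<in> smooth1_ring \<Longrightarrow> (\<lambda>x. u x * v x) \<in> smooth1_ring"

lemma smooth1_ring_smooth1:
  assumes "u \<in> smooth1_ring" shows "smooth1 u"
  using assms
proof (rule smooth1_coinduct)
  fix v assume "v \<in> smooth1_ring"
  then show "\<exists>v'\<in>smooth1_ring. \<forall>x. (v has_real_derivative v' x) (at x)"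
  proof induction
    case (gen u)
    then show ?case by (meson smooth1_DERIV smooth1_deriv smooth1_ring.gen)
  next
    case (add u v)
    then obtain u' v' where "u' \<in> smooth1_ring" "v' \<in> smooth1_ring"
      "\<forall>x. (u has_real_derivative u' x) (at x)" "\<forall>x. (v has_real_derivative v' x) (at x)" by blast
    then show ?case
      by (intro bexI[of _ "\<lambda>x. u' x + v' x"] smooth1_ring.add) (auto intro!: derivative_intros)
  next
    case (mult u v)
    then obtain u' v' where "u' \<in> smooth1_ring" "v' \<in> smooth1_ring"
      "\<forall>x. (u has_real_derivative u' x) (at x)" "\<forall>x. (v has_real_derivative v' x) (at x)" by blast
    then show ?case using mult.hyps
      by (intro bexI[of _ "\<lambda>x. u' x * v x + v' x * u x"] smooth1_ring.intros(2,3)) (auto intro!: derivative_eq_intros)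
  qed
qed

lemma smooth1_add: "smooth1 u \<Longrightarrow> smooth1 v \<Longrightarrow> smooth1 (\<lambda>x. u x + v x)"
  by (simp add: smooth1_ring.intros smooth1_ring_smooth1)
lemma smooth1_mult: "smooth1 u \<Longrightarrow> smooth1 v \<Longrightarrow> smooth1 (\<lambda>x. u x * v x)"
  by (simp add: smooth1_ring.intros smooth1_ring_smooth1)
lemma smooth1_cmult: "smooth1 u \<Longrightarrow> smooth1 (\<lambda>x. c * u x)"
  by (simp add: smooth1_mult smooth1_const)
lemma smooth1_diff: "smooth1 u \<Longrightarrow> smooth1 v \<Longrightarrow> smooth1 (\<lambda>x. u x - v x)"
  using smooth1_add[OF _ smooth1_cmult[of v "-1"], of u] by simp

text \<open>The polynomial parameter makes this family of functions \<open>p (1/t) e^(-1/t)\<close>, extended by zero to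
  \<open>t \<le> 0\<close>, closed under differentiation; the member with \<open>p = 1\<close> is a smooth monotone transition from
  \<open>0\<close> to \<open>1\<close>.\<close>

definition flat_step :: "real poly \<Rightarrow> real \<Rightarrow> real" where
  "flat_step p t = (if t > 0 then poly p (1 / t) * exp (- (1 / t)) else 0)"

lemma flat_step_tendsto_0: "((\<lambda>t::real. poly p (1 / t) * exp (- (1 / t))) \<longlongrightarrow> 0) (at_right 0)"
proof -
  have "((\<lambda>s::real. poly p s * exp (- s)) \<longlongrightarrow> 0) at_top"
  proof -
    have *: "((\<lambda>s::real. s ^ k / exp s) \<longlongrightarrow> 0) at_top" for k by (rule tendsto_power_div_exp_0)
    have "(\<lambda>s::real. poly q s * exp (- s)) = (\<lambda>s. \<Sum>i\<le>degree q. coeff q i * (s ^ i / exp s))" for q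
      by (simp add: poly_altdef exp_minus divide_inverse sum_distrib_right mult.assoc)
    moreover have "((\<lambda>s::real. \<Sum>i\<le>degree q. coeff q i * (s ^ i / exp s)) \<longlongrightarrow> (\<Sum>i\<le>degree q. coeff q i * 0)) at_top" for q
      by (intro tendsto_intros *)
    ultimately show ?thesis by simp
  qed
  moreover have "filterlim (\<lambda>t::real. 1 / t) at_top (at_right 0)"
    using filterlim_inverse_at_top_right by (simp add: inverse_eq_divide)
  ultimately show ?thesis by (rule filterlim_compose)
qed

lemma flat_step_DERIV:
  "(flat_step p has_real_derivative flat_step ([:0, 0, 1:] * (p - pderiv p)) t) (at t)"
proof -
  consider "t > 0" | "t < 0" | "t = 0" by linarith
  then show ?thesis
  proof cases
    case 1
    have "((\<lambda>t. poly p (1 / t) * exp (- (1 / t))) has_real_derivative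
        flat_step ([:0, 0, 1:] * (p - pderiv p)) t) (at t)"
      using 1 by (auto intro!: derivative_eq_intros poly_DERIV[THEN DERIV_chain2]
        simp: flat_step_def field_simps power2_eq_square)
    then show ?thesis
      by (rule DERIV_cong_ev[THEN iffD1, rotated -1, OF _ refl _ refl])
         (use eventually_nhds_in_open[of "{0<..}" t] 1 in \<open>auto elim!: eventually_mono simp: flat_step_def\<close>)
  next
    case 2
    have "((\<lambda>t. 0) has_real_derivative flat_step ([:0, 0, 1:] * (p - pderiv p)) t) (at t)"
      using 2 by (simp add: flat_step_def)
    then show ?thesis
      by (rule DERIV_cong_ev[THEN iffD1, rotated -1, OF _ refl _ refl])
         (use eventually_nhds_in_open[of "{..<0}" t] 2 in \<open>auto elim!: eventually_mono simp: flat_step_def\<close>)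
  next
    case 3
    have "((\<lambda>h. (flat_step p h - flat_step p 0) / h) \<longlongrightarrow> 0) (at 0)"
      unfolding filterlim_at_split
    proof
      show "((\<lambda>h. (flat_step p h - flat_step p 0) / h) \<longlongrightarrow> 0) (at_left 0)"
        by (rule tendsto_eventually) (auto simp: eventually_at_filter flat_step_def)
      show "((\<lambda>h. (flat_step p h - flat_step p 0) / h) \<longlongrightarrow> 0) (at_right 0)"
        using flat_step_tendsto_0[of "[:0, 1:] * p"]
        by (rule Lim_transform_eventually) (auto simp: eventually_at_filter flat_step_def)
    qed
    then show ?thesis unfolding 3 by (simp add: DERIV_def flat_step_def)
  qed
qed

lemma smooth1_flat_step: "smooth1 (flat_step p)"
  by (rule smooth1_coinduct[where S="range flat_step"]) (use flat_step_DERIV in auto)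

text \<open>The two factors vanish up to the distance \<open>1/n\<close> from the ends of \<open>(s, t)\<close>, which makes the support
  compact in that interval, and both tend to \<open>1\<close> inside it as \<open>n\<close> grows. Humps thus approximate indicator
  functions of intervals from within the test functions.\<close>

definition hump :: "real \<Rightarrow> real \<Rightarrow> nat \<Rightarrow> real \<Rightarrow> real" where
  "hump s t n x = flat_step 1 (real n * (x - s) - 1) * flat_step 1 (real n * (t - x) - 1)"

definition bumps :: "real \<Rightarrow> real \<Rightarrow> (real \<Rightarrow> real) set" where
  "bumps a b = {u. smooth1 u \<and> (\<exists>s t. a < s \<and> t < b \<and> (\<forall>x. x \<notin> {s..t} \<longrightarrow> u x = 0))}"

lemma bumpsD: "u \<in> bumps a b \<Longrightarrow> smooth1 u" by (simp add: bumps_def)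

lemma bumps_zero: "u \<in> bumps a b \<Longrightarrow> x \<le> a \<or> b \<le> x \<Longrightarrow> u x = 0"
  by (force simp: bumps_def)

lemma flat_step_bounds: "0 \<le> flat_step 1 t" "flat_step 1 t \<le> 1"
  by (auto simp: flat_step_def)

lemma hump_bounds: "0 \<le> hump s t n x" "hump s t n x \<le> 1"
  unfolding hump_def using flat_step_bounds by (auto intro!: mult_nonneg_nonneg mult_le_one)

lemma smooth1_hump: "smooth1 (hump s t n)"
proof -
  have 1: "smooth1 (\<lambda>x. flat_step 1 (real n * x + (- real n * s - 1)))"
   and 2: "smooth1 (\<lambda>x. flat_step 1 ((- real n) * x + (real n * t - 1)))"
    by (intro smooth1_affine smooth1_flat_step)+
  show ?thesis using smooth1_mult[OF 1 2] unfolding hump_def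
    by (simp add: algebra_simps)
qed

lemma hump_bumps: assumes "a \<le> s" "t \<le> b" shows "hump s t n \<in> bumps a b"
proof (cases "n = 0")
  case True
  then have "hump s t n = (\<lambda>x. 0)" by (auto simp: hump_def flat_step_def)
  moreover have "(\<exists>s t. a < s \<and> t < b)" by (meson lt_ex gt_ex)
  ultimately show ?thesis using smooth1_const by (auto simp: bumps_def)
next
  case False
  have "hump s t n x = 0" if "x \<notin> {s + 1 / n .. t - 1 / n}" for x
    using that False by (auto simp: hump_def flat_step_def field_simps not_le)
  moreover have "a < s + 1 / n" "t - 1 / n < b" using assms False
    by (auto intro: le_less_trans[of _ "t"] le_less_trans[of a s] le_less_trans[of "t - 1 / n" "b - 1 / n"])
  ultimately show ?thesis unfolding bumps_def using smooth1_hump by blast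
qed

text \<open>The end points may move with the index, which later allows rational end points only.\<close>

lemma hump_tendsto:
  assumes s: "\<And>n. a < s n" "s \<longlonglongrightarrow> a" and t: "\<And>n. t n < b" "t \<longlonglongrightarrow> b"
  shows "(\<lambda>n. hump (s n) (t n) n x) \<longlonglongrightarrow> indicator {a<..<b} x"
proof -
  have one: "((\<lambda>y::real. flat_step 1 y) \<longlongrightarrow> 1) at_top"
  proof -
    have "((\<lambda>y::real. exp (- (1 / y))) \<longlongrightarrow> exp (- 0)) at_top"
      by (intro tendsto_intros) (simp add: tendsto_inverse_0_at_top filterlim_ident flip: inverse_eq_divide)
    then show ?thesis
      by (simp, elim Lim_transform_eventually)
         (auto simp: flat_step_def eventually_at_top_dense intro!: exI[of _ 0])
  qed
  have lim: "filterlim (\<lambda>n. real n * (d n) - 1) at_top sequentially" if "d \<longlonglongrightarrow> e" "e > 0" for d e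
    using filterlim_tendsto_add_at_top[OF tendsto_const[of "-1"]
      filterlim_tendsto_pos_mult_at_top[OF that filterlim_real_sequentially]]
    by (simp add: algebra_simps)
  show ?thesis
  proof (cases "a < x \<and> x < b")
    case True
    have "(\<lambda>n. x - s n) \<longlonglongrightarrow> x - a" "(\<lambda>n. t n - x) \<longlonglongrightarrow> b - x" using s t by (auto intro!: tendsto_intros)
    from lim[OF this(1)] lim[OF this(2)] True
    have "(\<lambda>n. hump (s n) (t n) n x) \<longlonglongrightarrow> 1 * 1" unfolding hump_def
      by (intro tendsto_mult filterlim_compose[OF one]) auto
    then show ?thesis using True by simp
  next
    case False
    have "hump (s n) (t n) n x = 0" for n
    proof -
      have "real n * (x - s n) \<le> 0 \<or> real n * (t n - x) \<le> 0"
        using False s(1)[of n] t(1)[of n] by (auto simp: mult_le_0_iff)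
      then show ?thesis by (auto simp: hump_def flat_step_def)
    qed
    then show ?thesis using False by simp
  qed
qed

section \<open>Test functions on the rectangle and on the torus\<close>

lemma Basis_point: "(Basis :: point set) = {e_theta, e_z}"
  by (auto simp: Basis_prod_def e_theta_def e_z_def)

lemma smooth_functions_coinduct:
  assumes "f \<in> S"
    and S: "\<And>g. g \<in> S \<Longrightarrow> continuous_on UNIV g"
      "\<And>g e. g \<in> S \<Longrightarrow> e \<in> Basis \<Longrightarrow>
         (\<forall>x. (\<lambda>t. g (x + t *\<^sub>R e)) field_differentiable at 0) \<and> partial e g \<in> S"
  shows "f \<in> smooth_functions"
proof -
  have "\<forall>g\<in>S. C_k k g" for k
    by (induction k) (use S in \<open>auto simp del: Basis_point\<close>)
  then show ?thesis using assms(1) by (auto simp: smooth_functions_def)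
qed

lemma smooth_functionsD:
  assumes "f \<in> smooth_functions"
  shows "continuous_on UNIV f"
    and "e \<in> Basis \<Longrightarrow> (\<lambda>t. f (x + t *\<^sub>R e)) field_differentiable at 0"
    and "e \<in> Basis \<Longrightarrow> partial e f \<in> smooth_functions"
proof -
  have C: "C_k k f" for k using assms by (simp add: smooth_functions_def)
  from C[of 0] show "continuous_on UNIV f" by simp
  from C[of "Suc 0"] show "e \<in> Basis \<Longrightarrow> (\<lambda>t. f (x + t *\<^sub>R e)) field_differentiable at 0"
    by (simp del: split_paired_All)
  from C[of "Suc k" for k] show "e \<in> Basis \<Longrightarrow> partial e f \<in> smooth_functions"
    by (simp add: smooth_functions_def)
qed

lemma smooth_partial_DERIV:
  assumes "f \<in> smooth_functions" "e \<in> Basis"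
  shows "((\<lambda>t. f (x + t *\<^sub>R e)) has_real_derivative partial e f x) (at 0)"
  unfolding partial_def using smooth_functionsD(2)[OF assms]
  by (simp add: DERIV_deriv_iff_field_differentiable)

lemma product_partial:
  assumes "smooth1 a" "smooth1 b"
  shows "((\<lambda>t. (\<lambda>x. a (fst x) * b (snd x)) (x + t *\<^sub>R e_theta)) has_real_derivative deriv a (fst x) * b (snd x)) (at 0)"
    and "((\<lambda>t. (\<lambda>x. a (fst x) * b (snd x)) (x + t *\<^sub>R e_z)) has_real_derivative a (fst x) * deriv b (snd x)) (at 0)"
  by (auto intro!: derivative_eq_intros DERIV_chain2[OF smooth1_DERIV[OF assms(1)]]
      DERIV_chain2[OF smooth1_DERIV[OF assms(2)]] simp: e_theta_def e_z_def)

lemma partial_product: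
  assumes "smooth1 a" "smooth1 b"
  shows "partial e_theta (\<lambda>x. a (fst x) * b (snd x)) = (\<lambda>x. deriv a (fst x) * b (snd x))"
    and "partial e_z (\<lambda>x. a (fst x) * b (snd x)) = (\<lambda>x. a (fst x) * deriv b (snd x))"
  using product_partial[OF assms, THEN DERIV_imp_deriv] unfolding partial_def by auto

lemma smooth_product:
  assumes "smooth1 a" "smooth1 b"
  shows "(\<lambda>x. a (fst x) * b (snd x)) \<in> smooth_functions"
proof (rule smooth_functions_coinduct[where S="{\<lambda>x. a (fst x) * b (snd x) |a b. smooth1 a \<and> smooth1 b}"])
  fix g assume "g \<in> {\<lambda>x::point. a (fst x) * b (snd x) |a b. smooth1 a \<and> smooth1 b}"
  then obtain a b where g: "g = (\<lambda>x. a (fst x) * b (snd x))" and ab: "smooth1 a" "smooth1 b" by blast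
  show "continuous_on UNIV g" unfolding g
    by (intro continuous_intros continuous_on_compose2[OF smooth1_continuous[OF ab(1), of UNIV]]
         continuous_on_compose2[OF smooth1_continuous[OF ab(2), of UNIV]]) auto
  fix e :: point assume "e \<in> Basis"
  then consider "e = e_theta" | "e = e_z" by (auto simp: Basis_point)
  then show "(\<forall>x. (\<lambda>t. g (x + t *\<^sub>R e)) field_differentiable at 0)
      \<and> partial e g \<in> {\<lambda>x::point. a (fst x) * b (snd x) |a b. smooth1 a \<and> smooth1 b}"
  proof cases
    case 1
    then show ?thesis unfolding g field_differentiable_def partial_product(1)[OF ab] 1
      using product_partial(1)[OF ab] ab(2) smooth1_deriv[OF ab(1)] by blast
  next
    case 2
    then show ?thesis unfolding g field_differentiable_def partial_product(2)[OF ab] 2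
      using product_partial(2)[OF ab] ab(1) smooth1_deriv[OF ab(2)] by blast
  qed
qed (use assms in blast)

lemma interior_Omega: "interior Omega = {0<..<2*pi} \<times> {-1/2<..<1/2}"
  by (simp add: Omega_def interior_Times)

lemma product_interior_tests:
  assumes "a \<in> bumps 0 (2*pi)" "b \<in> bumps (-1/2) (1/2)"
  shows "(\<lambda>x. a (fst x) * b (snd x)) \<in> interior_tests"
proof -
  obtain s t s' t' where st: "0 < s" "t < 2 * pi" "\<And>x. x \<notin> {s..t} \<Longrightarrow> a x = 0"
      "-1/2 < s'" "t' < 1/2" "\<And>x. x \<notin> {s'..t'} \<Longrightarrow> b x = 0"
    using assms unfolding bumps_def mem_Collect_eq by blast
  have "closure {x. a (fst x) * b (snd x) \<noteq> 0} \<subseteq> {s..t} \<times> {s'..t'}"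
  proof (rule closure_minimal)
    show "{x. a (fst x) * b (snd x) \<noteq> 0} \<subseteq> {s..t} \<times> {s'..t'}"
    proof
      fix x assume "x \<in> {x. a (fst x) * b (snd x) \<noteq> 0}"
      then have "fst x \<in> {s..t}" "snd x \<in> {s'..t'}" using st(3)[of "fst x"] st(6)[of "snd x"] by auto
      then show "x \<in> {s..t} \<times> {s'..t'}" by (simp add: mem_Times_iff)
    qed
  qed (simp add: closed_Times)
  also have "\<dots> \<subseteq> interior Omega" using st by (auto simp: interior_Omega)
  finally show ?thesis using smooth_product assms by (simp add: interior_tests_def bumps_def)
qed

lemma partial_zero_on_open:
  assumes "open N" "\<And>x. x \<in> N \<Longrightarrow> \<psi> x = 0" "x \<in> N"
  shows "partial e \<psi> x = 0"
proof -
  have "isCont (\<lambda>t. x + t *\<^sub>R e) 0" by (intro continuous_intros)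
  then have "((\<lambda>t. x + t *\<^sub>R e) \<longlongrightarrow> x) (nhds 0)"
    by (simp add: continuous_at tendsto_nhds_iff)
  then have "\<forall>\<^sub>F t in nhds 0. x + t *\<^sub>R e \<in> N" using assms(1,3) topological_tendstoD by blast
  then have "((\<lambda>t. \<psi> (x + t *\<^sub>R e)) has_real_derivative 0) (at 0)"
    by (intro DERIV_cong_ev[THEN iffD2, OF refl _ refl DERIV_const[of 0]])
       (auto elim!: eventually_mono simp: assms(2))
  then show ?thesis unfolding partial_def by (rule DERIV_imp_deriv)
qed

text \<open>A map \<open>\<rho>\<close> that near every point is either a translation or takes values in the open set \<open>N\<close>. A smooth
  function that vanishes on \<open>N\<close> then stays smooth after composition with \<open>\<rho>\<close>, although \<open>\<rho>\<close> itself may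
  jump. Reduction modulo a period is of this kind, with a neighbourhood of the cell boundary as \<open>N\<close>.\<close>

definition folds_into :: "point set \<Rightarrow> (point \<Rightarrow> point) \<Rightarrow> bool" where
  "folds_into N \<rho> \<longleftrightarrow> open N \<and> (\<forall>x. \<exists>\<epsilon>>0. (\<exists>v. \<forall>y\<in>ball x \<epsilon>. \<rho> y = y - v) \<or> (\<forall>y\<in>ball x \<epsilon>. \<rho> y \<in> N))"

text \<open>Near a point where \<open>\<rho>\<close> is a translation this is the chain rule; near any other point both sides are
  the derivative of the zero function.\<close>

lemma fold_partial:
  assumes \<rho>: "folds_into N \<rho>" and \<psi>: "\<psi> \<in> smooth_functions" "\<And>x. x \<in> N \<Longrightarrow> \<psi> x = 0" and e: "e \<in> Basis"
  shows "((\<lambda>t. \<psi> (\<rho> (x + t *\<^sub>R e))) has_real_derivative partial e \<psi> (\<rho> x)) (at 0)"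
proof -
  obtain \<epsilon> where \<epsilon>: "\<epsilon> > 0" "(\<exists>v. \<forall>y\<in>ball x \<epsilon>. \<rho> y = y - v) \<or> (\<forall>y\<in>ball x \<epsilon>. \<rho> y \<in> N)"
    using \<rho> unfolding folds_into_def by blast
  have "isCont (\<lambda>t. x + t *\<^sub>R e) 0" by (intro continuous_intros)
  then have "((\<lambda>t. x + t *\<^sub>R e) \<longlongrightarrow> x) (nhds 0)"
    by (simp add: continuous_at tendsto_nhds_iff)
  then have ev: "\<forall>\<^sub>F t in nhds 0. x + t *\<^sub>R e \<in> ball x \<epsilon>"
    using \<open>\<epsilon> > 0\<close> topological_tendstoD by (metis centre_in_ball open_ball)
  from \<epsilon>(2) show ?thesis
  proof (elim disjE exE)
    fix v assume v: "\<forall>y\<in>ball x \<epsilon>. \<rho> y = y - v"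
    then have x: "\<rho> x = x - v" using \<epsilon>(1) by simp
    show ?thesis
      using smooth_partial_DERIV[OF \<psi>(1) e, of "x - v"] unfolding x
      by (rule DERIV_cong_ev[THEN iffD1, OF refl _ refl, rotated])
         (use ev in \<open>auto elim!: eventually_mono simp: v algebra_simps simp del: mem_ball\<close>)
  next
    assume v: "\<forall>y\<in>ball x \<epsilon>. \<rho> y \<in> N"
    then have "partial e \<psi> (\<rho> x) = 0" using \<epsilon>(1) \<rho> \<psi>(2) unfolding folds_into_def
      by (intro partial_zero_on_open[of N]) auto
    then show ?thesis
      by (simp, intro DERIV_cong_ev[THEN iffD2, OF refl _ refl DERIV_const[of 0]] eventually_mono[OF ev] \<psi>(2))
         (use v in blast)
  qed
qed

lemma partial_fold:
  assumes "folds_into N \<rho>" "\<psi> \<in> smooth_functions" "\<And>x. x \<in> N \<Longrightarrow> \<psi> x = 0" "e \<in> Basis"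
  shows "partial e (\<lambda>x. \<psi> (\<rho> x)) = (\<lambda>x. partial e \<psi> (\<rho> x))"
  unfolding partial_def[of e "\<lambda>x. \<psi> (\<rho> x)"]
  using fold_partial[OF assms, THEN DERIV_imp_deriv] by auto

lemma smooth_fold:
  assumes \<rho>: "folds_into N \<rho>" and \<psi>: "\<psi> \<in> smooth_functions" "\<And>x. x \<in> N \<Longrightarrow> \<psi> x = 0"
  shows "(\<lambda>x. \<psi> (\<rho> x)) \<in> smooth_functions"
proof (rule smooth_functions_coinduct[where S="{\<lambda>x. \<psi> (\<rho> x) |\<psi>. \<psi> \<in> smooth_functions \<and> (\<forall>x\<in>N. \<psi> x = 0)}"])
  fix g assume "g \<in> {\<lambda>x. \<psi> (\<rho> x) |\<psi>. \<psi> \<in> smooth_functions \<and> (\<forall>x\<in>N. \<psi> x = 0)}"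
  then obtain \<psi> where g: "g = (\<lambda>x. \<psi> (\<rho> x))" and \<psi>: "\<psi> \<in> smooth_functions" "\<And>x. x \<in> N \<Longrightarrow> \<psi> x = 0" by blast
  have "isCont g x" for x
  proof -
    obtain \<epsilon> where \<epsilon>: "\<epsilon> > 0" "(\<exists>v. \<forall>y\<in>ball x \<epsilon>. \<rho> y = y - v) \<or> (\<forall>y\<in>ball x \<epsilon>. \<rho> y \<in> N)"
      using \<rho> unfolding folds_into_def by blast
    have ev: "\<forall>\<^sub>F y in nhds x. y \<in> ball x \<epsilon>"
      using \<epsilon>(1) by (intro eventually_nhds_in_open) auto
    from \<epsilon>(2) show ?thesis
    proof (elim disjE exE)
      fix v assume v: "\<forall>y\<in>ball x \<epsilon>. \<rho> y = y - v"
      have "isCont (\<lambda>y. \<psi> (y - v)) x"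
        using continuous_on_compose2[OF smooth_functionsD(1)[OF \<psi>(1)], of UNIV "\<lambda>y. y - v"]
        by (simp add: continuous_on_eq_continuous_at continuous_on_diff del: split_paired_All)
      then show ?thesis
        by (rule isCont_cong[THEN iffD1, rotated]) (use ev v in \<open>auto elim!: eventually_mono simp: g simp del: mem_ball\<close>)
    next
      assume v: "\<forall>y\<in>ball x \<epsilon>. \<rho> y \<in> N"
      have "isCont (\<lambda>y. 0::real) x" by simp
      then show ?thesis
        by (rule isCont_cong[THEN iffD1, rotated], intro eventually_mono[OF ev]) (use v \<psi>(2) in \<open>metis g\<close>)
    qed
  qed
  then show "continuous_on UNIV g" by (simp add: continuous_at_imp_continuous_on)
  fix e :: point assume e: "e \<in> Basis"
  have "\<forall>x\<in>N. partial e \<psi> x = 0" using \<rho> \<psi>(2) partial_zero_on_open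
    unfolding folds_into_def by blast
  then show "(\<forall>x. (\<lambda>t. g (x + t *\<^sub>R e)) field_differentiable at 0)
      \<and> partial e g \<in> {\<lambda>x. \<psi> (\<rho> x) |\<psi>. \<psi> \<in> smooth_functions \<and> (\<forall>x\<in>N. \<psi> x = 0)}"
    using fold_partial[OF \<rho> \<psi> e] partial_fold[OF \<rho> \<psi> e] smooth_functionsD(3)[OF \<psi>(1) e]
    by (intro conjI allI CollectI exI[of _ "partial e \<psi>"]) (auto simp: g field_differentiable_def)
qed (use assms in blast)

text \<open>The representative of \<open>t\<close> modulo \<open>p\<close> in \<open>[b, b + p)\<close>.\<close>

definition wrap :: "real \<Rightarrow> real \<Rightarrow> real \<Rightarrow> real" where
  "wrap p b t = t - p * of_int \<lfloor>(t - b) / p\<rfloor>"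

lemma wrap_id: "p > 0 \<Longrightarrow> b \<le> t \<Longrightarrow> t < b + p \<Longrightarrow> wrap p b t = t"
  unfolding wrap_def by (subst floor_unique[of 0]) (auto simp: field_simps)

lemma wrap_end: "p > 0 \<Longrightarrow> wrap p b (b + p) = b"
  unfolding wrap_def by simp

lemma wrap_periodic: "p > 0 \<Longrightarrow> wrap p b (t + p) = wrap p b t"
proof -
  assume "p > 0"
  then have "(t + p - b) / p = (t - b) / p + 1" by (simp add: field_simps)
  then show ?thesis by (simp add: wrap_def algebra_simps)
qed

text \<open>Away from the points \<open>b + p k\<close> the floor is locally constant; next to such a point the
  representative lies next to one of the ends of the cell.\<close>

lemma wrap_local:
  assumes "p > 0" "\<delta> > 0"
  shows "\<exists>\<epsilon>>0. (\<exists>c. \<forall>s. \<bar>s - t\<bar> < \<epsilon> \<longrightarrow> wrap p b s = s - c)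
    \<or> (\<forall>s. \<bar>s - t\<bar> < \<epsilon> \<longrightarrow> wrap p b s < b + \<delta> \<or> wrap p b s > b + p - \<delta>)"
proof -
  define k where "k = \<lfloor>(t - b) / p\<rfloor>"
  have k: "b + p * k \<le> t" "t < b + p * (k + 1)"
    using floor_correct[of "(t - b) / p"] assms(1) unfolding k_def[symmetric]
    by (simp_all add: pos_le_divide_eq pos_divide_less_eq algebra_simps)
  show ?thesis
  proof (cases "t = b + p * k")
    case True
    have "wrap p b s < b + \<delta> \<or> wrap p b s > b + p - \<delta>" if "\<bar>s - t\<bar> < min \<delta> p" for s
    proof (cases "s \<ge> t")
      case True
      then have "\<lfloor>(s - b) / p\<rfloor> = k" using that \<open>t = _\<close> assms(1) k by (intro floor_unique) (auto simp: field_simps)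
      then show ?thesis using that \<open>t = _\<close> by (auto simp: wrap_def)
    next
      case False
      then have "\<lfloor>(s - b) / p\<rfloor> = k - 1" using that \<open>t = _\<close> assms(1) k by (intro floor_unique) (auto simp: field_simps)
      then show ?thesis using that \<open>t = _\<close> by (auto simp: wrap_def algebra_simps)
    qed
    then show ?thesis using assms by (intro exI[of _ "min \<delta> p"]) auto
  next
    case False
    have "wrap p b s = s - p * k" if "\<bar>s - t\<bar> < min (t - (b + p * k)) (b + p * (k + 1) - t)" for s
    proof -
      have "\<lfloor>(s - b) / p\<rfloor> = k" using that assms(1) by (intro floor_unique) (auto simp: field_simps)
      then show ?thesis by (simp add: wrap_def)
    qed
    then show ?thesis using False k by (intro exI[of _ "min (t - (b + p * k)) (b + p * (k + 1) - t)"]) auto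
  qed
qed

text \<open>Reduction of the coordinate along \<open>e\<close> to the period cell \<open>[b, b + p)\<close>. On the collar, which
  consists of the points with that coordinate less than \<open>\<delta>\<close> away from the ends of the cell or outside
  the cell, the test functions to be extended vanish.\<close>

definition fold_along :: "point \<Rightarrow> real \<Rightarrow> real \<Rightarrow> point \<Rightarrow> point" where
  "fold_along e p b x = x - (x \<bullet> e - wrap p b (x \<bullet> e)) *\<^sub>R e"

definition collar :: "point \<Rightarrow> real \<Rightarrow> real \<Rightarrow> real \<Rightarrow> point set" where
  "collar e p b \<delta> = {x. x \<bullet> e < b + \<delta> \<or> x \<bullet> e > b + p - \<delta>}"

lemma inner_basis [simp]: "x \<bullet> e_theta = fst x" "x \<bullet> e_z = snd x"
  by (simp_all add: e_theta_def e_z_def inner_prod_def)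

lemma fold_along_inner: "e \<in> Basis \<Longrightarrow> fold_along e p b x \<bullet> e = wrap p b (x \<bullet> e)"
  by (simp add: fold_along_def inner_diff_left)

lemma fold_along_coordinates:
  "fold_along e_theta p b x = (wrap p b (fst x), snd x)" "fold_along e_z p b x = (fst x, wrap p b (snd x))"
  by (auto simp: fold_along_def prod_eq_iff) (auto simp: e_theta_def e_z_def)

lemma folds_fold_along:
  assumes e: "e \<in> Basis" and p: "p > 0" and \<delta>: "\<delta> > 0"
  shows "folds_into (collar e p b \<delta>) (fold_along e p b)"
  unfolding folds_into_def
proof (intro conjI allI)
  show "open (collar e p b \<delta>)" unfolding collar_def by (intro open_Collect_disj open_Collect_less continuous_intros)
  fix x :: point
  obtain \<epsilon> where \<epsilon>: "\<epsilon> > 0" "(\<exists>c. \<forall>s. \<bar>s - x \<bullet> e\<bar> < \<epsilon> \<longrightarrow> wrap p b s = s - c)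
    \<or> (\<forall>s. \<bar>s - x \<bullet> e\<bar> < \<epsilon> \<longrightarrow> wrap p b s < b + \<delta> \<or> wrap p b s > b + p - \<delta>)"
    using wrap_local[OF p \<delta>] by blast
  have near: "\<bar>y \<bullet> e - x \<bullet> e\<bar> < \<epsilon>" if "y \<in> ball x \<epsilon>" for y
    using that Basis_le_norm[OF e, of "y - x"] by (simp add: inner_diff_left dist_norm norm_minus_commute)
  from \<epsilon>(2) show "\<exists>\<epsilon>>0. (\<exists>v. \<forall>y\<in>ball x \<epsilon>. fold_along e p b y = y - v) \<or> (\<forall>y\<in>ball x \<epsilon>. fold_along e p b y \<in> collar e p b \<delta>)"
  proof (elim disjE exE)
    fix c assume c: "\<forall>s. \<bar>s - x \<bullet> e\<bar> < \<epsilon> \<longrightarrow> wrap p b s = s - c"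
    have "fold_along e p b y = y - c *\<^sub>R e" if "y \<in> ball x \<epsilon>" for y
      using c near[OF that] by (simp add: fold_along_def)
    then show ?thesis using \<epsilon>(1) by blast
  next
    assume c: "\<forall>s. \<bar>s - x \<bullet> e\<bar> < \<epsilon> \<longrightarrow> wrap p b s < b + \<delta> \<or> wrap p b s > b + p - \<delta>"
    have "fold_along e p b y \<in> collar e p b \<delta>" if "y \<in> ball x \<epsilon>" for y
      using c near[OF that] by (simp add: collar_def fold_along_inner[OF e])
    then show ?thesis using \<epsilon>(1) by blast
  qed
qed

text \<open>Only the upper end of the closed cell is moved, namely to the lower end, and both ends are in the
  collar.\<close>

lemma fold_along_closed_cell:
  assumes "e \<in> Basis" "p > 0" "\<delta> > 0" "b \<le> x \<bullet> e" "x \<bullet> e \<le> b + p"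
  shows "fold_along e p b x = x \<or> (x \<in> collar e p b \<delta> \<and> fold_along e p b x \<in> collar e p b \<delta>)"
proof (cases "x \<bullet> e = b + p")
  case True
  then show ?thesis using assms wrap_end[of p b] by (simp add: collar_def fold_along_inner)
next
  case False
  then show ?thesis using assms wrap_id[of p b "x \<bullet> e"] by (simp add: fold_along_def)
qed

lemma interior_test_collar:
  assumes "\<psi> \<in> interior_tests"
  shows "\<exists>\<delta>>0. \<forall>x\<in>collar e_z 1 (-1/2) \<delta> \<union> collar e_theta (2*pi) 0 \<delta>. \<psi> x = 0"
proof -
  let ?K = "closure {x. \<psi> x \<noteq> 0}"
  have K: "?K \<subseteq> interior Omega" using assms by (simp add: interior_tests_def)
  have "bounded Omega" unfolding Omega_def by (intro bounded_Times) auto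
  then have "compact ?K" using K by (meson bounded_subset closed_closure compact_eq_bounded_closed interior_subset subset_trans)
  then obtain d where d: "d > 0" "(\<Union>x\<in>?K. ball x d) \<subseteq> interior Omega"
    using compact_subset_open_imp_ball_epsilon_subset[OF _ open_interior K] by blast
  have "\<psi> x = 0" if x: "x \<in> collar e_z 1 (-1/2) (d/2) \<union> collar e_theta (2*pi) 0 (d/2)" for x
  proof (rule ccontr)
    assume "\<psi> x \<noteq> 0"
    then have "x \<in> ?K" using closure_subset by fastforce
    then have sub: "ball x d \<subseteq> interior Omega" using d(2) by blast
    have "x + (0, d/2) \<in> ball x d" "x - (0, d/2) \<in> ball x d" "x + (d/2, 0) \<in> ball x d" "x - (d/2, 0) \<in> ball x d"
      using d(1) by (auto simp: dist_norm norm_Pair)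
    then have "x + (0, d/2) \<in> interior Omega" "x - (0, d/2) \<in> interior Omega"
      "x + (d/2, 0) \<in> interior Omega" "x - (d/2, 0) \<in> interior Omega" using sub by blast+
    with x show False unfolding interior_Omega by (cases x) (auto simp: collar_def)
  qed
  then show ?thesis using d(1) by (intro exI[of _ "d/2"]) auto
qed

text \<open>This connects the two notions of weak derivative: every interior test is the restriction of a
  periodic one, so a derivative on the torus is also a derivative on the open rectangle. The extension
  is done one coordinate at a time; after the first step the function still vanishes near the ends of the
  other coordinate.\<close>

lemma periodic_extension:
  assumes "\<psi> \<in> interior_tests"
  obtains \<Psi> where "\<Psi> \<in> periodic_tests" "\<And>x. x \<in> Omega \<Longrightarrow> \<Psi> x = \<psi> x"
    "\<And>x e. x \<in> Omega \<Longrightarrow> e \<in> Basis \<Longrightarrow> partial e \<Psi> x = partial e \<psi> x"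
proof -
  let ?cz = "collar e_z 1 (-1/2)" and ?fz = "fold_along e_z 1 (-1/2)"
  let ?ct = "collar e_theta (2*pi) 0" and ?ft = "fold_along e_theta (2*pi) 0"
  obtain \<delta> where \<delta>: "\<delta> > 0" "\<And>x. x \<in> ?cz \<delta> \<Longrightarrow> \<psi> x = 0" "\<And>x. x \<in> ?ct \<delta> \<Longrightarrow> \<psi> x = 0"
    using interior_test_collar[OF assms] by blast
  have \<psi>: "\<psi> \<in> smooth_functions" using assms by (simp add: interior_tests_def)
  have fz: "folds_into (?cz \<delta>) ?fz" and ft: "folds_into (?ct \<delta>) ?ft"
    by (rule folds_fold_along; use \<delta>(1) in \<open>simp add: Basis_point\<close>)+
  have o: "open (?cz \<delta>)" "open (?ct \<delta>)" using fz ft by (auto simp: folds_into_def)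
  have cell: "?fz x = x \<or> (x \<in> ?cz \<delta> \<and> ?fz x \<in> ?cz \<delta>)" "?ft x = x \<or> (x \<in> ?ct \<delta> \<and> ?ft x \<in> ?ct \<delta>)" if "x \<in> Omega" for x
    by (rule fold_along_closed_cell; use \<delta>(1) that in \<open>auto simp: Basis_point Omega_def\<close>)+
  define \<phi> where "\<phi> = (\<lambda>x. \<psi> (?fz x))"
  have \<phi>: "\<phi> \<in> smooth_functions" unfolding \<phi>_def by (rule smooth_fold[OF fz \<psi> \<delta>(2)])
  have \<phi>0: "\<phi> x = 0" if "x \<in> ?ct \<delta>" for x
    using that \<delta>(3)[of "?fz x"] by (simp add: \<phi>_def collar_def fold_along_coordinates)
  define \<Psi> where "\<Psi> = (\<lambda>x. \<phi> (?ft x))"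
  have \<Psi>: "\<Psi> \<in> smooth_functions" unfolding \<Psi>_def by (rule smooth_fold[OF ft \<phi> \<phi>0])
  have "\<Psi> \<in> periodic_tests" unfolding periodic_tests_def using \<Psi>
    by (simp add: \<Psi>_def \<phi>_def fold_along_coordinates wrap_periodic)
  moreover have "\<Psi> x = \<psi> x" if "x \<in> Omega" for x
  proof -
    have "\<phi> x = \<psi> x" using cell(1)[OF that] \<delta>(2) unfolding \<phi>_def by metis
    moreover have "\<Psi> x = \<phi> x" using cell(2)[OF that] \<phi>0 unfolding \<Psi>_def by metis
    ultimately show ?thesis by simp
  qed
  moreover have "partial e \<Psi> x = partial e \<psi> x" if "x \<in> Omega" "e \<in> Basis" for x e
  proof -
    have "partial e \<Psi> x = partial e \<phi> (?ft x)"
      unfolding \<Psi>_def by (simp add: partial_fold[OF ft \<phi> \<phi>0 that(2)])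
    moreover have "partial e \<phi> = (\<lambda>x. partial e \<psi> (?fz x))"
      unfolding \<phi>_def by (rule partial_fold[OF fz \<psi> \<delta>(2) that(2)])
    moreover have "y \<in> ?cz \<delta> \<Longrightarrow> partial e \<psi> y = 0" for y
      by (rule partial_zero_on_open[OF o(1) \<delta>(2)])
    moreover have "y \<in> ?ct \<delta> \<Longrightarrow> partial e \<phi> y = 0" for y
      by (rule partial_zero_on_open[OF o(2) \<phi>0])
    ultimately show ?thesis using cell[OF that(1)] by metis
  qed
  ultimately show ?thesis using that by blast
qed

text \<open>A bump in one coordinate only, extended periodically, has zero derivative in the other coordinate.
  Testing with it shows that a periodic weak derivative has mean zero on almost every line.\<close>

lemma periodic_bump:
  assumes dir: "e = e_theta \<and> e' = e_z \<and> p = 2 * pi \<and> c = 0 \<or> e = e_z \<and> e' = e_theta \<and> p = 1 \<and> c = -1/2"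
    and b: "b \<in> bumps c (c + p)"
  obtains \<Psi> where "\<Psi> \<in> periodic_tests" "\<And>x. x \<in> Omega \<Longrightarrow> \<Psi> x = b (x \<bullet> e)" "partial e' \<Psi> = (\<lambda>x. 0)"
proof -
  have ep: "e \<in> Basis" "p > 0" using dir by (auto simp: Basis_point)
  obtain s t where st: "c < s" "t < c + p" "\<And>x. x \<notin> {s..t} \<Longrightarrow> b x = 0" using b by (auto simp: bumps_def)
  define \<delta> where "\<delta> = min (s - c) (c + p - t)"
  have \<delta>: "\<delta> > 0" using st by (auto simp: \<delta>_def)
  define \<psi> where "\<psi> = (\<lambda>x::point. b (x \<bullet> e))"
  have \<psi>: "\<psi> \<in> smooth_functions" unfolding \<psi>_def
    using dir smooth_product[OF smooth1_const[of 1] bumpsD[OF b]] smooth_product[OF bumpsD[OF b] smooth1_const[of 1]] by auto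
  have 0: "\<psi> x = 0" if "x \<in> collar e p c \<delta>" for x
    using that st(3)[of "x \<bullet> e"] by (cases "x \<bullet> e \<in> {s..t}") (auto simp: \<psi>_def collar_def \<delta>_def)
  note f = folds_fold_along[OF ep \<delta>]
  let ?\<Psi> = "\<lambda>x. \<psi> (fold_along e p c x)"
  have eq: "?\<Psi> = (\<lambda>x. b (wrap p c (x \<bullet> e)))" by (simp add: \<psi>_def fold_along_inner[OF ep(1)])
  have "?\<Psi> \<in> smooth_functions" by (rule smooth_fold[OF f \<psi> 0])
  then have "?\<Psi> \<in> periodic_tests" unfolding periodic_tests_def eq using dir by (auto simp: wrap_periodic)
  moreover have "?\<Psi> x = b (x \<bullet> e)" if "x \<in> Omega" for x
  proof -
    have "c \<le> x \<bullet> e" "x \<bullet> e \<le> c + p" using that dir by (auto simp: Omega_def)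
    from fold_along_closed_cell[OF ep \<delta> this] show ?thesis using 0 unfolding \<psi>_def by metis
  qed
  moreover have "partial e' ?\<Psi> = (\<lambda>x. 0)"
    unfolding eq partial_def using dir by (auto simp: e_theta_def e_z_def)
  ultimately show ?thesis using that by blast
qed

section \<open>The fundamental lemma of the calculus of variations\<close>

text \<open>Lebesgue measure on an interval as a measure of its own, so that the measure on the rectangle becomes
  a product of two finite measures and the Fubini theorems apply directly.\<close>

definition Leb :: "real \<Rightarrow> real \<Rightarrow> real measure" where
  "Leb a b = restrict_space lborel {a..b}"

abbreviation Rect :: "real \<Rightarrow> real \<Rightarrow> real \<Rightarrow> real \<Rightarrow> (real \<times> real) measure" where
  "Rect a b c d \<equiv> Leb a b \<Otimes>\<^sub>M Leb c d"

lemma space_Leb [simp]: "space (Leb a b) = {a..b}" by (simp add: Leb_def space_restrict_space)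

lemma finite_measure_Leb: "finite_measure (Leb a b)"
  by (rule finite_measureI) (simp add: Leb_def emeasure_restrict_space emeasure_lborel_Icc_eq space_restrict_space)

interpretation Leb: finite_measure "Leb a b" by (rule finite_measure_Leb)

interpretation Leb2: pair_sigma_finite "Leb a b" "Leb c d" by standard

lemma finite_measure_Leb2: "finite_measure (Rect a b c d)"
  by (intro finite_measure_pair_measure finite_measure_Leb)

interpretation Leb2: finite_measure "Rect a b c d" by (rule finite_measure_Leb2)

lemma measurable_Leb [measurable (raw)]: "f \<in> borel_measurable borel \<Longrightarrow> f \<in> borel_measurable (Leb a b)"
  unfolding Leb_def by (simp add: measurable_restrict_space1)

lemma sets_Leb_iff: "A \<in> sets (Leb a b) \<longleftrightarrow> A \<in> sets borel \<and> A \<subseteq> {a..b}"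
  by (subst Leb_def, subst sets_restrict_space_iff) auto

lemma emeasure_Leb: "A \<subseteq> {a..b} \<Longrightarrow> emeasure (Leb a b) A = emeasure lborel A"
  by (simp add: Leb_def emeasure_restrict_space)

lemma Omega_measure_product: "Omega_measure = Rect 0 (2*pi) (-1/2) (1/2)"
proof -
  have O: "Omega \<in> sets borel" unfolding Omega_def by (intro borel_closed closed_Times) auto
  let ?P = "Rect 0 (2*pi) (-1/2) (1/2)"
  have sp: "space ?P = Omega" by (simp add: space_pair_measure Omega_def)
  have sp': "space Omega_measure = Omega" unfolding Omega_measure_def using O by (simp add: space_restrict_space2)
  have 1: "(\<lambda>x. x) \<in> measurable Omega_measure ?P"
  proof (rule measurable_pair)
    show "fst \<circ> (\<lambda>x. x) \<in> measurable Omega_measure (Leb 0 (2*pi))"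
      unfolding Leb_def Omega_measure_def
      by (rule measurable_restrict_space2, use O in \<open>auto simp: space_restrict_space Omega_def\<close>, rule measurable_restrict_space1)
         (simp add: comp_def flip: lborel_prod)
    show "snd \<circ> (\<lambda>x. x) \<in> measurable Omega_measure (Leb (-1/2) (1/2))"
      unfolding Leb_def Omega_measure_def
      by (rule measurable_restrict_space2, use O in \<open>auto simp: space_restrict_space Omega_def\<close>, rule measurable_restrict_space1)
         (simp add: comp_def flip: lborel_prod)
  qed
  have 2: "(\<lambda>x. x) \<in> measurable ?P Omega_measure"
    unfolding Omega_measure_def
  proof (rule measurable_restrict_space2)
    show "(\<lambda>x. x) \<in> ?P \<rightarrow>\<^sub>M lborel" unfolding lborel_prod[symmetric]
    proof (rule measurable_pair)
      have "(\<lambda>x. x) \<in> measurable (Leb a b) lborel" for a b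
        unfolding Leb_def by (rule measurable_restrict_space1) simp
      then show "fst \<circ> (\<lambda>x. x) \<in> ?P \<rightarrow>\<^sub>M lborel" "snd \<circ> (\<lambda>x. x) \<in> ?P \<rightarrow>\<^sub>M lborel"
        unfolding comp_def by (auto intro: measurable_compose[OF measurable_fst] measurable_compose[OF measurable_snd])
    qed
    show "(\<lambda>x. x) \<in> space ?P \<rightarrow> Omega" unfolding sp by simp
  qed
  have "sets ?P = sets Omega_measure"
  proof (intro equalityI subsetI)
    fix A assume A: "A \<in> sets ?P"
    from sets.sets_into_space[OF A] measurable_sets[OF 1 A] show "A \<in> sets Omega_measure"
      unfolding sp sp' by (simp add: Int_absorb2)
  next
    fix A assume A: "A \<in> sets Omega_measure"
    from sets.sets_into_space[OF A] measurable_sets[OF 2 A] show "A \<in> sets ?P"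
      unfolding sp sp' by (simp add: Int_absorb2)
  qed
  moreover have "emeasure (Leb 0 (2*pi)) A * emeasure (Leb (-1/2) (1/2)) B = emeasure Omega_measure (A \<times> B)"
    if "A \<in> sets (Leb 0 (2*pi))" "B \<in> sets (Leb (-1/2) (1/2))" for A B
  proof -
    have AB: "A \<in> sets borel" "B \<in> sets borel" "A \<subseteq> {0..2*pi}" "B \<subseteq> {-1/2..1/2}" using that by (auto simp: sets_Leb_iff)
    then have "emeasure Omega_measure (A \<times> B) = emeasure lborel (A \<times> B)"
      unfolding Omega_measure_def using O by (subst emeasure_restrict_space) (auto simp: Omega_def)
    also have "\<dots> = emeasure lborel A * emeasure lborel B"
      unfolding lborel_prod[symmetric] using AB by (intro lborel.emeasure_pair_measure_Times) auto
    finally show ?thesis using AB by (simp add: emeasure_Leb)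
  qed
  ultimately show ?thesis
    by (intro pair_measure_eqI[symmetric]) (auto intro: finite_measure.axioms finite_measure_Leb)
qed

lemma integrable_mult_bounded:
  fixes f h :: "'a \<Rightarrow> real"
  assumes "integrable M f" "h \<in> borel_measurable M" "\<And>x. x \<in> space M \<Longrightarrow> \<bar>h x\<bar> \<le> B"
  shows "integrable M (\<lambda>x. f x * h x)"
proof (rule Bochner_Integration.integrable_bound[of M "\<lambda>x. B * f x"])
  show "AE x in M. norm (f x * h x) \<le> norm (B * f x)"
  proof (rule AE_I2)
    fix x assume "x \<in> space M"
    then have "\<bar>h x\<bar> \<le> \<bar>B\<bar>" using assms(3)[of x] by linarith
    then show "norm (f x * h x) \<le> norm (B * f x)"
      by (simp add: abs_mult mult.commute[of "\<bar>B\<bar>"] mult_left_mono)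
  qed
qed (use assms in \<open>auto intro: borel_measurable_times\<close>)

text \<open>The open intervals form a generator that is closed under intersection, and the sets over which \<open>v\<close>
  integrates to zero form a Dynkin system.\<close>

lemma AE_zero_if_interval_integrals_zero:
  fixes v :: "real \<Rightarrow> real"
  assumes v: "integrable lborel v" and 0: "\<And>a b. (\<integral>x. indicator {a<..<b} x * v x \<partial>lborel) = 0"
  shows "AE x in lborel. v x = 0"
proof (rule sigma_finite_measure.density_zero[OF sigma_finite_lborel v])
  have si: "set_integrable lborel A v" if "A \<in> sets borel" for A
    unfolding set_integrable_def using v that by (intro integrable_mult_indicator) auto
  have U: "set_lebesgue_integral lborel UNIV v = 0"
  proof -
    have "(\<lambda>n. \<integral>x. indicator {- real n<..<real n} x * v x \<partial>lborel) \<longlonglongrightarrow> (\<integral>x. v x \<partial>lborel)"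
    proof (rule integral_dominated_convergence[where w="\<lambda>x. \<bar>v x\<bar>"])
      show "AE x in lborel. (\<lambda>n. indicator {- real n<..<real n} x * v x) \<longlonglongrightarrow> v x"
      proof (rule AE_I2)
        fix x :: real
        have "\<forall>\<^sub>F n in sequentially. indicator {- real n<..<real n} x * v x = v x"
          using eventually_gt_at_top[of "nat \<lceil>\<bar>x\<bar>\<rceil>"]
        proof eventually_elim
          case (elim n)
          then have "\<bar>x\<bar> < real n" by linarith
          then show ?case by (auto simp: indicator_def)
        qed
        then show "(\<lambda>n. indicator {- real n<..<real n} x * v x) \<longlonglongrightarrow> v x" by (rule tendsto_eventually)
      qed
    qed (use v in \<open>auto simp: indicator_def\<close>)
    then show ?thesis using LIMSEQ_unique[OF _ tendsto_const] by (simp add: 0 set_lebesgue_integral_def)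
  qed
  have sb: "sets (borel :: real measure) = sigma_sets UNIV (range (\<lambda>(a, b). {a<..<b}))"
  proof -
    have fn: "(\<lambda>(a, b). box a b) = (\<lambda>(a, b). {a<..<b::real})" by (auto simp: fun_eq_iff box_def)
    then show ?thesis by (subst borel_eq_box, subst fn) simp
  qed
  fix A :: "real set" assume "A \<in> sets lborel"
  then have A: "A \<in> sigma_sets UNIV (range (\<lambda>(a, b). {a<..<b}))" using sb by simp
  have "Int_stable (range (\<lambda>(a, b). {a<..<b::real}))" by (auto simp: Int_stable_def)
  moreover have "range (\<lambda>(a, b). {a<..<b::real}) \<subseteq> Pow UNIV" by simp
  ultimately show "set_lebesgue_integral lborel A v = 0" using A
  proof (induct rule: sigma_sets_induct_disjoint)
    case (basic A)
    then show ?case using 0 by (auto simp: set_lebesgue_integral_def)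
  next
    case (compl A)
    then have A: "A \<in> sets borel" using sb by simp
    have "set_lebesgue_integral lborel (A \<union> (UNIV - A)) v =
      set_lebesgue_integral lborel A v + set_lebesgue_integral lborel (UNIV - A) v"
      using A by (intro set_integral_Un si) auto
    then show ?case using compl U by simp
  next
    case (union A)
    then have A: "A i \<in> sets borel" for i using sb by auto
    have "set_lebesgue_integral lborel (\<Union>i. A i) v = (\<Sum>i. set_lebesgue_integral lborel (A i) v)"
      using A union(1) by (intro lebesgue_integral_countable_add si) (auto simp: disjoint_family_on_def)
    then show ?case using union by simp
  qed (auto simp: set_lebesgue_integral_def)
qed

text \<open>A countable family of tests. Countability is what allows the exceptional null sets of single
  tests to be collected into one null set of lines.\<close>

definition rat_humps :: "real \<Rightarrow> real \<Rightarrow> (real \<Rightarrow> real) set" where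
  "rat_humps a b = {hump s t n |s t n. s \<in> \<rat> \<and> t \<in> \<rat> \<and> a \<le> s \<and> t \<le> b}"

lemma countable_rat_humps: "countable (rat_humps a b)"
proof (rule countable_subset)
  show "rat_humps a b \<subseteq> (\<lambda>(s, t, n). hump s t n) ` (\<rat> \<times> \<rat> \<times> UNIV)" by (force simp: rat_humps_def)
qed (auto simp: countable_rat)

lemma rat_humps_bumps: "u \<in> rat_humps a b \<Longrightarrow> u \<in> bumps a b"
  by (auto simp: rat_humps_def hump_bumps)

lemma rat_humps_bound: "u \<in> rat_humps a b \<Longrightarrow> \<bar>u x\<bar> \<le> 1"
  using hump_bounds by (auto simp: rat_humps_def abs_le_iff intro: order_trans[of _ 0])

lemma rat_humps_measurable [measurable (raw)]: "u \<in> rat_humps a b \<Longrightarrow> u \<in> borel_measurable borel"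
  using rat_humps_bumps bumpsD smooth1_measurable by blast

lemma fundamental_lemma_variations:
  fixes v :: "real \<Rightarrow> real"
  assumes v: "integrable (Leb c d) v" and 0: "\<And>u. u \<in> rat_humps c d \<Longrightarrow> (\<integral>y. v y * u y \<partial>Leb c d) = 0"
  shows "AE y in Leb c d. v y = 0"
proof -
  \<comment> \<open>Rational end points converging to \<open>a\<close> and \<open>b\<close> from inside, one hump for each index.\<close>
  have I: "(\<integral>y. v y * indicator {a<..<b} y \<partial>Leb c d) = 0" if "c \<le> a" "b \<le> d" "a < b" for a b
  proof -
    have "\<exists>s. \<forall>n. s n \<in> \<rat> \<and> a < s n \<and> s n < a + 1 / real (Suc n)"
      by (intro choice allI) (use Rats_dense_in_real[of a "a + 1 / real (Suc n)" for n] in fastforce)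
    then obtain s where s: "\<And>n. s n \<in> \<rat>" "\<And>n. a < s n" "\<And>n. s n < a + 1 / real (Suc n)" by blast
    have "\<exists>t. \<forall>n. t n \<in> \<rat> \<and> b - 1 / real (Suc n) < t n \<and> t n < b"
      by (intro choice allI) (use Rats_dense_in_real[of "b - 1 / real (Suc n)" b for n] in fastforce)
    then obtain t where t: "\<And>n. t n \<in> \<rat>" "\<And>n. b - 1 / real (Suc n) < t n" "\<And>n. t n < b" by blast
    have ls: "s \<longlonglongrightarrow> a"
      by (rule tendsto_sandwich[of "\<lambda>n. a" _ _ "\<lambda>n. a + 1 / real (Suc n)"])
         (use s tendsto_add[OF tendsto_const LIMSEQ_Suc[OF lim_1_over_n], of a] in \<open>auto intro!: always_eventually less_imp_le\<close>)
    have lt: "t \<longlonglongrightarrow> b"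
      by (rule tendsto_sandwich[of "\<lambda>n. b - 1 / real (Suc n)" _ _ "\<lambda>n. b"])
         (use t tendsto_diff[OF tendsto_const LIMSEQ_Suc[OF lim_1_over_n], of b] in \<open>auto intro!: always_eventually less_imp_le\<close>)
    have h: "hump (s n) (t n) n \<in> rat_humps c d" for n
      unfolding rat_humps_def mem_Collect_eq
      using s(1,2)[of n] t(1,3)[of n] that less_imp_le[of a "s n"] less_imp_le[of "t n" b]
      by (intro exI[of _ "s n"] exI[of _ "t n"] exI[of _ n]) auto
    have "(\<lambda>n. \<integral>y. v y * hump (s n) (t n) n y \<partial>Leb c d) \<longlonglongrightarrow> (\<integral>y. v y * indicator {a<..<b} y \<partial>Leb c d)"
    proof (rule integral_dominated_convergence[where w="\<lambda>x. \<bar>v x\<bar>"])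
      show "AE y in Leb c d. (\<lambda>n. v y * hump (s n) (t n) n y) \<longlonglongrightarrow> v y * indicator {a<..<b} y"
        by (intro AE_I2 tendsto_mult tendsto_const hump_tendsto s t ls lt)
      show "AE y in Leb c d. norm (v y * hump (s n) (t n) n y) \<le> \<bar>v y\<bar>" for n
        using hump_bounds[of "s n" "t n" n] by (intro AE_I2) (simp add: abs_mult mult_left_le)
      show "(\<lambda>y. v y * hump (s n) (t n) n y) \<in> borel_measurable (Leb c d)" for n
        by (rule borel_measurable_times[OF borel_measurable_integrable[OF v] measurable_Leb[OF rat_humps_measurable[OF h[of n]]]])
      show "(\<lambda>y. v y * indicator {a<..<b} y) \<in> borel_measurable (Leb c d)"
        by (rule borel_measurable_times[OF borel_measurable_integrable[OF v] measurable_Leb]) simp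
    qed (use v in auto)
    then show ?thesis using 0[OF h] LIMSEQ_unique[OF _ tendsto_const] by simp
  qed
  define w where "w = (\<lambda>y. indicator {c..d} y * v y)"
  have "AE x in lborel. w x = 0"
  proof (rule AE_zero_if_interval_integrals_zero)
    show "integrable lborel w" using v unfolding w_def Leb_def by (simp add: integrable_restrict_space)
    fix a b
    let ?a = "max a c" and ?b = "min b d"
    have "(\<integral>x. indicator {a<..<b} x * w x \<partial>lborel) = (\<integral>x. indicator {c..d} x * (v x * indicator {?a<..<?b} x) \<partial>lborel)"
    proof (rule integral_cong_AE)
      show "AE x in lborel. indicator {a<..<b} x * w x = indicator {c..d} x * (v x * indicator {?a<..<?b} x)"
        using AE_lborel_singleton[of c] AE_lborel_singleton[of d]
        by eventually_elim (auto simp: w_def indicator_def)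
      have [measurable]: "w \<in> borel_measurable borel" using \<open>integrable lborel w\<close> by simp
      show "(\<lambda>x. indicator {a<..<b} x * w x) \<in> borel_measurable lborel" by simp
      have "(\<lambda>x. indicator {c..d} x * (v x * indicator {?a<..<?b} x)) = (\<lambda>x. w x * indicator {?a<..<?b} x)"
        by (auto simp: w_def)
      then show "(\<lambda>x. indicator {c..d} x * (v x * indicator {?a<..<?b} x)) \<in> borel_measurable lborel" by simp
    qed
    also have "\<dots> = (\<integral>y. v y * indicator {?a<..<?b} y \<partial>Leb c d)"
      unfolding Leb_def by (subst integral_restrict_space) auto
    also have "\<dots> = 0"
      using I[of ?a ?b] by (cases "?a < ?b") auto
    finally show "(\<integral>x. indicator {a<..<b} x * w x \<partial>lborel) = 0" .
  qed
  then show ?thesis unfolding Leb_def by (subst AE_restrict_space_iff) (auto simp: w_def elim!: eventually_mono)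
qed

text \<open>An identity tested with products \<open>\<alpha>(x) \<beta>(y)\<close> for all \<open>\<alpha>\<close> holds on almost every line: the difference of
  the two line integrals is a function of \<open>x\<close> to which the one-dimensional fundamental lemma applies.\<close>

lemma slice_identity:
  fixes f g :: "real \<times> real \<Rightarrow> real"
  assumes f: "integrable (Rect a b c d) f" and g: "integrable (Rect a b c d) g"
    and \<beta>: "\<beta> \<in> borel_measurable borel" "\<And>y. \<bar>\<beta> y\<bar> \<le> B"
    and \<gamma>: "\<gamma> \<in> borel_measurable borel" "\<And>y. \<bar>\<gamma> y\<bar> \<le> C"
    and eq: "\<And>\<alpha>. \<alpha> \<in> rat_humps a b \<Longrightarrow>
      (\<integral>x. f x * (\<alpha> (fst x) * \<beta> (snd x)) \<partial>Rect a b c d) = (\<integral>x. g x * (\<alpha> (fst x) * \<gamma> (snd x)) \<partial>Rect a b c d)"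
  shows "AE x in Leb a b. (\<integral>y. f (x, y) * \<beta> y \<partial>Leb c d) = (\<integral>y. g (x, y) * \<gamma> y \<partial>Leb c d)"
proof -
  let ?P = "Rect a b c d"
  have m: "(\<lambda>x. h (snd x)) \<in> borel_measurable ?P" "(\<lambda>x. h (fst x)) \<in> borel_measurable ?P"
    if "h \<in> borel_measurable borel" for h :: "real \<Rightarrow> real"
    using measurable_compose[OF measurable_snd measurable_Leb[OF that]]
      measurable_compose[OF measurable_fst measurable_Leb[OF that]] by auto
  have fi: "integrable ?P (\<lambda>x. f x * \<beta> (snd x))" and gi: "integrable ?P (\<lambda>x. g x * \<gamma> (snd x))"
    using \<beta> \<gamma> by (auto intro!: integrable_mult_bounded f g m)
  define V where "V = (\<lambda>x. (\<integral>y. f (x, y) * \<beta> y \<partial>Leb c d) - (\<integral>y. g (x, y) * \<gamma> y \<partial>Leb c d))"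
  have Vf: "integrable (Leb a b) (\<lambda>x. \<integral>y. f (x, y) * \<beta> y \<partial>Leb c d)" and
    Vg: "integrable (Leb a b) (\<lambda>x. \<integral>y. g (x, y) * \<gamma> y \<partial>Leb c d)"
    using Leb2.integrable_fst'[OF fi] Leb2.integrable_fst'[OF gi] by simp_all
  have "AE x in Leb a b. V x = 0"
  proof (rule fundamental_lemma_variations)
    show "integrable (Leb a b) V" unfolding V_def using Vf Vg by simp
    fix u assume u: "u \<in> rat_humps a b"
    have um: "u \<in> borel_measurable borel" using u by simp
    have I: "(\<integral>x. (\<integral>y. h (x, y) * \<eta> y \<partial>Leb c d) * u x \<partial>Leb a b) = (\<integral>x. h x * (u (fst x) * \<eta> (snd x)) \<partial>?P)"
      if "integrable ?P (\<lambda>x. h x * \<eta> (snd x))" for h \<eta>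
    proof -
      have i: "integrable ?P (\<lambda>x. h x * \<eta> (snd x) * u (fst x))"
        by (rule integrable_mult_bounded[OF that m(2)[OF um] rat_humps_bound[OF u]])
      have "(\<integral>x. (\<integral>y. h (x, y) * \<eta> y \<partial>Leb c d) * u x \<partial>Leb a b) = (\<integral>x. (\<integral>y. h (x, y) * \<eta> y * u x \<partial>Leb c d) \<partial>Leb a b)"
        by (simp only: integral_mult_left_zero)
      also have "\<dots> = (\<integral>x. h x * \<eta> (snd x) * u (fst x) \<partial>?P)"
        using Leb2.integral_fst'[OF i] unfolding fst_conv snd_conv .
      also have "\<dots> = (\<integral>x. h x * (u (fst x) * \<eta> (snd x)) \<partial>?P)"
        by (rule Bochner_Integration.integral_cong) auto
      finally show ?thesis .
    qed
    have "(\<integral>x. V x * u x \<partial>Leb a b) = (\<integral>x. (\<integral>y. f (x, y) * \<beta> y \<partial>Leb c d) * u x \<partial>Leb a b) - (\<integral>x. (\<integral>y. g (x, y) * \<gamma> y \<partial>Leb c d) * u x \<partial>Leb a b)"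
      unfolding V_def left_diff_distrib
      by (intro Bochner_Integration.integral_diff integrable_mult_bounded[where B=1] Vf Vg measurable_Leb um rat_humps_bound[OF u])
    also have "\<dots> = 0" using eq[OF u] by (simp add: I[OF fi] I[OF gi])
    finally show "(\<integral>x. V x * u x \<partial>Leb a b) = 0" .
  qed
  then show ?thesis by eventually_elim (simp add: V_def)
qed

lemma fundamental_lemma_product:
  fixes v :: "real \<times> real \<Rightarrow> real"
  assumes v: "integrable (Rect a b c d) v"
    and eq: "\<And>\<alpha> \<beta>. \<alpha> \<in> rat_humps a b \<Longrightarrow> \<beta> \<in> rat_humps c d \<Longrightarrow>
      (\<integral>x. v x * (\<alpha> (fst x) * \<beta> (snd x)) \<partial>Rect a b c d) = 0"
  shows "AE x in Rect a b c d. v x = 0"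
proof (rule Leb2.AE_pair_measure)
  show "{x \<in> space (Rect a b c d). v x = 0} \<in> sets (Rect a b c d)"
    using v by measurable
  have "AE x in Leb a b. \<forall>\<beta>\<in>rat_humps c d. (\<integral>y. v (x, y) * \<beta> y \<partial>Leb c d) = 0"
  proof (subst AE_ball_countable[OF countable_rat_humps], intro ballI)
    fix \<beta> assume \<beta>: "\<beta> \<in> rat_humps c d"
    from slice_identity[of a b c d v "\<lambda>_. 0" \<beta> 1 \<beta> 1] v eq[OF _ \<beta>] \<beta> rat_humps_bound[OF \<beta>]
    show "AE x in Leb a b. (\<integral>y. v (x, y) * \<beta> y \<partial>Leb c d) = 0" by simp
  qed
  then show "AE x in Leb a b. AE y in Leb c d. v (x, y) = 0"
    using Leb2.AE_integrable_fst'[OF v]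
    by eventually_elim (rule fundamental_lemma_variations, auto)
qed

section \<open>Weak derivatives on the rectangle\<close>

text \<open>An instance of the fundamental lemma, with products of bumps as tests. Consequently the representative \<open>D\<close> agrees almost everywhere with any weak derivative that
  is at hand.\<close>

lemma weak_partial_unique:
  assumes "weak_partial interior_tests e f g" "weak_partial interior_tests e f g'"
  shows "AE x in Omega_measure. g x = g' x"
proof -
  let ?P = "Rect 0 (2*pi) (-1/2) (1/2)"
  have i: "integrable ?P g" "integrable ?P g'" using assms by (auto simp: weak_partial_def Omega_measure_product)
  have "AE x in ?P. g x - g' x = 0"
  proof (rule fundamental_lemma_product)
    fix \<alpha> \<beta> assume ab: "\<alpha> \<in> rat_humps 0 (2*pi)" "\<beta> \<in> rat_humps (-1/2) (1/2)"
    let ?\<psi> = "\<lambda>x. \<alpha> (fst x) * \<beta> (snd x)"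
    have "?\<psi> \<in> interior_tests" using ab by (intro product_interior_tests rat_humps_bumps)
    then have eq: "(\<integral>x. g x * ?\<psi> x \<partial>?P) = (\<integral>x. g' x * ?\<psi> x \<partial>?P)"
    proof -
      assume \<psi>: "?\<psi> \<in> interior_tests"
      have "- (\<integral>x. g x * ?\<psi> x \<partial>?P) = - (\<integral>x. g' x * ?\<psi> x \<partial>?P)"
        using assms[unfolded weak_partial_def, THEN conjunct2, THEN conjunct2, THEN bspec, OF \<psi>]
        unfolding Omega_measure_product by (rule trans[OF sym])
      then show ?thesis by linarith
    qed
    have m: "?\<psi> \<in> borel_measurable ?P"
      by (intro borel_measurable_times measurable_compose[OF measurable_fst] measurable_compose[OF measurable_snd]
          measurable_Leb rat_humps_measurable[OF ab(1)] rat_humps_measurable[OF ab(2)])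
    have b: "\<bar>?\<psi> x\<bar> \<le> 1" for x
      using rat_humps_bound[OF ab(1)] rat_humps_bound[OF ab(2)] by (simp add: abs_mult mult_le_one)
    show "(\<integral>x. (g x - g' x) * ?\<psi> x \<partial>?P) = 0"
      unfolding left_diff_distrib
        Bochner_Integration.integral_diff[OF integrable_mult_bounded[OF i(1) m b] integrable_mult_bounded[OF i(2) m b]]
      using eq by (rule right_minus_eq[THEN iffD2])
  qed (use i in simp)
  then show ?thesis unfolding Omega_measure_product by simp
qed

lemma D_weak_partial:
  assumes "weak_partial interior_tests e f g"
  shows "weak_partial interior_tests e f (D e f)" "AE x in Omega_measure. D e f x = g x"
proof -
  show "weak_partial interior_tests e f (D e f)" unfolding D_def by (rule someI[of _ g]) (rule assms)
  then show "AE x in Omega_measure. D e f x = g x" using assms by (rule weak_partial_unique)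
qed

lemma weak_partial_cong_AE:
  assumes "weak_partial T e f g" "integrable Omega_measure f'" "AE x in Omega_measure. f' x = f x"
    and T: "\<And>\<psi>. \<psi> \<in> T \<Longrightarrow> partial e \<psi> \<in> borel_measurable Omega_measure"
  shows "weak_partial T e f' g"
proof -
  have "(\<integral>x. f' x * partial e \<psi> x \<partial>Omega_measure) = (\<integral>x. f x * partial e \<psi> x \<partial>Omega_measure)" if "\<psi> \<in> T" for \<psi>
  proof (rule integral_cong_AE)
    show "AE x in Omega_measure. f' x * partial e \<psi> x = f x * partial e \<psi> x"
      using assms(3) by eventually_elim simp
    show "(\<lambda>x. f' x * partial e \<psi> x) \<in> borel_measurable Omega_measure"
      "(\<lambda>x. f x * partial e \<psi> x) \<in> borel_measurable Omega_measure"
      using assms(1,2) T[OF that] by (auto intro!: borel_measurable_times simp: weak_partial_def)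
  qed
  then show ?thesis using assms by (simp add: weak_partial_def)
qed

lemma space_Omega_measure: "space Omega_measure = Omega"
  by (simp add: Omega_measure_product space_pair_measure Omega_def)

lemma continuous_measurable_Omega: "continuous_on UNIV f \<Longrightarrow> f \<in> borel_measurable Omega_measure"
  for f :: "point \<Rightarrow> real"
  unfolding Omega_measure_def by (intro measurable_restrict_space1) (simp add: borel_measurable_continuous_onI)

lemma weak_partial_periodic_interior:
  assumes "weak_partial periodic_tests e f g" "e \<in> Basis"
  shows "weak_partial interior_tests e f g"
  unfolding weak_partial_def
proof (intro conjI ballI)
  fix \<psi> assume \<psi>: "\<psi> \<in> interior_tests"
  obtain \<Psi> where \<Psi>: "\<Psi> \<in> periodic_tests" "\<And>x. x \<in> Omega \<Longrightarrow> \<Psi> x = \<psi> x"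
    "\<And>x. x \<in> Omega \<Longrightarrow> partial e \<Psi> x = partial e \<psi> x"
    by (rule periodic_extension[OF \<psi>]) (use assms(2) in blast)
  have "(\<integral>x. f x * partial e \<psi> x \<partial>Omega_measure) = (\<integral>x. f x * partial e \<Psi> x \<partial>Omega_measure)"
    by (rule Bochner_Integration.integral_cong) (auto simp: space_Omega_measure \<Psi>)
  also have "\<dots> = - (\<integral>x. g x * \<Psi> x \<partial>Omega_measure)" using assms(1) \<Psi>(1) by (simp add: weak_partial_def)
  also have "\<dots> = - (\<integral>x. g x * \<psi> x \<partial>Omega_measure)"
    by (rule arg_cong[of _ _ uminus], rule Bochner_Integration.integral_cong) (auto simp: space_Omega_measure \<Psi>)
  finally show "(\<integral>x. f x * partial e \<psi> x \<partial>Omega_measure) = - (\<integral>x. g x * \<psi> x \<partial>Omega_measure)" .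
qed (use assms in \<open>auto simp: weak_partial_def\<close>)

text \<open>The inner derivative is itself only a representative; the outer weak derivative does not notice, since
  it depends on its argument through integrals alone.\<close>

lemma D_D_weak_partial:
  assumes "weak_partial interior_tests j f g" "weak_partial interior_tests i g k" "i \<in> Basis"
  shows "AE x in Omega_measure. D i (D j f) x = k x"
proof (rule D_weak_partial(2), rule weak_partial_cong_AE[OF assms(2)])
  show "integrable Omega_measure (D j f)" "AE x in Omega_measure. D j f x = g x"
    using D_weak_partial[OF assms(1)] by (auto simp: weak_partial_def)
  show "partial i \<psi> \<in> borel_measurable Omega_measure" if "\<psi> \<in> interior_tests" for \<psi>
    using that assms(3) by (intro continuous_measurable_Omega smooth_functionsD(1) smooth_functionsD(3))
      (auto simp: interior_tests_def)
qed

section \<open>Absolute continuity on lines\<close>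

lemma bumps_bounded: assumes "u \<in> bumps a b" obtains B where "\<And>x. \<bar>u x\<bar> \<le> B"
proof -
  obtain s t where u: "smooth1 u" "\<And>x. x \<notin> {s..t} \<Longrightarrow> u x = 0" using assms by (auto simp: bumps_def)
  have "compact (u ` {s..t})" by (intro compact_continuous_image smooth1_continuous u(1)) auto
  then obtain B where B: "\<And>x. x \<in> {s..t} \<Longrightarrow> \<bar>u x\<bar> \<le> B"
    by (meson bounded_real compact_imp_bounded imageI)
  have "\<bar>u x\<bar> \<le> max B 0" for x using B[of x] u(2)[of x] by (cases "x \<in> {s..t}") auto
  then show ?thesis using that by blast
qed

lemma bumps_comb:
  assumes "u \<in> bumps a b" "v \<in> bumps a b"
  shows "(\<lambda>x. u x - k * v x) \<in> bumps a b"
proof -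
  obtain s t where u: "a < s" "t < b" "smooth1 u" "\<And>x. x \<notin> {s..t} \<Longrightarrow> u x = 0" using assms(1) by (auto simp: bumps_def)
  obtain s' t' where v: "a < s'" "t' < b" "smooth1 v" "\<And>x. x \<notin> {s'..t'} \<Longrightarrow> v x = 0" using assms(2) by (auto simp: bumps_def)
  have "u x - k * v x = 0" if "x \<notin> {min s s'..max t t'}" for x
  proof -
    have "x \<notin> {s..t}" "x \<notin> {s'..t'}" using that by auto
    then show ?thesis using u(4)[of x] v(4)[of x] by simp
  qed
  moreover have "a < min s s'" "max t t' < b" using u v by auto
  ultimately show ?thesis unfolding bumps_def
    using smooth1_diff[OF u(3) smooth1_cmult[OF v(3)]] by blast
qed

lemma integrable_Leb_continuous:
  assumes "continuous_on UNIV (f :: real \<Rightarrow> real)"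
  shows "integrable (Leb a b) f"
proof -
  have "set_integrable lborel {a..b} f"
    unfolding set_integrable_def by (intro borel_integrable_compact continuous_on_subset[OF assms]) auto
  then show ?thesis by (simp add: Leb_def integrable_restrict_space set_integrable_def)
qed

lemma integral_Leb_indicator:
  fixes f :: "real \<Rightarrow> real"
  assumes "a \<le> s" "t \<le> b"
  shows "(\<integral>y. indicator {s..t} y * f y \<partial>Leb a b) = (\<integral>y. f y * indicator {s..t} y \<partial>lborel)"
proof -
  have "(\<integral>y. indicator {s..t} y * f y \<partial>Leb a b) = (\<integral>y. indicator {a..b} y * (indicator {s..t} y * f y) \<partial>lborel)"
    by (simp add: Leb_def integral_restrict_space)
  also have "\<dots> = (\<integral>y. f y * indicator {s..t} y \<partial>lborel)"
    using assms by (intro Bochner_Integration.integral_cong) (auto simp: indicator_def)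
  finally show ?thesis .
qed

lemma integral_Leb_DERIV:
  assumes "a \<le> s" "s \<le> t" "t \<le> b" "\<And>x. (F has_real_derivative f x) (at x)" "continuous_on UNIV f"
  shows "(\<integral>y. indicator {s..t} y * f y \<partial>Leb a b) = F t - F s"
  unfolding integral_Leb_indicator[OF assms(1,3)]
  using assms by (intro integral_FTC_Icc_real) (auto simp: continuous_on_eq_continuous_at)

lemma integral_Leb_cong_space: "(\<And>x. x \<in> {a..b} \<Longrightarrow> f x = g x) \<Longrightarrow> (\<integral>x. f x \<partial>Leb a b) = (\<integral>x. g x \<partial>Leb a b)"
  for f :: "real \<Rightarrow> real"
  by (rule Bochner_Integration.integral_cong) auto

lemma constant_off_support:
  assumes "\<And>x. (F has_real_derivative f x) (at x)" "convex S" "\<And>x. x \<in> S \<Longrightarrow> f x = 0" "x \<in> S" "y \<in> S"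
  shows "F x = (F y :: real)"
proof -
  have "\<exists>c. \<forall>x\<in>S. F x = c"
    using assms(1,3) by (intro has_field_derivative_zero_constant assms(2)) (metis has_field_derivative_at_within)
  then show ?thesis using assms(4,5) by auto
qed

text \<open>The mean-zero condition makes the antiderivative that vanishes to the left of the support vanish also
  to the right of it.\<close>

lemma bump_antiderivative:
  assumes \<theta>: "\<theta> \<in> bumps c d" and 0: "(\<integral>y. \<theta> y \<partial>Leb c d) = 0" and "c < d"
  obtains \<beta> where "\<beta> \<in> bumps c d" "deriv \<beta> = \<theta>"
proof -
  obtain s t where \<theta>s: "c < s" "t < d" "smooth1 \<theta>" "\<And>x. x \<notin> {s..t} \<Longrightarrow> \<theta> x = 0" using \<theta> by (auto simp: bumps_def)
  have "\<exists>F. \<forall>x :: real. (-\<infinity>::ereal) < x \<longrightarrow> x < (\<infinity>::ereal) \<longrightarrow> (F has_vector_derivative \<theta> x) (at x)"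
    using smooth1_continuous[OF \<theta>s(3), of UNIV] by (intro einterval_antiderivative) (auto simp: continuous_on_eq_continuous_at)
  then obtain F where F: "\<And>x. (F has_real_derivative \<theta> x) (at x)"
    by (auto simp: has_real_derivative_iff_has_vector_derivative)
  have "F d - F c = (\<integral>y. indicator {c..d} y * \<theta> y \<partial>Leb c d)"
    using integral_Leb_DERIV[OF order_refl _ order_refl F smooth1_continuous[OF \<theta>s(3)]] assms(3) by simp
  also have "\<dots> = (\<integral>y. \<theta> y \<partial>Leb c d)" by (rule integral_Leb_cong_space) auto
  finally have dc: "F d = F c" using 0 by simp
  define \<beta> where "\<beta> = (\<lambda>x. F x - F c)"
  have D: "(\<beta> has_real_derivative \<theta> x) (at x)" for x unfolding \<beta>_def by (auto intro!: derivative_eq_intros F)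
  have "\<beta> x = 0" if "x < s" for x
    using constant_off_support[OF F, of "{..<s}" x c] that \<theta>s by (auto simp: \<beta>_def)
  moreover have "\<beta> x = 0" if "t < x" for x
    using constant_off_support[OF F, of "{t<..}" x d] that \<theta>s dc by (auto simp: \<beta>_def)
  ultimately have "\<beta> x = 0" if "x \<notin> {s..t}" for x using that by force
  then have "\<beta> \<in> bumps c d" using smooth1_antiderivative[OF D \<theta>s(3)] \<theta>s(1,2) by (auto simp: bumps_def)
  moreover have "deriv \<beta> = \<theta>" using D DERIV_imp_deriv by blast
  ultimately show ?thesis using that by blast
qed

text \<open>If all humps had integral zero, the fundamental lemma would make the constant \<open>1\<close> vanish almost
  everywhere.\<close>

lemma unit_mass_bump:
  assumes "c < d"
  obtains \<kappa> where "\<kappa> \<in> bumps c d" "(\<integral>y. \<kappa> y \<partial>Leb c d) = 1"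
proof -
  have "\<exists>u\<in>rat_humps c d. (\<integral>y. u y \<partial>Leb c d) \<noteq> 0"
  proof (rule ccontr)
    assume "\<not> ?thesis"
    then have "AE y in Leb c d. (1::real) = 0"
      by (intro fundamental_lemma_variations) auto
    then have "emeasure (Leb c d) (space (Leb c d)) = 0" by (simp add: ae_filter_eq_bot_iff eventually_False)
    then show False using assms by (simp add: emeasure_Leb)
  qed
  then obtain u where u: "u \<in> rat_humps c d" "(\<integral>y. u y \<partial>Leb c d) \<noteq> 0" by blast
  let ?k = "1 / (\<integral>y. u y \<partial>Leb c d)"
  have "(\<lambda>y. u y - (1 - ?k) * u y) \<in> bumps c d" by (intro bumps_comb rat_humps_bumps u)
  moreover have "(\<lambda>y. u y - (1 - ?k) * u y) = (\<lambda>y. ?k * u y)" by (auto simp: algebra_simps)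
  ultimately show ?thesis using that[of "\<lambda>y. ?k * u y"] u(2) by simp
qed

lemma integrable_snd_Leb:
  assumes "integrable (Leb c d) (g :: real \<Rightarrow> real)"
  shows "integrable (Rect a b c d) (\<lambda>x. g (snd x))"
  by (rule Leb2.Fubini_integrable)
     (use assms measurable_compose[OF measurable_snd borel_measurable_integrable[OF assms]] in auto)

lemma integrable_primitive_kernel:
  fixes g :: "real \<Rightarrow> real"
  assumes "integrable (Leb c d) g"
  shows "integrable (Rect c d c d) (\<lambda>p. g (snd p) * indicator {t. t \<le> fst p} (snd p))"
proof (rule integrable_mult_bounded[OF integrable_snd_Leb[OF assms], where B=1])
  have "(\<lambda>p. fst p :: real) \<in> borel_measurable (Rect c d c d)" "(\<lambda>p. snd p :: real) \<in> borel_measurable (Rect c d c d)"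
    by (intro measurable_compose[OF measurable_fst] measurable_compose[OF measurable_snd] measurable_Leb measurable_ident_sets, simp)+
  then show "(\<lambda>p. indicator {t. t \<le> fst p} (snd p) :: real) \<in> borel_measurable (Rect c d c d)"
    unfolding indicator_def by measurable
qed (auto simp: indicator_def)

lemma primitive_kernel_eq:
  fixes g :: "real \<Rightarrow> real"
  shows "(\<integral>t. indicator {c..y} t * g t \<partial>Leb c d) = (\<integral>t. g t * indicator {t. t \<le> y} t \<partial>Leb c d)"
  by (rule integral_Leb_cong_space) (auto simp: indicator_def)

text \<open>The primitive is a line integral of an integrable kernel on the square, which gives its measurability
  by Fubini.\<close>

lemma integrable_primitive:
  fixes g :: "real \<Rightarrow> real"
  assumes "integrable (Leb c d) g"
  shows "integrable (Leb c d) (\<lambda>y. \<integral>t. indicator {c..y} t * g t \<partial>Leb c d)"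
  unfolding primitive_kernel_eq using Leb2.integrable_fst'[OF integrable_primitive_kernel[OF assms]] by simp

text \<open>Subtracting the primitive \<open>G\<close> of \<open>g\<close> leaves a function \<open>v\<close> that integrates to zero against all
  derivatives of tests. Every \<open>\<eta> - (\<integral>\<eta>) \<kappa>\<close>, with a fixed \<open>\<kappa>\<close> of mass one, is such a derivative, so
  \<open>v - \<integral>v \<kappa>\<close> is orthogonal to every \<open>\<eta>\<close>. The hypothesis speaks of the countable set
  \<open>rat_humps\<close> so that it can be verified on almost every line of a rectangle.\<close>

lemma du_Bois_Reymond:
  fixes f g :: "real \<Rightarrow> real"
  assumes f: "integrable (Leb c d) f" and g: "integrable (Leb c d) g" and "c < d"
    and \<kappa>: "\<kappa> \<in> bumps c d" "(\<integral>y. \<kappa> y \<partial>Leb c d) = 1"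
    and weak: "\<And>\<eta>. \<eta> \<in> rat_humps c d \<Longrightarrow> \<exists>\<beta>\<in>bumps c d. deriv \<beta> = (\<lambda>y. \<eta> y - (\<integral>y. \<eta> y \<partial>Leb c d) * \<kappa> y)
        \<and> (\<integral>y. f y * deriv \<beta> y \<partial>Leb c d) = - (\<integral>y. g y * \<beta> y \<partial>Leb c d)"
  shows "\<exists>C. AE y in Leb c d. f y = C + (\<integral>t. indicator {c..y} t * g t \<partial>Leb c d)"
proof -
  let ?Y = "Leb c d"
  define G where "G = (\<lambda>y. \<integral>t. indicator {c..y} t * g t \<partial>?Y)"
  obtain X where X: "\<And>x. \<bar>\<kappa> x\<bar> \<le> X" using bumps_bounded[OF \<kappa>(1)] by blast
  have \<kappa>m: "\<kappa> \<in> borel_measurable ?Y" by (intro measurable_Leb smooth1_measurable bumpsD[OF \<kappa>(1)])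
  note Gi = integrable_primitive_kernel[OF g]
  have Geq: "G y = (\<integral>t. g t * indicator {t. t \<le> y} t \<partial>?Y)" for y
    unfolding G_def by (rule primitive_kernel_eq)
  have G: "integrable ?Y G" unfolding G_def by (rule integrable_primitive[OF g])
  have Gparts: "(\<integral>y. G y * deriv \<beta> y \<partial>?Y) = - (\<integral>y. g y * \<beta> y \<partial>?Y)" if \<beta>: "\<beta> \<in> bumps c d" and \<beta>': "deriv \<beta> \<in> bumps c d" for \<beta>
  proof -
    obtain B where B: "\<And>x. \<bar>deriv \<beta> x\<bar> \<le> B" using bumps_bounded[OF \<beta>'] by blast
    have \<beta>'m: "deriv \<beta> \<in> borel_measurable borel" by (intro smooth1_measurable bumpsD[OF \<beta>'])
    have i: "integrable (?Y \<Otimes>\<^sub>M ?Y) (\<lambda>(y, t). g t * indicator {t. t \<le> y} t * deriv \<beta> y)"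
      using integrable_mult_bounded[OF Gi measurable_compose[OF measurable_fst measurable_Leb[OF \<beta>'m]] B]
      by (simp add: case_prod_beta')
    have "(\<integral>y. G y * deriv \<beta> y \<partial>?Y) = (\<integral>y. (\<integral>t. g t * indicator {t. t \<le> y} t * deriv \<beta> y \<partial>?Y) \<partial>?Y)"
      unfolding Geq by (simp only: integral_mult_left_zero)
    also have "\<dots> = (\<integral>t. (\<integral>y. g t * indicator {t. t \<le> y} t * deriv \<beta> y \<partial>?Y) \<partial>?Y)"
      using Leb2.Fubini_integral[OF i] by simp
    also have "\<dots> = (\<integral>t. - (g t * \<beta> t) \<partial>?Y)"
    proof (rule integral_Leb_cong_space)
      fix t assume t: "t \<in> {c..d}"
      have "(\<integral>y. g t * indicator {t. t \<le> y} t * deriv \<beta> y \<partial>?Y) = (\<integral>y. g t * (indicator {t..d} y * deriv \<beta> y) \<partial>?Y)"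
        by (rule integral_Leb_cong_space) (auto simp: indicator_def)
      also have "\<dots> = g t * (\<beta> d - \<beta> t)"
        using t integral_Leb_DERIV[of c t d d \<beta> "deriv \<beta>"] smooth1_DERIV[OF bumpsD[OF \<beta>]]
          smooth1_continuous[OF bumpsD[OF \<beta>']] by simp
      also have "\<dots> = - (g t * \<beta> t)" using bumps_zero[OF \<beta>, of d] by simp
      finally show "(\<integral>y. g t * indicator {t. t \<le> y} t * deriv \<beta> y \<partial>?Y) = - (g t * \<beta> t)" .
    qed
    finally show ?thesis by simp
  qed
  define v where "v = (\<lambda>y. f y - G y)"
  have v: "integrable ?Y v" unfolding v_def using f G by simp
  define C where "C = (\<integral>y. v y * \<kappa> y \<partial>?Y)"
  have "AE y in ?Y. v y - C = 0"
  proof (rule fundamental_lemma_variations)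
    show "integrable ?Y (\<lambda>y. v y - C)" using v by simp
    fix \<eta> assume \<eta>: "\<eta> \<in> rat_humps c d"
    have \<eta>m: "\<eta> \<in> borel_measurable ?Y" using \<eta> by (intro measurable_Leb rat_humps_measurable)
    let ?k = "\<integral>y. \<eta> y \<partial>?Y"
    obtain \<beta> where \<beta>: "\<beta> \<in> bumps c d" "deriv \<beta> = (\<lambda>y. \<eta> y - ?k * \<kappa> y)"
        "(\<integral>y. f y * deriv \<beta> y \<partial>?Y) = - (\<integral>y. g y * \<beta> y \<partial>?Y)" using weak[OF \<eta>] by blast
    have \<beta>': "deriv \<beta> \<in> bumps c d" unfolding \<beta>(2) by (intro bumps_comb rat_humps_bumps \<eta> \<kappa>)
    obtain B where B: "\<And>x. \<bar>deriv \<beta> x\<bar> \<le> B" using bumps_bounded[OF \<beta>'] by blast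
    have \<beta>'m: "deriv \<beta> \<in> borel_measurable ?Y" by (intro measurable_Leb smooth1_measurable bumpsD[OF \<beta>'])
    have "(\<integral>y. v y * deriv \<beta> y \<partial>?Y) = (\<integral>y. f y * deriv \<beta> y \<partial>?Y) - (\<integral>y. G y * deriv \<beta> y \<partial>?Y)"
      unfolding v_def left_diff_distrib
      by (intro Bochner_Integration.integral_diff integrable_mult_bounded[OF _ \<beta>'m B] f G)
    also have "\<dots> = 0" using \<beta>(3) Gparts[OF \<beta>(1) \<beta>'] by simp
    finally have 0: "(\<integral>y. v y * deriv \<beta> y \<partial>?Y) = 0" .
    have i1: "integrable ?Y (\<lambda>y. v y * \<eta> y)" by (rule integrable_mult_bounded[OF v \<eta>m rat_humps_bound[OF \<eta>]])
    have i2: "integrable ?Y (\<lambda>y. v y * \<kappa> y)" by (rule integrable_mult_bounded[OF v \<kappa>m X])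
    have i3: "integrable ?Y \<eta>" using \<eta> by (intro integrable_Leb_continuous smooth1_continuous bumpsD[OF rat_humps_bumps])
    have "(\<integral>y. (v y - C) * \<eta> y \<partial>?Y) = (\<integral>y. v y * \<eta> y \<partial>?Y) - C * ?k"
      using i1 i3 by (simp add: left_diff_distrib)
    also have "\<dots> = (\<integral>y. v y * deriv \<beta> y \<partial>?Y)"
    proof -
      have "(\<integral>y. v y * deriv \<beta> y \<partial>?Y) = (\<integral>y. v y * \<eta> y - ?k * (v y * \<kappa> y) \<partial>?Y)"
        unfolding \<beta>(2) by (rule integral_Leb_cong_space) (simp add: algebra_simps)
      also have "\<dots> = (\<integral>y. v y * \<eta> y \<partial>?Y) - ?k * C" unfolding C_def using i1 i2 by simp
      finally show ?thesis by (simp add: mult.commute)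
    qed
    finally show "(\<integral>y. (v y - C) * \<eta> y \<partial>?Y) = 0" using 0 by simp
  qed
  then have "AE y in ?Y. f y = C + (\<integral>t. indicator {c..y} t * g t \<partial>?Y)"
    by eventually_elim (simp add: v_def G_def)
  then show ?thesis by blast
qed

text \<open>On almost every line parallel to the \<open>y\<close>-axis a function with a weak \<open>y\<close>-derivative is, up to a null set
  of that line, a primitive of the derivative. All interpolation inequalities below thereby reduce to
  statements about primitives on an interval.\<close>

lemma absolutely_continuous_on_lines:
  fixes f g :: "real \<times> real \<Rightarrow> real"
  assumes f: "integrable (Rect a b c d) f" and g: "integrable (Rect a b c d) g" and "c < d"
    and weak: "\<And>\<alpha> \<beta>. \<alpha> \<in> bumps a b \<Longrightarrow> \<beta> \<in> bumps c d \<Longrightarrow>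
      (\<integral>x. f x * (\<alpha> (fst x) * deriv \<beta> (snd x)) \<partial>Rect a b c d) = - (\<integral>x. g x * (\<alpha> (fst x) * \<beta> (snd x)) \<partial>Rect a b c d)"
  shows "AE x in Leb a b. \<exists>C. AE y in Leb c d. f (x, y) = C + (\<integral>t. indicator {c..y} t * g (x, t) \<partial>Leb c d)"
proof -
  obtain \<kappa> where \<kappa>: "\<kappa> \<in> bumps c d" "(\<integral>y. \<kappa> y \<partial>Leb c d) = 1" using unit_mass_bump[OF \<open>c < d\<close>] by blast
  have "\<exists>\<beta>\<in>bumps c d. deriv \<beta> = (\<lambda>y. \<eta> y - (\<integral>y. \<eta> y \<partial>Leb c d) * \<kappa> y)" if \<eta>: "\<eta> \<in> rat_humps c d" for \<eta>
  proof -
    have "(\<lambda>y. \<eta> y - (\<integral>y. \<eta> y \<partial>Leb c d) * \<kappa> y) \<in> bumps c d" by (intro bumps_comb rat_humps_bumps \<eta> \<kappa>)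
    moreover have "(\<integral>y. \<eta> y - (\<integral>y. \<eta> y \<partial>Leb c d) * \<kappa> y \<partial>Leb c d) = 0"
    proof -
      have "integrable (Leb c d) \<eta>" "integrable (Leb c d) \<kappa>"
        by (intro integrable_Leb_continuous smooth1_continuous bumpsD[OF rat_humps_bumps[OF \<eta>]] bumpsD[OF \<kappa>(1)])+
      then show ?thesis using \<kappa>(2) by simp
    qed
    ultimately show ?thesis using bump_antiderivative \<open>c < d\<close> by metis
  qed
  then obtain \<beta> where \<beta>: "\<And>\<eta>. \<eta> \<in> rat_humps c d \<Longrightarrow> \<beta> \<eta> \<in> bumps c d"
    "\<And>\<eta>. \<eta> \<in> rat_humps c d \<Longrightarrow> deriv (\<beta> \<eta>) = (\<lambda>y. \<eta> y - (\<integral>y. \<eta> y \<partial>Leb c d) * \<kappa> y)" by metis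
  have "AE x in Leb a b. \<forall>\<eta>\<in>rat_humps c d. (\<integral>y. f (x, y) * deriv (\<beta> \<eta>) y \<partial>Leb c d) = (\<integral>y. - g (x, y) * \<beta> \<eta> y \<partial>Leb c d)"
  proof (subst AE_ball_countable[OF countable_rat_humps], intro ballI)
    fix \<eta> assume \<eta>: "\<eta> \<in> rat_humps c d"
    have \<beta>': "deriv (\<beta> \<eta>) \<in> bumps c d" unfolding \<beta>(2)[OF \<eta>] by (intro bumps_comb rat_humps_bumps \<eta> \<kappa>)
    obtain B where B: "\<And>x. \<bar>deriv (\<beta> \<eta>) x\<bar> \<le> B" using bumps_bounded[OF \<beta>'] by blast
    obtain B' where B': "\<And>x. \<bar>\<beta> \<eta> x\<bar> \<le> B'" using bumps_bounded[OF \<beta>(1)[OF \<eta>]] by blast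
    show "AE x in Leb a b. (\<integral>y. f (x, y) * deriv (\<beta> \<eta>) y \<partial>Leb c d) = (\<integral>y. - g (x, y) * \<beta> \<eta> y \<partial>Leb c d)"
    proof (rule slice_identity[OF f _ _ B _ B'])
      show "integrable (Rect a b c d) (\<lambda>x. - g x)" using g by simp
      show "deriv (\<beta> \<eta>) \<in> borel_measurable borel" "\<beta> \<eta> \<in> borel_measurable borel"
        using smooth1_measurable bumpsD[OF \<beta>'] bumpsD[OF \<beta>(1)[OF \<eta>]] by auto
      fix \<alpha> assume "\<alpha> \<in> rat_humps a b"
      from weak[OF rat_humps_bumps[OF this] \<beta>(1)[OF \<eta>]]
      show "(\<integral>x. f x * (\<alpha> (fst x) * deriv (\<beta> \<eta>) (snd x)) \<partial>Rect a b c d) = (\<integral>x. - g x * (\<alpha> (fst x) * \<beta> \<eta> (snd x)) \<partial>Rect a b c d)"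
        by simp
    qed
  qed
  then show ?thesis using Leb2.AE_integrable_fst'[OF f] Leb2.AE_integrable_fst'[OF g]
  proof eventually_elim
    case (elim x)
    show ?case
    proof (rule du_Bois_Reymond[OF elim(2,3) \<open>c < d\<close> \<kappa>])
      fix \<eta> assume \<eta>: "\<eta> \<in> rat_humps c d"
      show "\<exists>\<beta>\<in>bumps c d. deriv \<beta> = (\<lambda>y. \<eta> y - (\<integral>y. \<eta> y \<partial>Leb c d) * \<kappa> y)
        \<and> (\<integral>y. f (x, y) * deriv \<beta> y \<partial>Leb c d) = - (\<integral>y. g (x, y) * \<beta> y \<partial>Leb c d)"
        using \<beta>[OF \<eta>] bspec[OF elim(1) \<eta>] by (intro bexI[of _ "\<beta> \<eta>"]) auto
    qed
  qed
qed

lemma mean_zero_on_lines: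
  fixes g :: "real \<times> real \<Rightarrow> real"
  assumes g: "integrable (Rect a b c d) g"
    and 0: "\<And>\<alpha>. \<alpha> \<in> bumps a b \<Longrightarrow> (\<integral>x. g x * \<alpha> (fst x) \<partial>Rect a b c d) = 0"
  shows "AE x in Leb a b. (\<integral>y. g (x, y) \<partial>Leb c d) = 0"
  using slice_identity[of a b c d g "\<lambda>_. 0" "\<lambda>_. 1" 1 "\<lambda>_. 0" 0] g 0 rat_humps_bumps by simp

section \<open>Interpolation inequalities on an interval\<close>

abbreviation int_on :: "real \<Rightarrow> real \<Rightarrow> real \<Rightarrow> real \<Rightarrow> (real \<Rightarrow> real) \<Rightarrow> real" where
  "int_on c d s t h \<equiv> \<integral>y. indicator {s..t} y * h y \<partial>Leb c d"

lemma integrable_int_on: "integrable (Leb c d) h \<Longrightarrow> integrable (Leb c d) (\<lambda>y. indicator {s..t} y * h y)"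
  for h :: "real \<Rightarrow> real"
  using integrable_mult_bounded[of "Leb c d" h "indicator {s..t}" 1]
  by (simp add: mult.commute measurable_Leb indicator_def)

lemma int_on_const:
  assumes "c \<le> s" "s \<le> t" "t \<le> d" shows "int_on c d s t (\<lambda>_. k) = (t - s) * k"
proof -
  have D: "((\<lambda>y. k * y) has_real_derivative k) (at x)" for x by (auto intro!: derivative_eq_intros)
  show ?thesis by (rule trans[OF integral_Leb_DERIV[OF assms D]]) (auto simp: algebra_simps)
qed

lemma int_on_mono_AE:
  assumes "integrable (Leb c d) g" "integrable (Leb c d) h" "AE y in Leb c d. y \<in> {s..t} \<longrightarrow> g y \<le> h y"
  shows "int_on c d s t g \<le> int_on c d s t h"
  using assms by (intro integral_mono_AE integrable_int_on) (auto elim!: eventually_mono simp: indicator_def)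

lemma int_on_ge_const:
  assumes "c \<le> s" "s \<le> t" "t \<le> d" "integrable (Leb c d) h" "\<And>y. y \<in> {s..t} \<Longrightarrow> a \<le> h y"
  shows "(t - s) * a \<le> int_on c d s t h"
  using int_on_mono_AE[of c d "\<lambda>_. a" h s t] assms int_on_const[OF assms(1-3), of a] by auto

lemma int_on_le_const_AE:
  assumes "c \<le> s" "s \<le> t" "t \<le> d" "integrable (Leb c d) h" "AE y in Leb c d. y \<in> {s..t} \<longrightarrow> h y \<le> a"
  shows "int_on c d s t h \<le> (t - s) * a"
  using int_on_mono_AE[of c d h "\<lambda>_. a" s t] assms int_on_const[OF assms(1-3), of a] by auto

lemma int_on_subset:
  assumes "integrable (Leb c d) h" "\<And>y. 0 \<le> h y" "s \<le> s'" "t' \<le> t"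
  shows "int_on c d s' t' h \<le> int_on c d s t h"
  using assms by (intro integral_mono integrable_int_on) (auto simp: indicator_def)

lemma int_on_nonneg: "(\<And>y. 0 \<le> h y) \<Longrightarrow> 0 \<le> int_on c d s t h"
  by (intro Bochner_Integration.integral_nonneg) auto

lemma int_on_Cauchy_Schwarz:
  assumes "c \<le> s" "s < t" "t \<le> d" "integrable (Leb c d) h" "integrable (Leb c d) (\<lambda>y. (h y)\<^sup>2)"
  shows "(int_on c d s t h)\<^sup>2 \<le> (t - s) * int_on c d s t (\<lambda>y. (h y)\<^sup>2)"
proof -
  let ?A = "int_on c d s t h" and ?Q = "int_on c d s t (\<lambda>y. (h y)\<^sup>2)"
  \<comment> \<open>\<open>r\<close> is the mean of \<open>h\<close>, which minimizes the nonnegative quadratic \<open>\<integral>(h - r)\<^sup>2\<close>.\<close>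
  define r where "r = ?A / (t - s)"
  have "0 \<le> int_on c d s t (\<lambda>y. (h y - r)\<^sup>2)" by (rule int_on_nonneg) simp
  also have "\<dots> = (\<integral>y. (indicator {s..t} y * (h y)\<^sup>2 - 2 * r * (indicator {s..t} y * h y)) + indicator {s..t} y * r\<^sup>2 \<partial>Leb c d)"
    by (rule integral_Leb_cong_space) (auto simp: power2_eq_square algebra_simps)
  also have "\<dots> = (?Q - 2 * r * ?A) + (t - s) * r\<^sup>2"
    using integrable_int_on[OF assms(4), of s t] integrable_int_on[OF assms(5), of s t]
      integrable_int_on[of c d "\<lambda>_. r\<^sup>2" s t] int_on_const[of c s t d "r\<^sup>2"] assms(1-3) by simp
  also have "\<dots> = ?Q - ?A\<^sup>2 / (t - s)"
  proof -
    have "(t - s) * r\<^sup>2 = r * ?A" "?A\<^sup>2 / (t - s) = r * ?A" using assms(2) by (auto simp: r_def power2_eq_square)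
    then show ?thesis by simp
  qed
  finally have "?A\<^sup>2 / (t - s) \<le> ?Q" by simp
  then show ?thesis using assms(2) by (simp add: pos_divide_le_eq mult.commute)
qed

text \<open>An exact version of the fundamental theorem of calculus, valid for all pairs of points; it frees the
  estimates on an interval from exceptional sets.\<close>

definition primitive_on :: "real \<Rightarrow> real \<Rightarrow> (real \<Rightarrow> real) \<Rightarrow> (real \<Rightarrow> real) \<Rightarrow> bool" where
  "primitive_on c d F g \<longleftrightarrow> (\<forall>s t. c \<le> s \<and> s \<le> t \<and> t \<le> d \<longrightarrow> F t - F s = int_on c d s t g)"

lemma AE_Leb_neq: "AE y in Leb c d. y \<noteq> s"
  unfolding Leb_def by (subst AE_restrict_space_iff) (use AE_lborel_singleton[of s] in \<open>auto elim!: eventually_mono\<close>)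

lemma int_on_add:
  assumes "integrable (Leb c d) h" "s \<le> t" "t \<le> u"
  shows "int_on c d s t h + int_on c d t u h = int_on c d s u h"
proof -
  have "int_on c d s t h + int_on c d t u h = (\<integral>y. indicator {s..t} y * h y + indicator {t..u} y * h y \<partial>Leb c d)"
    using assms(1) by (simp add: integrable_int_on)
  also have "\<dots> = int_on c d s u h"
  proof (rule integral_cong_AE)
    show "AE y in Leb c d. indicator {s..t} y * h y + indicator {t..u} y * h y = indicator {s..u} y * h y"
      using AE_Leb_neq[where s=t] by eventually_elim (use assms in \<open>auto simp: indicator_def\<close>)
  qed (use integrable_int_on[OF assms(1)] in auto)
  finally show ?thesis .
qed

lemma primitive_on_primitive:
  "integrable (Leb c d) g \<Longrightarrow> primitive_on c d (\<lambda>y. C + int_on c d c y g) g"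
  unfolding primitive_on_def using int_on_add[of c d g c] by force

lemma primitive_on_osc:
  assumes "primitive_on c d F g" "integrable (Leb c d) g" "c \<le> s" "t \<le> d" "y \<in> {s..t}" "y' \<in> {s..t}"
  shows "\<bar>F y - F y'\<bar> \<le> int_on c d s t (\<lambda>y. \<bar>g y\<bar>)"
proof -
  have *: "\<bar>F v - F u\<bar> \<le> int_on c d s t (\<lambda>y. \<bar>g y\<bar>)" if "s \<le> u" "u \<le> v" "v \<le> t" for u v
  proof -
    have "F v - F u = int_on c d u v g" using assms that by (auto simp: primitive_on_def)
    then have "\<bar>F v - F u\<bar> \<le> (\<integral>y. norm (indicator {u..v} y * g y) \<partial>Leb c d)"
      using integral_norm_bound[of "Leb c d" "\<lambda>y. indicator {u..v} y * g y"] by simp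
    also have "\<dots> = int_on c d u v (\<lambda>y. \<bar>g y\<bar>)" by (simp add: abs_mult)
    also have "\<dots> \<le> int_on c d s t (\<lambda>y. \<bar>g y\<bar>)" using assms that by (intro int_on_subset) auto
    finally show ?thesis .
  qed
  show ?thesis using *[of y y'] *[of y' y] assms(5,6) by (cases "y \<le> y'") auto
qed

lemma int_on_sq_le:
  assumes "c \<le> s" "s < t" "t \<le> d" "integrable (Leb c d) k" "integrable (Leb c d) (\<lambda>y. (k y)\<^sup>2)"
  shows "(int_on c d s t (\<lambda>y. \<bar>k y\<bar>))\<^sup>2 \<le> (t - s) * int_on c d s t (\<lambda>y. (k y)\<^sup>2)"
  using int_on_Cauchy_Schwarz[OF assms(1-3), of "\<lambda>y. \<bar>k y\<bar>"] assms(4,5) by simp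

lemma sum_sq_le: "((a::real) + b)\<^sup>2 \<le> 2 * a\<^sup>2 + 2 * b\<^sup>2"
  using sum_squares_bound[of a b] by (simp add: power2_sum)

text \<open>On an interval of length \<open>l\<close> the function differs from its value at any other point by at most
  \<open>\<integral>\<bar>g\<bar>\<close>, so it is bounded by its mean plus \<open>\<integral>\<bar>g\<bar>\<close>.\<close>

lemma block_interpolation:
  assumes F: "primitive_on c d F g" "integrable (Leb c d) F" "integrable (Leb c d) (\<lambda>y. (F y)\<^sup>2)"
    and g: "integrable (Leb c d) g" "integrable (Leb c d) (\<lambda>y. (g y)\<^sup>2)"
    and st: "c \<le> s" "s < t" "t \<le> d" and l: "l = t - s"
  shows "int_on c d s t (\<lambda>y. (F y)\<^sup>2)
    \<le> 2 / l * (int_on c d s t (\<lambda>y. \<bar>F y\<bar>))\<^sup>2 + 2 * l\<^sup>2 * int_on c d s t (\<lambda>y. (g y)\<^sup>2)"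
proof -
  define A where "A = int_on c d s t (\<lambda>y. \<bar>F y\<bar>)"
  define K where "K = int_on c d s t (\<lambda>y. \<bar>g y\<bar>)"
  have l0: "l > 0" using st l by simp
  have pt: "\<bar>F y\<bar> \<le> A / l + K" if "y \<in> {s..t}" for y
  proof -
    have "(t - s) * (\<bar>F y\<bar> - K) \<le> A" unfolding A_def
    proof (rule int_on_ge_const)
      fix y' assume "y' \<in> {s..t}"
      then show "\<bar>F y\<bar> - K \<le> \<bar>F y'\<bar>"
        using primitive_on_osc[OF F(1) g(1) st(1,3) that, of y'] unfolding K_def by linarith
    qed (use st F in auto)
    then have "(\<bar>F y\<bar> - K) * l \<le> A" unfolding l by (simp add: mult.commute)
    then have "\<bar>F y\<bar> - K \<le> A / l" using l0 by (simp add: pos_le_divide_eq)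
    then show ?thesis by linarith
  qed
  have "int_on c d s t (\<lambda>y. (F y)\<^sup>2) \<le> (t - s) * (2 * (A / l)\<^sup>2 + 2 * K\<^sup>2)"
  proof (rule int_on_le_const_AE, goal_cases)
    case 5
    have "(F y)\<^sup>2 \<le> 2 * (A / l)\<^sup>2 + 2 * K\<^sup>2" if "y \<in> {s..t}" for y
      using power_mono[OF pt[OF that], of 2] sum_sq_le[of "A / l" K] by simp
    then show ?case by simp
  qed (use st F in auto)
  also have "\<dots> = 2 / l * A\<^sup>2 + 2 * l * K\<^sup>2" unfolding l[symmetric] using l0 by (simp add: field_simps power2_eq_square)
  also have "2 * l * K\<^sup>2 \<le> 2 * l * (l * int_on c d s t (\<lambda>y. (g y)\<^sup>2))"
    using int_on_sq_le[OF st g] l0 l unfolding K_def by (intro mult_left_mono) auto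
  finally show ?thesis by (simp add: A_def power2_eq_square mult.assoc)
qed

text \<open>Take one point in the left third and one in the right third of the interval. The difference of
  the values of \<open>V\<close> at these points equals their distance, which is at least \<open>l/3\<close>, times the slope at
  \<open>y\<close>, up to the oscillation \<open>\<integral>\<bar>k\<bar>\<close> of the slope. Averaging over both points replaces the values of \<open>V\<close> by
  integrals and gives the constant \<open>9 = 3 * 3\<close>.\<close>

lemma block_slope_bound:
  assumes V: "primitive_on c d V \<gamma>" "integrable (Leb c d) V"
    and \<gamma>: "primitive_on c d \<gamma> k" "integrable (Leb c d) \<gamma>" and k: "integrable (Leb c d) k"
    and st: "c \<le> s" "s < t" "t \<le> d" and l: "l = t - s" and y: "y \<in> {s..t}"
  shows "\<bar>\<gamma> y\<bar> \<le> 9 / l\<^sup>2 * int_on c d s t (\<lambda>y. \<bar>V y\<bar>) + int_on c d s t (\<lambda>y. \<bar>k y\<bar>)"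
proof -
  define K where "K = int_on c d s t (\<lambda>y. \<bar>k y\<bar>)"
  define p where "p = s + l / 3"
  define q where "q = t - l / 3"
  have pq: "s < p" "p < q" "q < t" "p - s = l / 3" "t - q = l / 3" "l > 0"
    using st unfolding p_def q_def l by (simp_all add: field_simps)
  have slope: "(\<bar>\<gamma> y\<bar> - K) * (l / 3) \<le> \<bar>V y1\<bar> + \<bar>V y2\<bar>" if "y1 \<in> {s..p}" "y2 \<in> {q..t}" for y1 y2
  proof (cases "\<bar>\<gamma> y\<bar> \<ge> K")
    case True
    have in1: "c \<le> y1" "y1 \<le> y2" "y2 \<le> d" using that pq st by auto
    have "V y2 - V y1 = int_on c d y1 y2 \<gamma>" using V(1) in1 by (auto simp: primitive_on_def)
    moreover have "int_on c d y1 y2 \<gamma> \<le> (y2 - y1) * (\<gamma> y + K)"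
    proof (rule int_on_le_const_AE[OF in1 \<gamma>(2)], intro AE_I2 impI)
      fix u assume "u \<in> {y1..y2}"
      then have "u \<in> {s..t}" using that pq by auto
      then show "\<gamma> u \<le> \<gamma> y + K" using primitive_on_osc[OF \<gamma>(1) k st(1,3) _ y, of u] unfolding K_def by linarith
    qed
    moreover have "(y2 - y1) * (\<gamma> y - K) \<le> int_on c d y1 y2 \<gamma>"
    proof (rule int_on_ge_const[OF in1 \<gamma>(2)])
      fix u assume "u \<in> {y1..y2}"
      then have "u \<in> {s..t}" using that pq by auto
      then show "\<gamma> y - K \<le> \<gamma> u" using primitive_on_osc[OF \<gamma>(1) k st(1,3) _ y, of u] unfolding K_def by linarith
    qed
    ultimately have "(y2 - y1) * (\<bar>\<gamma> y\<bar> - K) \<le> \<bar>V y1\<bar> + \<bar>V y2\<bar>"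
      by (cases "\<gamma> y \<ge> 0") (auto simp: algebra_simps)
    moreover have "l / 3 * (\<bar>\<gamma> y\<bar> - K) \<le> (y2 - y1) * (\<bar>\<gamma> y\<bar> - K)"
    proof (rule mult_right_mono)
      have "q - p = l / 3" by (simp add: p_def q_def l field_simps)
      then show "l / 3 \<le> y2 - y1" using that by auto
    qed (use True in simp)
    ultimately show ?thesis by (simp add: mult.commute)
  next
    case False
    then have "(\<bar>\<gamma> y\<bar> - K) * (l / 3) \<le> 0" using pq by (simp add: mult_le_0_iff)
    then show ?thesis by linarith
  qed
  define A1 where "A1 = int_on c d s p (\<lambda>y. \<bar>V y\<bar>)"
  define A3 where "A3 = int_on c d q t (\<lambda>y. \<bar>V y\<bar>)"
  have 1: "(\<bar>\<gamma> y\<bar> - K) * (l / 3) - A1 / (l / 3) \<le> \<bar>V y2\<bar>" if "y2 \<in> {q..t}" for y2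
  proof -
    have "(p - s) * ((\<bar>\<gamma> y\<bar> - K) * (l / 3) - \<bar>V y2\<bar>) \<le> A1" unfolding A1_def
    proof (rule int_on_ge_const)
      fix y1 assume "y1 \<in> {s..p}"
      from slope[OF this that] show "(\<bar>\<gamma> y\<bar> - K) * (l / 3) - \<bar>V y2\<bar> \<le> \<bar>V y1\<bar>" by linarith
    qed (use st pq V in auto)
    then have "(\<bar>\<gamma> y\<bar> - K) * (l / 3) - \<bar>V y2\<bar> \<le> A1 / (l / 3)" unfolding pq(4) using pq(6)
      by (subst pos_le_divide_eq) (auto simp: mult.commute)
    then show ?thesis by linarith
  qed
  have "(t - q) * ((\<bar>\<gamma> y\<bar> - K) * (l / 3) - A1 / (l / 3)) \<le> A3" unfolding A3_def
    by (rule int_on_ge_const) (use 1 st pq V in auto)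
  then have a: "(l / 3) * ((\<bar>\<gamma> y\<bar> - K) * (l / 3) - A1 / (l / 3)) \<le> A3" unfolding pq(5) .
  have b: "(l / 3) * (z - A1 / (l / 3)) = z * (l / 3) - A1" for z
    using pq(6) by (simp add: right_diff_distrib)
  have "(\<bar>\<gamma> y\<bar> - K) * (l / 3) * (l / 3) = (\<bar>\<gamma> y\<bar> - K) * (l\<^sup>2 / 9)" by (simp add: power2_eq_square)
  then have 2: "(\<bar>\<gamma> y\<bar> - K) * (l\<^sup>2 / 9) \<le> A1 + A3" using a unfolding b by linarith
  have "A1 + A3 \<le> int_on c d s t (\<lambda>y. \<bar>V y\<bar>)"
  proof -
    have "A3 \<le> int_on c d p t (\<lambda>y. \<bar>V y\<bar>)" unfolding A3_def using V pq by (intro int_on_subset) auto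
    then show ?thesis using int_on_add[of c d "\<lambda>y. \<bar>V y\<bar>" s p t] V pq unfolding A1_def by simp
  qed
  with 2 have "(\<bar>\<gamma> y\<bar> - K) * (l\<^sup>2 / 9) \<le> int_on c d s t (\<lambda>y. \<bar>V y\<bar>)" by linarith
  then have "\<bar>\<gamma> y\<bar> - K \<le> int_on c d s t (\<lambda>y. \<bar>V y\<bar>) / (l\<^sup>2 / 9)" using pq(6) by (subst pos_le_divide_eq) auto
  then show ?thesis unfolding K_def by (simp add: mult.commute)
qed

lemma block_slope_L2:
  assumes V: "primitive_on c d V \<gamma>" "integrable (Leb c d) V" "integrable (Leb c d) (\<lambda>y. (V y)\<^sup>2)"
    and \<gamma>: "primitive_on c d \<gamma> k" "integrable (Leb c d) \<gamma>" "integrable (Leb c d) (\<lambda>y. (\<gamma> y)\<^sup>2)"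
    and k: "integrable (Leb c d) k" "integrable (Leb c d) (\<lambda>y. (k y)\<^sup>2)"
    and st: "c \<le> s" "s < t" "t \<le> d" and l: "l = t - s"
  shows "int_on c d s t (\<lambda>y. (\<gamma> y)\<^sup>2)
    \<le> 162 / l\<^sup>2 * int_on c d s t (\<lambda>y. (V y)\<^sup>2) + 2 * l\<^sup>2 * int_on c d s t (\<lambda>y. (k y)\<^sup>2)"
proof -
  define A where "A = int_on c d s t (\<lambda>y. \<bar>V y\<bar>)"
  define K where "K = int_on c d s t (\<lambda>y. \<bar>k y\<bar>)"
  have l0: "l > 0" using st l by simp
  have "int_on c d s t (\<lambda>y. (\<gamma> y)\<^sup>2) \<le> (t - s) * (2 * (9 / l\<^sup>2 * A)\<^sup>2 + 2 * K\<^sup>2)"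
  proof (rule int_on_le_const_AE, goal_cases)
    case 5
    have "(\<gamma> y)\<^sup>2 \<le> 2 * (9 / l\<^sup>2 * A)\<^sup>2 + 2 * K\<^sup>2" if "y \<in> {s..t}" for y
      using power_mono[OF block_slope_bound[OF V(1,2) \<gamma>(1,2) k(1) st l that], of 2] sum_sq_le[of "9 / l\<^sup>2 * A" K]
      unfolding A_def K_def by simp
    then show ?case by simp
  qed (use st \<gamma> in auto)
  also have "\<dots> = 162 / l^3 * A\<^sup>2 + 2 * l * K\<^sup>2" unfolding l[symmetric] using l0
    by (simp add: field_simps power2_eq_square power3_eq_cube)
  also have "\<dots> \<le> 162 / l^3 * (l * int_on c d s t (\<lambda>y. (V y)\<^sup>2)) + 2 * l * (l * int_on c d s t (\<lambda>y. (k y)\<^sup>2))"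
    using int_on_sq_le[OF st k] int_on_sq_le[OF st V(2,3)] l0 l unfolding K_def A_def
    by (intro add_mono mult_left_mono) auto
  also have "\<dots> = 162 / l\<^sup>2 * int_on c d s t (\<lambda>y. (V y)\<^sup>2) + 2 * l\<^sup>2 * int_on c d s t (\<lambda>y. (k y)\<^sup>2)"
    using l0 by (simp add: field_simps power2_eq_square power3_eq_cube)
  finally show ?thesis .
qed

text \<open>With a bound \<open>m\<close> on the slope, one of the two factors of \<open>\<gamma>\<^sup>2\<close> is estimated by \<open>m\<close> and the other one by
  the slope bound. The result is linear in \<open>\<integral>\<bar>V\<bar>\<close>, so it survives summation over blocks and integration over
  lines.\<close>

lemma block_slope_Linfty:
  assumes V: "primitive_on c d V \<gamma>" "integrable (Leb c d) V"
    and \<gamma>: "primitive_on c d \<gamma> k" "integrable (Leb c d) \<gamma>" "integrable (Leb c d) (\<lambda>y. (\<gamma> y)\<^sup>2)"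
    and k: "integrable (Leb c d) k" "integrable (Leb c d) (\<lambda>y. (k y)\<^sup>2)"
    and m: "AE y in Leb c d. \<bar>\<gamma> y\<bar> \<le> m"
    and st: "c \<le> s" "s < t" "t \<le> d" and l: "l = t - s"
  shows "int_on c d s t (\<lambda>y. (\<gamma> y)\<^sup>2)
    \<le> 18 * m / l * int_on c d s t (\<lambda>y. \<bar>V y\<bar>) + l\<^sup>2 * int_on c d s t (\<lambda>y. (k y)\<^sup>2)"
proof -
  define A where "A = int_on c d s t (\<lambda>y. \<bar>V y\<bar>)"
  define K where "K = int_on c d s t (\<lambda>y. \<bar>k y\<bar>)"
  have l0: "l > 0" using st l by simp
  have A0: "A \<ge> 0" unfolding A_def by (rule int_on_nonneg) simp
  have "int_on c d s t (\<lambda>y. (\<gamma> y)\<^sup>2) \<le> (t - s) * (18 * m / l\<^sup>2 * A + K\<^sup>2)"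
  proof (rule int_on_le_const_AE, goal_cases)
    case 5
    show ?case using m
    proof (eventually_elim, intro impI)
      fix y assume y: "\<bar>\<gamma> y\<bar> \<le> m" "y \<in> {s..t}"
      have "(\<gamma> y)\<^sup>2 = \<bar>\<gamma> y\<bar> * \<bar>\<gamma> y\<bar>" by (simp add: power2_eq_square)
      also have "\<dots> \<le> \<bar>\<gamma> y\<bar> * (9 / l\<^sup>2 * A + K)"
        using block_slope_bound[OF V(1,2) \<gamma>(1,2) k(1) st l y(2)] unfolding A_def K_def by (intro mult_left_mono) auto
      also have "\<dots> = \<bar>\<gamma> y\<bar> * (9 / l\<^sup>2 * A) + \<bar>\<gamma> y\<bar> * K" by (simp add: algebra_simps)
      also have "\<dots> \<le> m * (9 / l\<^sup>2 * A) + ((\<gamma> y)\<^sup>2 + K\<^sup>2) / 2"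
        using y(1) A0 sum_squares_bound[of "\<bar>\<gamma> y\<bar>" K] by (intro add_mono mult_right_mono) auto
      finally show "(\<gamma> y)\<^sup>2 \<le> 18 * m / l\<^sup>2 * A + K\<^sup>2" by (simp add: field_simps)
    qed
  qed (use st \<gamma> in auto)
  also have "\<dots> = 18 * m / l * A + l * K\<^sup>2" unfolding l[symmetric] using l0
    by (simp add: field_simps power2_eq_square)
  also have "\<dots> \<le> 18 * m / l * A + l * (l * int_on c d s t (\<lambda>y. (k y)\<^sup>2))"
    using int_on_sq_le[OF st k] l0 l unfolding K_def by (intro add_left_mono mult_left_mono) auto
  finally show ?thesis by (simp add: A_def power2_eq_square mult.assoc)
qed

lemma sum_blocks:
  assumes "integrable (Leb c d) h" "l \<ge> 0"
  shows "(\<Sum>j<n. int_on c d (c + real j * l) (c + real (Suc j) * l) h) = int_on c d c (c + real n * l) h"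
proof (induction n)
  case 0
  have "int_on c d c c h = int_on c d c c h + int_on c d c c h" using int_on_add[OF assms(1), of c c c] by simp
  then show ?case by simp
next
  case (Suc n)
  have "int_on c d c (c + real n * l) h + int_on c d (c + real n * l) (c + real (Suc n) * l) h = int_on c d c (c + real (Suc n) * l) h"
    using assms by (intro int_on_add) (auto simp: algebra_simps)
  then show ?case using Suc by simp
qed

lemma int_on_whole: "int_on c d c d h = (\<integral>y. h y \<partial>Leb c d)"
  by (rule integral_Leb_cong_space) auto

lemma sum_blocks_whole:
  assumes "integrable (Leb c d) h" "c < d" "n \<ge> 1" "l = (d - c) / real n"
  shows "(\<Sum>j<n. int_on c d (c + real j * l) (c + real (Suc j) * l) h) = (\<integral>y. h y \<partial>Leb c d)"
  using sum_blocks[OF assms(1), of l n] assms(2-4) by (simp add: int_on_whole)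

lemma block_bounds:
  assumes "c < d" "n \<ge> 1" "l = (d - c) / real n" "j < n"
  shows "c \<le> c + real j * l" "c + real j * l < c + real (Suc j) * l" "c + real (Suc j) * l \<le> d"
    "l = (c + real (Suc j) * l) - (c + real j * l)"
proof -
  have l: "l > 0" using assms by simp
  then show "c \<le> c + real j * l" "c + real j * l < c + real (Suc j) * l" by auto
  have "real (Suc j) * l \<le> real n * l" using assms(4) l by (intro mult_right_mono) auto
  also have "\<dots> = d - c" using assms by simp
  finally show "c + real (Suc j) * l \<le> d" by simp
  show "l = (c + real (Suc j) * l) - (c + real j * l)" by (simp add: algebra_simps)
qed

text \<open>The interval is cut into \<open>n\<close> blocks of length \<open>l\<close>. The parameter \<open>n\<close> stays free; choosing it optimally
  later replaces the interpolation inequality with fractional powers.\<close>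

lemma interpolation_line:
  assumes F: "primitive_on c d F g" "integrable (Leb c d) F" "integrable (Leb c d) (\<lambda>y. (F y)\<^sup>2)"
    and g: "integrable (Leb c d) g" "integrable (Leb c d) (\<lambda>y. (g y)\<^sup>2)"
    and l: "c < d" "n \<ge> 1" "l = (d - c) / real n"
  shows "(\<integral>y. (F y)\<^sup>2 \<partial>Leb c d) \<le> 2 / l * (\<integral>y. \<bar>F y\<bar> \<partial>Leb c d)\<^sup>2 + 2 * l\<^sup>2 * (\<integral>y. (g y)\<^sup>2 \<partial>Leb c d)"
proof -
  have l0: "l > 0" using l by simp
  let ?s = "\<lambda>j. c + real j * l" and ?t = "\<lambda>j. c + real (Suc j) * l"
  let ?A = "\<lambda>j. int_on c d (?s j) (?t j) (\<lambda>y. \<bar>F y\<bar>)"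
  have A0: "?A j \<ge> 0" for j by (rule int_on_nonneg) simp
  have AS: "(\<Sum>j<n. ?A j) = (\<integral>y. \<bar>F y\<bar> \<partial>Leb c d)" using F by (intro sum_blocks_whole[OF _ l]) auto
  have "(\<integral>y. (F y)\<^sup>2 \<partial>Leb c d) = (\<Sum>j<n. int_on c d (?s j) (?t j) (\<lambda>y. (F y)\<^sup>2))"
    by (rule sum_blocks_whole[OF F(3) l, symmetric])
  also have "\<dots> \<le> (\<Sum>j<n. 2 / l * (?A j)\<^sup>2 + 2 * l\<^sup>2 * int_on c d (?s j) (?t j) (\<lambda>y. (g y)\<^sup>2))"
  proof (rule sum_mono)
    fix j assume "j \<in> {..<n}"
    then show "int_on c d (?s j) (?t j) (\<lambda>y. (F y)\<^sup>2) \<le> 2 / l * (?A j)\<^sup>2 + 2 * l\<^sup>2 * int_on c d (?s j) (?t j) (\<lambda>y. (g y)\<^sup>2)"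
      by (intro block_interpolation[OF F g] block_bounds[OF l]) auto
  qed
  also have "\<dots> = 2 / l * (\<Sum>j<n. (?A j)\<^sup>2) + 2 * l\<^sup>2 * (\<integral>y. (g y)\<^sup>2 \<partial>Leb c d)"
    unfolding sum.distrib sum_distrib_left[symmetric] sum_blocks_whole[OF g(2) l] ..
  also have "\<dots> \<le> 2 / l * (\<Sum>j<n. ?A j)\<^sup>2 + 2 * l\<^sup>2 * (\<integral>y. (g y)\<^sup>2 \<partial>Leb c d)"
  proof (intro add_right_mono mult_left_mono)
    have "(\<Sum>j<n. (?A j)\<^sup>2) \<le> (\<Sum>j<n. (\<Sum>i<n. ?A i) * ?A j)"
      unfolding power2_eq_square using A0 by (intro sum_mono mult_right_mono member_le_sum) auto
    then show "(\<Sum>j<n. (?A j)\<^sup>2) \<le> (\<Sum>j<n. ?A j)\<^sup>2" by (simp add: power2_eq_square flip: sum_distrib_left)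
  qed (use l0 in simp)
  finally show ?thesis unfolding AS .
qed

lemma slope_line_L2:
  assumes V: "primitive_on c d V \<gamma>" "integrable (Leb c d) V" "integrable (Leb c d) (\<lambda>y. (V y)\<^sup>2)"
    and \<gamma>: "primitive_on c d \<gamma> k" "integrable (Leb c d) \<gamma>" "integrable (Leb c d) (\<lambda>y. (\<gamma> y)\<^sup>2)"
    and k: "integrable (Leb c d) k" "integrable (Leb c d) (\<lambda>y. (k y)\<^sup>2)"
    and l: "c < d" "n \<ge> 1" "l = (d - c) / real n"
  shows "(\<integral>y. (\<gamma> y)\<^sup>2 \<partial>Leb c d) \<le> 162 / l\<^sup>2 * (\<integral>y. (V y)\<^sup>2 \<partial>Leb c d) + 2 * l\<^sup>2 * (\<integral>y. (k y)\<^sup>2 \<partial>Leb c d)"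
proof -
  let ?s = "\<lambda>j. c + real j * l" and ?t = "\<lambda>j. c + real (Suc j) * l"
  have "(\<integral>y. (\<gamma> y)\<^sup>2 \<partial>Leb c d) = (\<Sum>j<n. int_on c d (?s j) (?t j) (\<lambda>y. (\<gamma> y)\<^sup>2))"
    by (rule sum_blocks_whole[OF \<gamma>(3) l, symmetric])
  also have "\<dots> \<le> (\<Sum>j<n. 162 / l\<^sup>2 * int_on c d (?s j) (?t j) (\<lambda>y. (V y)\<^sup>2) + 2 * l\<^sup>2 * int_on c d (?s j) (?t j) (\<lambda>y. (k y)\<^sup>2))"
    by (rule sum_mono, rule block_slope_L2[OF V \<gamma> k]; rule block_bounds[OF l]; simp)
  also have "\<dots> = 162 / l\<^sup>2 * (\<integral>y. (V y)\<^sup>2 \<partial>Leb c d) + 2 * l\<^sup>2 * (\<integral>y. (k y)\<^sup>2 \<partial>Leb c d)"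
    unfolding sum.distrib sum_distrib_left[symmetric] sum_blocks_whole[OF V(3) l] sum_blocks_whole[OF k(2) l] ..
  finally show ?thesis .
qed

lemma slope_line_Linfty:
  assumes V: "primitive_on c d V \<gamma>" "integrable (Leb c d) V"
    and \<gamma>: "primitive_on c d \<gamma> k" "integrable (Leb c d) \<gamma>" "integrable (Leb c d) (\<lambda>y. (\<gamma> y)\<^sup>2)"
    and k: "integrable (Leb c d) k" "integrable (Leb c d) (\<lambda>y. (k y)\<^sup>2)"
    and m: "AE y in Leb c d. \<bar>\<gamma> y\<bar> \<le> m"
    and l: "c < d" "n \<ge> 1" "l = (d - c) / real n"
  shows "(\<integral>y. (\<gamma> y)\<^sup>2 \<partial>Leb c d) \<le> 18 * m / l * (\<integral>y. \<bar>V y\<bar> \<partial>Leb c d) + l\<^sup>2 * (\<integral>y. (k y)\<^sup>2 \<partial>Leb c d)"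
proof -
  let ?s = "\<lambda>j. c + real j * l" and ?t = "\<lambda>j. c + real (Suc j) * l"
  have V1: "integrable (Leb c d) (\<lambda>y. \<bar>V y\<bar>)" using V by simp
  have "(\<integral>y. (\<gamma> y)\<^sup>2 \<partial>Leb c d) = (\<Sum>j<n. int_on c d (?s j) (?t j) (\<lambda>y. (\<gamma> y)\<^sup>2))"
    by (rule sum_blocks_whole[OF \<gamma>(3) l, symmetric])
  also have "\<dots> \<le> (\<Sum>j<n. 18 * m / l * int_on c d (?s j) (?t j) (\<lambda>y. \<bar>V y\<bar>) + l\<^sup>2 * int_on c d (?s j) (?t j) (\<lambda>y. (k y)\<^sup>2))"
    by (rule sum_mono, rule block_slope_Linfty[OF V \<gamma> k m]; rule block_bounds[OF l]; simp)
  also have "\<dots> = 18 * m / l * (\<integral>y. \<bar>V y\<bar> \<partial>Leb c d) + l\<^sup>2 * (\<integral>y. (k y)\<^sup>2 \<partial>Leb c d)"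
    unfolding sum.distrib sum_distrib_left[symmetric] sum_blocks_whole[OF V1 l] sum_blocks_whole[OF k(2) l] ..
  finally show ?thesis .
qed

text \<open>A function of mean zero is bounded by its oscillation.\<close>

lemma Poincare_line:
  assumes \<gamma>: "primitive_on c d \<gamma> k" "integrable (Leb c d) \<gamma>" "integrable (Leb c d) (\<lambda>y. (\<gamma> y)\<^sup>2)" "(\<integral>y. \<gamma> y \<partial>Leb c d) = 0"
    and k: "integrable (Leb c d) k" "integrable (Leb c d) (\<lambda>y. (k y)\<^sup>2)" and "c < d"
  shows "(\<integral>y. (\<gamma> y)\<^sup>2 \<partial>Leb c d) \<le> (d - c)\<^sup>2 * (\<integral>y. (k y)\<^sup>2 \<partial>Leb c d)"
proof -
  define K where "K = int_on c d c d (\<lambda>y. \<bar>k y\<bar>)"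
  have pt: "\<bar>\<gamma> y\<bar> \<le> K" if y: "y \<in> {c..d}" for y
  proof -
    have *: "\<bar>\<gamma> y - \<gamma> y'\<bar> \<le> K" if "y' \<in> {c..d}" for y'
      unfolding K_def by (rule primitive_on_osc[OF \<gamma>(1) k(1) _ _ y that]) auto
    have "(d - c) * (\<gamma> y - K) \<le> int_on c d c d \<gamma>"
      by (rule int_on_ge_const[OF _ _ _ \<gamma>(2)]) (use * \<open>c < d\<close> in \<open>fastforce simp: abs_le_iff\<close>)+
    moreover have "int_on c d c d \<gamma> \<le> (d - c) * (\<gamma> y + K)"
      by (rule int_on_le_const_AE[OF _ _ _ \<gamma>(2)]) (use * \<open>c < d\<close> in \<open>fastforce simp: abs_le_iff\<close>)+
    ultimately have "\<gamma> y - K \<le> 0" "0 \<le> \<gamma> y + K" using \<gamma>(4) \<open>c < d\<close>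
      by (auto simp: int_on_whole mult_le_0_iff zero_le_mult_iff)
    then show ?thesis by linarith
  qed
  have "int_on c d c d (\<lambda>y. (\<gamma> y)\<^sup>2) \<le> (d - c) * K\<^sup>2"
  proof (rule int_on_le_const_AE, goal_cases)
    case 5
    show ?case using power_mono[OF pt, of _ 2] by simp
  qed (use assms in auto)
  also have "\<dots> \<le> (d - c) * ((d - c) * int_on c d c d (\<lambda>y. (k y)\<^sup>2))"
    unfolding K_def using int_on_sq_le[OF _ \<open>c < d\<close> _ k] \<open>c < d\<close> by (intro mult_left_mono) auto
  finally show ?thesis by (simp add: int_on_whole power2_eq_square mult.assoc)
qed

section \<open>Interpolation inequalities on a rectangle\<close>

lemma primitive_on_cong_AE:
  assumes "primitive_on c d V \<gamma>" "AE y in Leb c d. \<gamma> y = \<Gamma> y" "integrable (Leb c d) \<gamma>" "integrable (Leb c d) \<Gamma>"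
  shows "primitive_on c d V \<Gamma>"
proof -
  have "int_on c d s t \<gamma> = int_on c d s t \<Gamma>" for s t
    by (rule integral_cong_AE) (use assms in \<open>auto intro!: borel_measurable_integrable[OF integrable_int_on] elim!: eventually_mono\<close>)
  then show ?thesis using assms(1) by (simp add: primitive_on_def)
qed

lemma exact_representative:
  fixes f g :: "real \<Rightarrow> real"
  assumes f: "integrable (Leb c d) f" "integrable (Leb c d) (\<lambda>y. (f y)\<^sup>2)" and g: "integrable (Leb c d) g"
    and rep: "\<exists>C. AE y in Leb c d. f y = C + (\<integral>t. indicator {c..y} t * g t \<partial>Leb c d)"
  obtains F where "primitive_on c d F g" "integrable (Leb c d) F" "integrable (Leb c d) (\<lambda>y. (F y)\<^sup>2)"
    "AE y in Leb c d. f y = F y" "(\<integral>y. (f y)\<^sup>2 \<partial>Leb c d) = (\<integral>y. (F y)\<^sup>2 \<partial>Leb c d)"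
    "(\<integral>y. \<bar>f y\<bar> \<partial>Leb c d) = (\<integral>y. \<bar>F y\<bar> \<partial>Leb c d)" "(\<integral>y. f y \<partial>Leb c d) = (\<integral>y. F y \<partial>Leb c d)"
proof -
  obtain C where C: "AE y in Leb c d. f y = C + (\<integral>t. indicator {c..y} t * g t \<partial>Leb c d)" using rep by blast
  define F where "F = (\<lambda>y. C + (\<integral>t. indicator {c..y} t * g t \<partial>Leb c d))"
  have F: "integrable (Leb c d) F" unfolding F_def using integrable_primitive[OF g] by simp
  have AE: "AE y in Leb c d. f y = F y" using C by (simp add: F_def)
  have m: "f \<in> borel_measurable (Leb c d)" "F \<in> borel_measurable (Leb c d)" using f F by auto
  have AE2: "AE y in Leb c d. (f y)\<^sup>2 = (F y)\<^sup>2" using AE by eventually_elim simp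
  have AEa: "AE y in Leb c d. \<bar>f y\<bar> = \<bar>F y\<bar>" using AE by eventually_elim simp
  have m2: "(\<lambda>y. (f y)\<^sup>2) \<in> borel_measurable (Leb c d)" "(\<lambda>y. (F y)\<^sup>2) \<in> borel_measurable (Leb c d)"
    "(\<lambda>y. \<bar>f y\<bar>) \<in> borel_measurable (Leb c d)" "(\<lambda>y. \<bar>F y\<bar>) \<in> borel_measurable (Leb c d)"
    using m by (auto intro: borel_measurable_power borel_measurable_abs)
  show ?thesis
  proof (rule that[of F])
    show "primitive_on c d F g" unfolding F_def by (rule primitive_on_primitive[OF g])
    show "integrable (Leb c d) (\<lambda>y. (F y)\<^sup>2)" using integrable_cong_AE[OF m2(1,2) AE2] f(2) by simp
    show "(\<integral>y. (f y)\<^sup>2 \<partial>Leb c d) = (\<integral>y. (F y)\<^sup>2 \<partial>Leb c d)" by (rule integral_cong_AE[OF m2(1,2) AE2])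
    show "(\<integral>y. \<bar>f y\<bar> \<partial>Leb c d) = (\<integral>y. \<bar>F y\<bar> \<partial>Leb c d)" by (rule integral_cong_AE[OF m2(3,4) AEa])
    show "(\<integral>y. f y \<partial>Leb c d) = (\<integral>y. F y \<partial>Leb c d)" by (rule integral_cong_AE[OF m AE])
  qed (fact F AE)+
qed

text \<open>Tested with products only, and with the second coordinate as the direction of differentiation; the
  other direction is obtained by swapping the coordinates.\<close>

definition weak_dy :: "real \<Rightarrow> real \<Rightarrow> real \<Rightarrow> real \<Rightarrow> (real \<times> real \<Rightarrow> real) \<Rightarrow> (real \<times> real \<Rightarrow> real) \<Rightarrow> bool" where
  "weak_dy a b c d f g \<longleftrightarrow> (\<forall>\<alpha>\<in>bumps a b. \<forall>\<beta>\<in>bumps c d.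
     (\<integral>x. f x * (\<alpha> (fst x) * deriv \<beta> (snd x)) \<partial>Rect a b c d) = - (\<integral>x. g x * (\<alpha> (fst x) * \<beta> (snd x)) \<partial>Rect a b c d))"

definition sq_integrable :: "'a measure \<Rightarrow> ('a \<Rightarrow> real) \<Rightarrow> bool" where
  "sq_integrable M f \<longleftrightarrow> integrable M f \<and> integrable M (\<lambda>x. (f x)\<^sup>2)"

lemma sq_integrable_lines:
  "sq_integrable (Rect a b c d) f \<Longrightarrow>
    AE x in Leb a b. integrable (Leb c d) (\<lambda>y. f (x, y)) \<and> integrable (Leb c d) (\<lambda>y. (f (x, y))\<^sup>2)"
  unfolding sq_integrable_def by (intro AE_conjI) (auto intro: Leb2.AE_integrable_fst')

lemma weak_dy_lines:
  assumes "sq_integrable (Rect a b c d) f" "sq_integrable (Rect a b c d) g" "weak_dy a b c d f g" "c < d"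
  shows "AE x in Leb a b. \<exists>C. AE y in Leb c d. f (x, y) = C + (\<integral>t. indicator {c..y} t * g (x, t) \<partial>Leb c d)"
  using assms by (intro absolutely_continuous_on_lines) (auto simp: weak_dy_def sq_integrable_def)

lemma integrate_over_lines:
  fixes h1 h2 h3 :: "real \<times> real \<Rightarrow> real"
  assumes h: "integrable (Rect a b c d) h1" "integrable (Rect a b c d) h2" "integrable (Rect a b c d) h3"
    and le: "AE x in Leb a b. (\<integral>y. h1 (x, y) \<partial>Leb c d) \<le> A * (\<integral>y. h2 (x, y) \<partial>Leb c d) + B * (\<integral>y. h3 (x, y) \<partial>Leb c d)"
  shows "integral\<^sup>L (Rect a b c d) h1 \<le> A * integral\<^sup>L (Rect a b c d) h2 + B * integral\<^sup>L (Rect a b c d) h3"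
proof -
  note i = Leb2.integrable_fst'[OF h(1)] Leb2.integrable_fst'[OF h(2)] Leb2.integrable_fst'[OF h(3)]
  have "(\<integral>x. (\<integral>y. h1 (x, y) \<partial>Leb c d) \<partial>Leb a b) \<le> (\<integral>x. A * (\<integral>y. h2 (x, y) \<partial>Leb c d) + B * (\<integral>y. h3 (x, y) \<partial>Leb c d) \<partial>Leb a b)"
    using i le by (intro integral_mono_AE) auto
  also have "\<dots> = A * (\<integral>x. (\<integral>y. h2 (x, y) \<partial>Leb c d) \<partial>Leb a b) + B * (\<integral>x. (\<integral>y. h3 (x, y) \<partial>Leb c d) \<partial>Leb a b)"
    using i by simp
  finally show ?thesis
    unfolding Leb2.integral_fst'[OF h(1)] Leb2.integral_fst'[OF h(2)] Leb2.integral_fst'[OF h(3)] .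
qed

text \<open>The squared line integral of \<open>\<bar>f\<bar>\<close> is dominated by a line integral of some integrable \<open>h\<close>. In the
  application \<open>h\<close> is a multiple of the squared hoop strain, so that the energy enters in the strong form of an
  \<open>L\<^sup>2\<close> bound in the transversal variable.\<close>

lemma interpolation_plane:
  assumes f: "sq_integrable (Rect a b c d) f" and g: "sq_integrable (Rect a b c d) g" and w: "weak_dy a b c d f g"
    and l: "c < d" "n \<ge> 1" "l = (d - c) / real n"
    and h: "integrable (Rect a b c d) h" "AE x in Leb a b. (\<integral>y. \<bar>f (x, y)\<bar> \<partial>Leb c d)\<^sup>2 \<le> (\<integral>y. h (x, y) \<partial>Leb c d)"
  shows "(\<integral>x. (f x)\<^sup>2 \<partial>Rect a b c d) \<le> 2 / l * integral\<^sup>L (Rect a b c d) h + 2 * l\<^sup>2 * (\<integral>x. (g x)\<^sup>2 \<partial>Rect a b c d)"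
proof (rule integrate_over_lines)
  have l0: "2 / l \<ge> 0" using l by simp
  show "AE x in Leb a b. (\<integral>y. (f (x, y))\<^sup>2 \<partial>Leb c d) \<le> 2 / l * (\<integral>y. h (x, y) \<partial>Leb c d) + 2 * l\<^sup>2 * (\<integral>y. (g (x, y))\<^sup>2 \<partial>Leb c d)"
    using sq_integrable_lines[OF f] sq_integrable_lines[OF g] weak_dy_lines[OF f g w l(1)] h(2)
  proof eventually_elim
    case (elim x)
    then obtain F where F: "primitive_on c d F (\<lambda>y. g (x, y))" "integrable (Leb c d) F" "integrable (Leb c d) (\<lambda>y. (F y)\<^sup>2)"
        "(\<integral>y. (f (x, y))\<^sup>2 \<partial>Leb c d) = (\<integral>y. (F y)\<^sup>2 \<partial>Leb c d)" "(\<integral>y. \<bar>f (x, y)\<bar> \<partial>Leb c d) = (\<integral>y. \<bar>F y\<bar> \<partial>Leb c d)"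
      by (elim conjE) (rule exact_representative[of c d "\<lambda>y. f (x, y)" "\<lambda>y. g (x, y)"])
    show ?case using interpolation_line[OF F(1-3) _ _ l] elim mult_left_mono[OF elim(4) l0] unfolding F(4,5) by fastforce
  qed
qed (use f g h in \<open>auto simp: sq_integrable_def\<close>)

lemma two_exact_representatives:
  fixes v \<gamma> k :: "real \<Rightarrow> real"
  assumes v: "integrable (Leb c d) v" "integrable (Leb c d) (\<lambda>y. (v y)\<^sup>2)"
    and \<gamma>: "integrable (Leb c d) \<gamma>" "integrable (Leb c d) (\<lambda>y. (\<gamma> y)\<^sup>2)" and k: "integrable (Leb c d) k"
    and rep: "\<exists>C. AE y in Leb c d. v y = C + (\<integral>t. indicator {c..y} t * \<gamma> t \<partial>Leb c d)"
    "\<exists>C. AE y in Leb c d. \<gamma> y = C + (\<integral>t. indicator {c..y} t * k t \<partial>Leb c d)"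
  obtains V \<Gamma> where "primitive_on c d V \<Gamma>" "integrable (Leb c d) V" "integrable (Leb c d) (\<lambda>y. (V y)\<^sup>2)"
    "primitive_on c d \<Gamma> k" "integrable (Leb c d) \<Gamma>" "integrable (Leb c d) (\<lambda>y. (\<Gamma> y)\<^sup>2)"
    "AE y in Leb c d. \<gamma> y = \<Gamma> y" "(\<integral>y. (v y)\<^sup>2 \<partial>Leb c d) = (\<integral>y. (V y)\<^sup>2 \<partial>Leb c d)"
    "(\<integral>y. \<bar>v y\<bar> \<partial>Leb c d) = (\<integral>y. \<bar>V y\<bar> \<partial>Leb c d)" "(\<integral>y. (\<gamma> y)\<^sup>2 \<partial>Leb c d) = (\<integral>y. (\<Gamma> y)\<^sup>2 \<partial>Leb c d)"
proof -
  obtain V where V: "primitive_on c d V \<gamma>" "integrable (Leb c d) V" "integrable (Leb c d) (\<lambda>y. (V y)\<^sup>2)"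
    "(\<integral>y. (v y)\<^sup>2 \<partial>Leb c d) = (\<integral>y. (V y)\<^sup>2 \<partial>Leb c d)" "(\<integral>y. \<bar>v y\<bar> \<partial>Leb c d) = (\<integral>y. \<bar>V y\<bar> \<partial>Leb c d)"
    by (rule exact_representative[OF v \<gamma>(1) rep(1)])
  obtain \<Gamma> where \<Gamma>: "primitive_on c d \<Gamma> k" "integrable (Leb c d) \<Gamma>" "integrable (Leb c d) (\<lambda>y. (\<Gamma> y)\<^sup>2)"
    "AE y in Leb c d. \<gamma> y = \<Gamma> y" "(\<integral>y. (\<gamma> y)\<^sup>2 \<partial>Leb c d) = (\<integral>y. (\<Gamma> y)\<^sup>2 \<partial>Leb c d)"
    by (rule exact_representative[OF \<gamma> k rep(2)])
  show ?thesis
    by (rule that[OF primitive_on_cong_AE[OF V(1) \<Gamma>(4) \<gamma>(1) \<Gamma>(2)] V(2,3) \<Gamma>(1-4) V(4,5) \<Gamma>(5)])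
qed

lemma slope_plane_L2:
  assumes v: "sq_integrable (Rect a b c d) v" and \<gamma>: "sq_integrable (Rect a b c d) \<gamma>" and k: "sq_integrable (Rect a b c d) k"
    and w: "weak_dy a b c d v \<gamma>" "weak_dy a b c d \<gamma> k"
    and l: "c < d" "n \<ge> 1" "l = (d - c) / real n"
  shows "(\<integral>x. (\<gamma> x)\<^sup>2 \<partial>Rect a b c d) \<le> 162 / l\<^sup>2 * (\<integral>x. (v x)\<^sup>2 \<partial>Rect a b c d) + 2 * l\<^sup>2 * (\<integral>x. (k x)\<^sup>2 \<partial>Rect a b c d)"
proof (rule integrate_over_lines)
  show "AE x in Leb a b. (\<integral>y. (\<gamma> (x, y))\<^sup>2 \<partial>Leb c d) \<le> 162 / l\<^sup>2 * (\<integral>y. (v (x, y))\<^sup>2 \<partial>Leb c d) + 2 * l\<^sup>2 * (\<integral>y. (k (x, y))\<^sup>2 \<partial>Leb c d)"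
    using sq_integrable_lines[OF v] sq_integrable_lines[OF \<gamma>] sq_integrable_lines[OF k]
      weak_dy_lines[OF v \<gamma> w(1) l(1)] weak_dy_lines[OF \<gamma> k w(2) l(1)]
  proof eventually_elim
    case (elim x)
    then obtain V \<Gamma> where *: "primitive_on c d V \<Gamma>" "integrable (Leb c d) V" "integrable (Leb c d) (\<lambda>y. (V y)\<^sup>2)"
      "primitive_on c d \<Gamma> (\<lambda>y. k (x, y))" "integrable (Leb c d) \<Gamma>" "integrable (Leb c d) (\<lambda>y. (\<Gamma> y)\<^sup>2)"
      "(\<integral>y. (v (x, y))\<^sup>2 \<partial>Leb c d) = (\<integral>y. (V y)\<^sup>2 \<partial>Leb c d)" "(\<integral>y. (\<gamma> (x, y))\<^sup>2 \<partial>Leb c d) = (\<integral>y. (\<Gamma> y)\<^sup>2 \<partial>Leb c d)"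
      by (elim conjE) (rule two_exact_representatives[of c d "\<lambda>y. v (x, y)" "\<lambda>y. \<gamma> (x, y)" "\<lambda>y. k (x, y)"])
    show ?case unfolding *(7,8) using elim by (intro slope_line_L2[OF *(1-6) _ _ l]) auto
  qed
qed (use v \<gamma> k in \<open>auto simp: sq_integrable_def\<close>)

lemma slope_plane_Linfty:
  assumes v: "sq_integrable (Rect a b c d) v" and \<gamma>: "sq_integrable (Rect a b c d) \<gamma>" and k: "sq_integrable (Rect a b c d) k"
    and w: "weak_dy a b c d v \<gamma>" "weak_dy a b c d \<gamma> k"
    and m: "AE x in Rect a b c d. \<bar>\<gamma> x\<bar> \<le> m"
    and l: "c < d" "n \<ge> 1" "l = (d - c) / real n"
  shows "(\<integral>x. (\<gamma> x)\<^sup>2 \<partial>Rect a b c d) \<le> 18 * m / l * (\<integral>x. \<bar>v x\<bar> \<partial>Rect a b c d) + l\<^sup>2 * (\<integral>x. (k x)\<^sup>2 \<partial>Rect a b c d)"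
proof (rule integrate_over_lines)
  show "AE x in Leb a b. (\<integral>y. (\<gamma> (x, y))\<^sup>2 \<partial>Leb c d) \<le> 18 * m / l * (\<integral>y. \<bar>v (x, y)\<bar> \<partial>Leb c d) + l\<^sup>2 * (\<integral>y. (k (x, y))\<^sup>2 \<partial>Leb c d)"
    using sq_integrable_lines[OF v] sq_integrable_lines[OF \<gamma>] sq_integrable_lines[OF k]
      weak_dy_lines[OF v \<gamma> w(1) l(1)] weak_dy_lines[OF \<gamma> k w(2) l(1)] Leb2.AE_pair[OF m]
  proof eventually_elim
    case (elim x)
    then obtain V \<Gamma> where *: "primitive_on c d V \<Gamma>" "integrable (Leb c d) V"
      "primitive_on c d \<Gamma> (\<lambda>y. k (x, y))" "integrable (Leb c d) \<Gamma>" "integrable (Leb c d) (\<lambda>y. (\<Gamma> y)\<^sup>2)"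
      and AE: "AE y in Leb c d. \<gamma> (x, y) = \<Gamma> y"
      and eq: "(\<integral>y. \<bar>v (x, y)\<bar> \<partial>Leb c d) = (\<integral>y. \<bar>V y\<bar> \<partial>Leb c d)" "(\<integral>y. (\<gamma> (x, y))\<^sup>2 \<partial>Leb c d) = (\<integral>y. (\<Gamma> y)\<^sup>2 \<partial>Leb c d)"
      by (elim conjE) (rule two_exact_representatives[of c d "\<lambda>y. v (x, y)" "\<lambda>y. \<gamma> (x, y)" "\<lambda>y. k (x, y)"])
    have "AE y in Leb c d. \<bar>\<Gamma> y\<bar> \<le> m" using AE elim(6) by eventually_elim simp
    then show ?case unfolding eq using elim by (intro slope_line_Linfty[OF * _ _ _ l]) auto
  qed
qed (use v \<gamma> k in \<open>auto simp: sq_integrable_def\<close>)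

lemma Poincare_plane:
  assumes \<gamma>: "sq_integrable (Rect a b c d) \<gamma>" and k: "sq_integrable (Rect a b c d) k"
    and w: "weak_dy a b c d \<gamma> k" and 0: "AE x in Leb a b. (\<integral>y. \<gamma> (x, y) \<partial>Leb c d) = 0" and l: "c < d"
  shows "(\<integral>x. (\<gamma> x)\<^sup>2 \<partial>Rect a b c d) \<le> (d - c)\<^sup>2 * (\<integral>x. (k x)\<^sup>2 \<partial>Rect a b c d)"
proof -
  have "AE x in Leb a b. (\<integral>y. (\<gamma> (x, y))\<^sup>2 \<partial>Leb c d) \<le> (d - c)\<^sup>2 * (\<integral>y. (k (x, y))\<^sup>2 \<partial>Leb c d) + 0 * (\<integral>y. (k (x, y))\<^sup>2 \<partial>Leb c d)"
    using sq_integrable_lines[OF \<gamma>] sq_integrable_lines[OF k] weak_dy_lines[OF \<gamma> k w l] 0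
  proof eventually_elim
    case (elim x)
    then obtain F where F: "primitive_on c d F (\<lambda>y. k (x, y))" "integrable (Leb c d) F" "integrable (Leb c d) (\<lambda>y. (F y)\<^sup>2)"
        and eq: "(\<integral>y. (\<gamma> (x, y))\<^sup>2 \<partial>Leb c d) = (\<integral>y. (F y)\<^sup>2 \<partial>Leb c d)" "(\<integral>y. \<gamma> (x, y) \<partial>Leb c d) = (\<integral>y. F y \<partial>Leb c d)"
      by (elim conjE) (rule exact_representative[of c d "\<lambda>y. \<gamma> (x, y)" "\<lambda>y. k (x, y)"])
    have "(\<integral>y. F y \<partial>Leb c d) = 0" using elim(4) eq(2) by simp
    then show ?case unfolding eq(1) using Poincare_line[OF F _ _ _ l] elim by simp
  qed
  from integrate_over_lines[OF _ _ _ this] \<gamma> k show ?thesis by (auto simp: sq_integrable_def)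
qed

lemma finite_measure_Cauchy_Schwarz:
  assumes "finite_measure M" "integrable M h" "integrable M (\<lambda>x. (h x)\<^sup>2)" "measure M (space M) > 0"
  shows "(\<integral>x. h x \<partial>M)\<^sup>2 \<le> measure M (space M) * (\<integral>x. (h x :: real)\<^sup>2 \<partial>M)"
proof -
  interpret finite_measure M by fact
  define \<mu> where "\<mu> = measure M (space M)"
  define A where "A = (\<integral>x. h x \<partial>M)"
  have \<mu>: "\<mu> > 0" using assms(4) by (simp add: \<mu>_def)
  have "0 \<le> (\<integral>x. (h x - A / \<mu>)\<^sup>2 \<partial>M)" by (rule Bochner_Integration.integral_nonneg) simp
  also have "\<dots> = (\<integral>x. ((h x)\<^sup>2 - 2 * (A / \<mu>) * h x) + (A / \<mu>)\<^sup>2 \<partial>M)"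
    by (rule Bochner_Integration.integral_cong) (auto simp: power2_eq_square algebra_simps)
  also have "\<dots> = ((\<integral>x. (h x)\<^sup>2 \<partial>M) - 2 * (A / \<mu>) * A) + \<mu> * (A / \<mu>)\<^sup>2"
    using assms(2,3) by (simp add: A_def \<mu>_def)
  also have "\<dots> = (\<integral>x. (h x)\<^sup>2 \<partial>M) - A\<^sup>2 / \<mu>"
  proof -
    have "\<mu> * (A / \<mu>)\<^sup>2 = A\<^sup>2 / \<mu>" "2 * (A / \<mu>) * A = 2 * (A\<^sup>2 / \<mu>)" using \<mu> by (auto simp: power2_eq_square)
    then show ?thesis by linarith
  qed
  finally have "A\<^sup>2 / \<mu> \<le> (\<integral>x. (h x)\<^sup>2 \<partial>M)" by simp
  then show ?thesis using \<mu> unfolding A_def[symmetric] \<mu>_def[symmetric] by (simp add: pos_divide_le_eq mult.commute)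
qed

section \<open>Weak derivatives of admissible displacements\<close>

lemma const_smooth: "(\<lambda>x::point. k) \<in> smooth_functions"
  using smooth_product[OF smooth1_const[of k] smooth1_const[of 1]] by simp

lemma const_periodic_test: "(\<lambda>x. 1) \<in> periodic_tests"
  by (simp add: periodic_tests_def const_smooth)

lemma partial_const: "partial e (\<lambda>x. k) = (\<lambda>x. 0)"
  by (simp add: partial_def)

lemma finite_measure_Omega: "finite_measure Omega_measure"
  unfolding Omega_measure_product by (rule finite_measure_Leb2)

lemma measure_Omega: "measure Omega_measure Omega = 2 * pi"
proof -
  have "emeasure Omega_measure Omega = emeasure (Leb 0 (2*pi)) {0..2*pi} * emeasure (Leb (-1/2) (1/2)) {-1/2..1/2}"
    unfolding Omega_measure_product Omega_def
    by (rule Leb.emeasure_pair_measure_Times) (auto simp: sets_Leb_iff)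
  also have "\<dots> = ennreal (2 * pi)" by (simp add: emeasure_Leb)
  finally show ?thesis by (simp add: measure_def)
qed

lemma Omega_Cauchy_Schwarz:
  "sq_integrable Omega_measure h \<Longrightarrow> (\<integral>x. h x \<partial>Omega_measure)\<^sup>2 \<le> 2 * pi * (\<integral>x. (h x)\<^sup>2 \<partial>Omega_measure)"
  using finite_measure_Cauchy_Schwarz[OF finite_measure_Omega, of h]
  by (simp add: sq_integrable_def space_Omega_measure measure_Omega)

lemma L2_sq_integrable: "L2 f \<Longrightarrow> sq_integrable Omega_measure f"
  unfolding L2_def sq_integrable_def
  using finite_measure.square_integrable_imp_integrable[OF finite_measure_Omega] by blast

lemma weak_partialD:
  "weak_partial T e f g \<Longrightarrow> \<psi> \<in> T \<Longrightarrow>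
    (\<integral>x. f x * partial e \<psi> x \<partial>Omega_measure) = - (\<integral>x. g x * \<psi> x \<partial>Omega_measure)"
  by (simp add: weak_partial_def)

lemma weak_partial_integral_zero:
  "weak_partial periodic_tests e f g \<Longrightarrow> (\<integral>x. g x \<partial>Omega_measure) = 0"
  using weak_partialD[OF _ const_periodic_test, of e f g] by (simp add: partial_const)

lemma weak_partial_mean_zero:
  assumes dir: "e = e_theta \<and> e' = e_z \<and> p = 2 * pi \<and> c = 0 \<or> e = e_z \<and> e' = e_theta \<and> p = 1 \<and> c = -1/2"
    and b: "b \<in> bumps c (c + p)" and fg: "weak_partial periodic_tests e' f g"
  shows "(\<integral>x. g x * b (x \<bullet> e) \<partial>Omega_measure) = 0"
proof -
  obtain \<Psi> where \<Psi>: "\<Psi> \<in> periodic_tests" "\<And>x. x \<in> Omega \<Longrightarrow> \<Psi> x = b (x \<bullet> e)" "partial e' \<Psi> = (\<lambda>x. 0)"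
    using periodic_bump[OF dir b] by blast
  have "(\<integral>x. g x * b (x \<bullet> e) \<partial>Omega_measure) = (\<integral>x. g x * \<Psi> x \<partial>Omega_measure)"
    by (rule Bochner_Integration.integral_cong) (auto simp: space_Omega_measure \<Psi>(2))
  also have "\<dots> = 0" using weak_partialD[OF fg \<Psi>(1)] by (simp add: \<Psi>(3))
  finally show ?thesis .
qed

lemma integrable_Omega_continuous:
  fixes k :: "point \<Rightarrow> real"
  assumes k: "continuous_on UNIV k" and h: "integrable Omega_measure h"
  shows "integrable Omega_measure (\<lambda>x. h x * k x)"
proof -
  have "compact Omega" unfolding Omega_def by (intro compact_Times) auto
  then have "bounded (k ` Omega)"
    by (intro compact_imp_bounded compact_continuous_image continuous_on_subset[OF k]) auto
  then obtain B where "\<And>x. x \<in> Omega \<Longrightarrow> \<bar>k x\<bar> \<le> B" by (auto simp: bounded_real)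
  then show ?thesis by (intro integrable_mult_bounded[OF h continuous_measurable_Omega[OF k], of B]) (simp add: space_Omega_measure)
qed

lemma integrable_Omega_const: "integrable Omega_measure (\<lambda>x. k :: real)"
  by (rule finite_measure.integrable_const[OF finite_measure_Omega])

lemma continuous_integrable_Omega: "continuous_on UNIV k \<Longrightarrow> integrable Omega_measure k"
  for k :: "point \<Rightarrow> real"
  using integrable_Omega_continuous[OF _ integrable_Omega_const[of 1], of k] by simp

lemma continuous_sq_integrable_Omega: "continuous_on UNIV k \<Longrightarrow> sq_integrable Omega_measure k"
  for k :: "point \<Rightarrow> real"
  unfolding sq_integrable_def by (intro conjI continuous_integrable_Omega continuous_on_power)

lemma swap_Omega:
  fixes f :: "point \<Rightarrow> real"
  shows "integrable Omega_measure f \<Longrightarrow> integrable (Rect (-1/2) (1/2) 0 (2*pi)) (\<lambda>x. f (prod.swap x))"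
    and "integrable Omega_measure f \<Longrightarrow>
      (\<integral>x. f (prod.swap x) \<partial>(Rect (-1/2) (1/2) 0 (2*pi))) = (\<integral>x. f x \<partial>Omega_measure)"
  using Leb2.integrable_product_swap[of 0 "2*pi" "-1/2" "1/2" f] Leb2.integral_product_swap[of f 0 "2*pi" "-1/2" "1/2"]
  by (simp_all add: Omega_measure_product case_prod_beta' prod.swap_def borel_measurable_integrable)

lemma weak_dy_z:
  assumes "weak_partial interior_tests e_z f g"
  shows "weak_dy 0 (2*pi) (-1/2) (1/2) f g"
  unfolding weak_dy_def
proof (intro ballI)
  fix \<alpha> \<beta> assume ab: "\<alpha> \<in> bumps 0 (2*pi)" "\<beta> \<in> bumps (-1/2) (1/2)"
  show "(\<integral>x. f x * (\<alpha> (fst x) * deriv \<beta> (snd x)) \<partial>(Rect 0 (2*pi) (-1/2) (1/2)))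
      = - (\<integral>x. g x * (\<alpha> (fst x) * \<beta> (snd x)) \<partial>(Rect 0 (2*pi) (-1/2) (1/2)))"
    using weak_partialD[OF assms product_interior_tests[OF ab]]
    unfolding partial_product(2)[OF ab[THEN bumpsD]] Omega_measure_product .
qed

lemma weak_dy_theta:
  assumes "weak_partial interior_tests e_theta f g"
  shows "weak_dy (-1/2) (1/2) 0 (2*pi) (\<lambda>x. f (prod.swap x)) (\<lambda>x. g (prod.swap x))"
  unfolding weak_dy_def
proof (intro ballI)
  fix \<alpha> \<beta> assume ab: "\<alpha> \<in> bumps (-1/2) (1/2)" "\<beta> \<in> bumps 0 (2*pi)"
  let ?Q = "Rect (-1/2) (1/2) 0 (2*pi)"
  let ?\<psi> = "\<lambda>x. \<beta> (fst x) * \<alpha> (snd x)"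
  have \<psi>: "?\<psi> \<in> interior_tests" by (rule product_interior_tests[OF ab(2,1)])
  have p: "partial e_theta ?\<psi> = (\<lambda>x. deriv \<beta> (fst x) * \<alpha> (snd x))" by (rule partial_product(1)[OF ab(2,1)[THEN bumpsD]])
  have eq: "(\<integral>x. f x * (deriv \<beta> (fst x) * \<alpha> (snd x)) \<partial>Omega_measure) = - (\<integral>x. g x * ?\<psi> x \<partial>Omega_measure)"
    using weak_partialD[OF assms \<psi>] unfolding p .
  have m: "integrable Omega_measure (\<lambda>x. h x * (u (fst x) * v (snd x)))"
    if "integrable Omega_measure h" "smooth1 u" "smooth1 v" for h u v
    using that by (intro integrable_Omega_continuous smooth_functionsD(1)[OF smooth_product])
  have fg: "integrable Omega_measure f" "integrable Omega_measure g" using assms by (auto simp: weak_partial_def)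
  note s = bumpsD[OF ab(2)] bumpsD[OF ab(1)]
  show "(\<integral>x. f (prod.swap x) * (\<alpha> (fst x) * deriv \<beta> (snd x)) \<partial>?Q) = - (\<integral>x. g (prod.swap x) * (\<alpha> (fst x) * \<beta> (snd x)) \<partial>?Q)"
    using swap_Omega(2)[OF m[OF fg(1) smooth1_deriv[OF s(1)] s(2)]] swap_Omega(2)[OF m[OF fg(2) s]] eq
    by (simp add: mult.commute[of "\<alpha> _"])
qed

lemma sq_integrable_swap:
  "sq_integrable Omega_measure f \<Longrightarrow> sq_integrable (Rect (-1/2) (1/2) 0 (2*pi)) (\<lambda>x. f (prod.swap x))"
  unfolding sq_integrable_def using swap_Omega(1)[of f] swap_Omega(1)[of "\<lambda>x. (f x)\<^sup>2"] by blast

lemma smooth_DERIV_z: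
  assumes "\<psi> \<in> smooth_functions"
  shows "((\<lambda>z. \<psi> (\<theta>, z)) has_real_derivative partial e_z \<psi> (\<theta>, z)) (at z)"
  using smooth_partial_DERIV[OF assms, of e_z "(\<theta>, z)"] DERIV_shift[of "\<lambda>z. \<psi> (\<theta>, z)" _ 0 z]
  by (simp add: Basis_point e_z_def add.commute)

lemma smooth_DERIV_theta:
  assumes "\<psi> \<in> smooth_functions"
  shows "((\<lambda>\<theta>. \<psi> (\<theta>, z)) has_real_derivative partial e_theta \<psi> (\<theta>, z)) (at \<theta>)"
  using smooth_partial_DERIV[OF assms, of e_theta "(\<theta>, z)"] DERIV_shift[of "\<lambda>\<theta>. \<psi> (\<theta>, z)" _ 0 \<theta>]
  by (simp add: Basis_point e_theta_def add.commute)

text \<open>Integration by parts on each line; the condition on the test functions makes the boundary terms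
  cancel.\<close>

lemma weak_partial_z_C1:
  assumes f: "\<And>z. (f has_real_derivative f' z) (at z)" and f': "continuous_on UNIV f'"
    and T: "T \<subseteq> smooth_functions"
    and bd: "\<And>\<psi> \<theta>. \<psi> \<in> T \<Longrightarrow> f (1/2) * \<psi> (\<theta>, 1/2) = f (-1/2) * \<psi> (\<theta>, -1/2)"
  shows "weak_partial T e_z (\<lambda>x. f (snd x)) (\<lambda>x. f' (snd x))"
proof -
  have fc: "continuous_on UNIV f" using f by (meson DERIV_isCont continuous_at_imp_continuous_on)
  have c: "continuous_on UNIV (\<lambda>x::point. f (snd x))" "continuous_on UNIV (\<lambda>x::point. f' (snd x))"
    by (intro continuous_on_compose2[OF fc] continuous_on_compose2[OF f'] continuous_intros; simp)+
  note i = c[THEN continuous_integrable_Omega]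
  show ?thesis unfolding weak_partial_def
  proof (intro conjI ballI i)
    fix \<psi> assume \<psi>: "\<psi> \<in> T"
    then have s: "\<psi> \<in> smooth_functions" using T by blast
    have \<psi>c: "continuous_on UNIV \<psi>" "continuous_on UNIV (partial e_z \<psi>)"
      using smooth_functionsD[OF s] smooth_functionsD(1) by (auto simp: Basis_point)
    define H where "H = (\<lambda>x. f (snd x) * partial e_z \<psi> x + f' (snd x) * \<psi> x)"
    have Hc: "continuous_on UNIV H" unfolding H_def by (intro continuous_intros c \<psi>c)
    have Hi: "integrable (Rect 0 (2*pi) (-1/2) (1/2)) H"
      using continuous_integrable_Omega[OF Hc] by (simp add: Omega_measure_product)
    have "(\<integral>z. H (\<theta>, z) \<partial>Leb (-1/2) (1/2)) = 0" for \<theta>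
    proof -
      have D: "((\<lambda>z. f z * \<psi> (\<theta>, z)) has_real_derivative H (\<theta>, z)) (at z)" for z
        unfolding H_def using DERIV_mult[OF f smooth_DERIV_z[OF s]] by (simp add: algebra_simps)
      have "continuous_on UNIV (\<lambda>z. H (\<theta>, z))"
        by (rule continuous_on_compose2[OF Hc]) (auto intro!: continuous_intros)
      from integral_Leb_DERIV[OF order_refl _ order_refl D this, of "-1/2" "1/2"] bd[OF \<psi>, of \<theta>]
      show ?thesis by (simp add: int_on_whole)
    qed
    then have "(\<integral>x. H x \<partial>Omega_measure) = 0"
      using Leb2.integral_fst'[OF Hi] by (simp add: Omega_measure_product)
    moreover have "(\<integral>x. H x \<partial>Omega_measure) = (\<integral>x. f (snd x) * partial e_z \<psi> x \<partial>Omega_measure) + (\<integral>x. f' (snd x) * \<psi> x \<partial>Omega_measure)"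
      unfolding H_def by (intro Bochner_Integration.integral_add integrable_Omega_continuous \<psi>c i)
    ultimately show "(\<integral>x. f (snd x) * partial e_z \<psi> x \<partial>Omega_measure) = - (\<integral>x. f' (snd x) * \<psi> x \<partial>Omega_measure)" by simp
  qed
qed

lemma weak_partial_theta_zero:
  assumes f: "continuous_on UNIV f" and T: "T \<subseteq> smooth_functions"
    and bd: "\<And>\<psi> z. \<psi> \<in> T \<Longrightarrow> \<psi> (2*pi, z) = \<psi> (0, z)"
  shows "weak_partial T e_theta (\<lambda>x. f (snd x)) (\<lambda>x. 0)"
proof -
  have c: "continuous_on UNIV (\<lambda>x::point. f (snd x))"
    by (intro continuous_on_compose2[OF f] continuous_intros; simp)+
  note i = c[THEN continuous_integrable_Omega]
  show ?thesis unfolding weak_partial_def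
  proof (intro conjI ballI i)
    fix \<psi> assume \<psi>: "\<psi> \<in> T"
    then have s: "\<psi> \<in> smooth_functions" using T by blast
    have \<psi>c: "continuous_on UNIV (partial e_theta \<psi>)"
      using smooth_functionsD[OF s] smooth_functionsD(1) by (auto simp: Basis_point)
    define H where "H = (\<lambda>x. f (snd x) * partial e_theta \<psi> x)"
    have Hc: "continuous_on UNIV H" unfolding H_def by (intro continuous_intros c \<psi>c)
    have Hi: "integrable (Rect 0 (2*pi) (-1/2) (1/2)) (\<lambda>(\<theta>, z). H (\<theta>, z))"
      using continuous_integrable_Omega[OF Hc] by (simp add: Omega_measure_product)
    have 0: "(\<integral>\<theta>. H (\<theta>, z) \<partial>Leb 0 (2*pi)) = 0" for z
    proof -
      have D: "((\<lambda>\<theta>. f z * \<psi> (\<theta>, z)) has_real_derivative H (\<theta>, z)) (at \<theta>)" for \<theta>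
        unfolding H_def using DERIV_cmult[OF smooth_DERIV_theta[OF s]] by simp
      have "continuous_on UNIV (\<lambda>\<theta>. H (\<theta>, z))"
        by (rule continuous_on_compose2[OF Hc]) (auto intro!: continuous_intros)
      from integral_Leb_DERIV[OF order_refl _ order_refl D this, of 0 "2*pi"] bd[OF \<psi>, of z]
      show ?thesis by (simp add: int_on_whole)
    qed
    have "(\<integral>x. H x \<partial>Omega_measure) = (\<integral>\<theta>. (\<integral>z. H (\<theta>, z) \<partial>Leb (-1/2) (1/2)) \<partial>Leb 0 (2*pi))"
      using Leb2.integral_fst'[OF Hi] by (simp add: Omega_measure_product)
    also have "\<dots> = 0" unfolding Leb2.Fubini_integral[OF Hi, symmetric] by (simp add: 0)
    finally show "(\<integral>x. f (snd x) * partial e_theta \<psi> x \<partial>Omega_measure) = - (\<integral>x. 0 * \<psi> x \<partial>Omega_measure)"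
      by (simp add: H_def)
  qed simp
qed

lemma interior_tests_smooth: "interior_tests \<subseteq> smooth_functions"
  by (auto simp: interior_tests_def)

lemma periodic_tests_smooth: "periodic_tests \<subseteq> smooth_functions"
  by (auto simp: periodic_tests_def)

lemma interior_tests_zero: "\<psi> \<in> interior_tests \<Longrightarrow> x \<notin> interior Omega \<Longrightarrow> \<psi> x = 0"
  using closure_subset[of "{x. \<psi> x \<noteq> 0}"] unfolding interior_tests_def by blast

lemma weak_partial_z_interior:
  assumes "\<And>z. (f has_real_derivative f' z) (at z)" "continuous_on UNIV f'"
  shows "weak_partial interior_tests e_z (\<lambda>x. f (snd x)) (\<lambda>x. f' (snd x))"
  using assms interior_tests_smooth
  by (rule weak_partial_z_C1) (simp add: interior_tests_zero interior_Omega)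

lemma weak_partial_z_periodic:
  assumes "\<And>z. (f has_real_derivative f' z) (at z)" "continuous_on UNIV f'" "f (1/2) = f (-1/2)"
  shows "weak_partial periodic_tests e_z (\<lambda>x. f (snd x)) (\<lambda>x. f' (snd x))"
  using assms(1,2) periodic_tests_smooth
proof (rule weak_partial_z_C1)
  fix \<psi> \<theta> assume "\<psi> \<in> periodic_tests"
  then have "\<psi> (\<theta>, -1/2 + 1) = \<psi> (\<theta>, -1/2)" unfolding periodic_tests_def by blast
  then show "f (1/2) * \<psi> (\<theta>, 1/2) = f (-1/2) * \<psi> (\<theta>, -1/2)" using assms(3) by simp
qed

lemma weak_partial_theta_interior:
  "continuous_on UNIV f \<Longrightarrow> weak_partial interior_tests e_theta (\<lambda>x. f (snd x)) (\<lambda>x. 0)"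
  using interior_tests_smooth
  by (intro weak_partial_theta_zero) (auto simp add: interior_tests_zero interior_Omega)

lemma weak_partial_theta_periodic:
  "continuous_on UNIV f \<Longrightarrow> weak_partial periodic_tests e_theta (\<lambda>x. f (snd x)) (\<lambda>x. 0)"
proof (intro weak_partial_theta_zero periodic_tests_smooth)
  fix \<psi> z assume "\<psi> \<in> periodic_tests"
  then have "\<psi> (0 + 2 * pi, z) = \<psi> (0, z)" unfolding periodic_tests_def by blast
  then show "\<psi> (2 * pi, z) = \<psi> (0, z)" by simp
qed

lemma weak_partial_linear:
  "weak_partial interior_tests e_z (\<lambda>x. lam * snd x) (\<lambda>x. lam)"
  by (rule weak_partial_z_interior[of "\<lambda>z. lam * z" "\<lambda>z. lam"]) (auto intro!: derivative_eq_intros)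

lemma weak_partial_diff:
  assumes "weak_partial interior_tests e f g" "weak_partial interior_tests e f' g'" "e \<in> Basis"
  shows "weak_partial interior_tests e (\<lambda>x. f x - f' x) (\<lambda>x. g x - g' x)"
  unfolding weak_partial_def
proof (intro conjI ballI)
  have i: "integrable Omega_measure f" "integrable Omega_measure g" "integrable Omega_measure f'" "integrable Omega_measure g'"
    using assms by (auto simp: weak_partial_def)
  then show "integrable Omega_measure (\<lambda>x. f x - f' x)" "integrable Omega_measure (\<lambda>x. g x - g' x)" by auto
  fix \<psi> assume \<psi>: "\<psi> \<in> interior_tests"
  then have s: "\<psi> \<in> smooth_functions" by (simp add: interior_tests_def)
  note c = smooth_functionsD(1)[OF s] smooth_functionsD(1)[OF smooth_functionsD(3)[OF s assms(3)]]
  have "(\<integral>x. (f x - f' x) * partial e \<psi> x \<partial>Omega_measure) = (\<integral>x. f x * partial e \<psi> x \<partial>Omega_measure) - (\<integral>x. f' x * partial e \<psi> x \<partial>Omega_measure)"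
    unfolding left_diff_distrib by (intro Bochner_Integration.integral_diff integrable_Omega_continuous i c)
  also have "\<dots> = - ((\<integral>x. g x * \<psi> x \<partial>Omega_measure) - (\<integral>x. g' x * \<psi> x \<partial>Omega_measure))"
    using assms \<psi> by (simp add: weak_partial_def)
  also have "\<dots> = - (\<integral>x. (g x - g' x) * \<psi> x \<partial>Omega_measure)"
    unfolding left_diff_distrib by (intro arg_cong[of _ _ uminus] Bochner_Integration.integral_diff[symmetric] integrable_Omega_continuous i c)
  finally show "(\<integral>x. (f x - f' x) * partial e \<psi> x \<partial>Omega_measure) = - (\<integral>x. (g x - g' x) * \<psi> x \<partial>Omega_measure)" .
qed

section \<open>Lower bounds for a given energy\<close>

lemma integrable_of_nn_integral_bound:
  assumes "u \<in> borel_measurable M" "\<And>x. 0 \<le> u x" "(\<integral>\<^sup>+x. ennreal (u x) \<partial>M) \<le> ennreal e" "0 \<le> e"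
  shows "integrable M u" "(\<integral>x. u x \<partial>M) \<le> e"
proof -
  show i: "integrable M u"
    using assms by (intro integrableI_bounded) (auto intro: le_less_trans[OF _ ennreal_less_top])
  show "(\<integral>x. u x \<partial>M) \<le> e"
    using assms(3) nn_integral_eq_integral[OF i] assms(2,4) by (simp add: ennreal_le_iff)
qed

text \<open>What remains of an admissible displacement of energy at most \<open>e\<close>: the radial component \<open>w\<close>, its
  first derivatives \<open>gt\<close> and \<open>gz\<close>, the second derivative \<open>k\<close> in the axial direction, and the derivatives \<open>p\<close>
  and \<open>q\<close> of the hoop component \<open>u\<close> and of the axial component \<open>v\<close> after the linear part \<open>- lam z\<close> has been
  removed.\<close>

locale bounded_energy =
  fixes w gt gz k p q u v :: "point \<Rightarrow> real" and lam h e :: real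
  assumes w: "sq_integrable Omega_measure w" "AE x in Omega_measure. 0 \<le> w x"
    and gt: "sq_integrable Omega_measure gt" "weak_partial periodic_tests e_theta w gt"
    and gz: "sq_integrable Omega_measure gz" "weak_partial periodic_tests e_z w gz"
    and k: "sq_integrable Omega_measure k" "weak_partial periodic_tests e_z gz k"
    and p: "weak_partial periodic_tests e_theta u p"
    and q: "weak_partial periodic_tests e_z v q"
    and eps_tt: "integrable Omega_measure (\<lambda>x. (p x + 1/2 * (gt x)\<^sup>2 + w x)\<^sup>2)"
      "(\<integral>x. (p x + 1/2 * (gt x)\<^sup>2 + w x)\<^sup>2 \<partial>Omega_measure) \<le> e"
    and eps_zz: "integrable Omega_measure (\<lambda>x. (q x - lam + 1/2 * (gz x)\<^sup>2)\<^sup>2)"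
      "(\<integral>x. (q x - lam + 1/2 * (gz x)\<^sup>2)\<^sup>2 \<partial>Omega_measure) \<le> e"
    and bend: "h\<^sup>2 * (\<integral>x. (k x)\<^sup>2 \<partial>Omega_measure) \<le> e"
    and pos: "0 < e" "0 < h" "0 < lam"
begin

lemma integrability: "integrable Omega_measure w" "integrable Omega_measure (\<lambda>x. (w x)\<^sup>2)"
  "integrable Omega_measure (\<lambda>x. (gt x)\<^sup>2)" "integrable Omega_measure (\<lambda>x. (gz x)\<^sup>2)"
  "integrable Omega_measure (\<lambda>x. (k x)\<^sup>2)" "integrable Omega_measure p" "integrable Omega_measure q"
  using w gt gz k p q by (auto simp: sq_integrable_def weak_partial_def)

text \<open>The Cauchy-Schwarz inequality on a set of measure \<open>2 pi \<le> 9\<close>.\<close>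

lemma abs_integral_le:
  assumes "sq_integrable Omega_measure f" "(\<integral>x. (f x)\<^sup>2 \<partial>Omega_measure) \<le> e"
  shows "\<bar>\<integral>x. f x \<partial>Omega_measure\<bar> \<le> 3 * sqrt e"
proof -
  have "(\<integral>x. f x \<partial>Omega_measure)\<^sup>2 \<le> 2 * pi * (\<integral>x. (f x)\<^sup>2 \<partial>Omega_measure)" by (rule Omega_Cauchy_Schwarz[OF assms(1)])
  also have "\<dots> \<le> 9 * e" using assms(2) pi_less_4 by (intro mult_mono) auto
  also have "\<dots> = (3 * sqrt e)\<^sup>2" using pos by (simp add: power_mult_distrib)
  finally have "\<bar>\<integral>x. f x \<partial>Omega_measure\<bar> \<le> \<bar>3 * sqrt e\<bar>" by (simp only: abs_le_square_iff)
  then show ?thesis using pos by simp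
qed

text \<open>The tangential derivative \<open>p\<close> integrates to zero and the two other contributions to the hoop strain are
  nonnegative because of the obstacle; hence the strain controls both of them, without any cancellation.\<close>

lemma hoop_integrals:
  "(\<integral>x. w x \<partial>Omega_measure) \<le> 3 * sqrt e" "(\<integral>x. (gt x)\<^sup>2 \<partial>Omega_measure) \<le> 6 * sqrt e"
proof -
  have "(\<integral>x. p x + 1/2 * (gt x)\<^sup>2 + w x \<partial>Omega_measure) = (\<integral>x. p x \<partial>Omega_measure) + 1/2 * (\<integral>x. (gt x)\<^sup>2 \<partial>Omega_measure) + (\<integral>x. w x \<partial>Omega_measure)"
    using integrability by simp
  then have "1/2 * (\<integral>x. (gt x)\<^sup>2 \<partial>Omega_measure) + (\<integral>x. w x \<partial>Omega_measure) \<le> 3 * sqrt e"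
    using abs_integral_le[of "\<lambda>x. p x + 1/2 * (gt x)\<^sup>2 + w x"] eps_tt integrability weak_partial_integral_zero[OF p]
    by (simp add: sq_integrable_def)
  moreover have "0 \<le> (\<integral>x. (gt x)\<^sup>2 \<partial>Omega_measure)" by simp
  moreover have "0 \<le> (\<integral>x. w x \<partial>Omega_measure)" using w(2) by (rule integral_nonneg_AE)
  ultimately show "(\<integral>x. w x \<partial>Omega_measure) \<le> 3 * sqrt e" "(\<integral>x. (gt x)\<^sup>2 \<partial>Omega_measure) \<le> 6 * sqrt e" by linarith+
qed

text \<open>The total length has to be accommodated: \<open>q\<close> integrates to zero, so the axial strain can be small only
  if the slope \<open>gz\<close> makes up for the compression \<open>lam\<close>.\<close>

lemma axial_slope_lower:
  assumes "e \<le> lam\<^sup>2" shows "6 * lam \<le> (\<integral>x. (gz x)\<^sup>2 \<partial>Omega_measure)"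
proof -
  have c: "(\<integral>x. lam \<partial>Omega_measure) = 2 * pi * lam" using measure_Omega by (simp add: space_Omega_measure)
  have "(\<integral>x. q x - lam + 1/2 * (gz x)\<^sup>2 \<partial>Omega_measure) = (\<integral>x. q x \<partial>Omega_measure) - (\<integral>x. lam \<partial>Omega_measure) + 1/2 * (\<integral>x. (gz x)\<^sup>2 \<partial>Omega_measure)"
    using integrability integrable_Omega_const[of lam] by simp
  moreover have "\<bar>\<integral>x. q x - lam + 1/2 * (gz x)\<^sup>2 \<partial>Omega_measure\<bar> \<le> 3 * sqrt e"
    using eps_zz integrability integrable_Omega_const[of lam] by (intro abs_integral_le) (auto simp: sq_integrable_def)
  moreover have "sqrt e \<le> lam" using assms pos by (simp add: real_le_lsqrt)
  moreover have "6 * lam \<le> 2 * pi * lam" using pos pi_gt3 by simp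
  ultimately show ?thesis using weak_partial_integral_zero[OF q] c by linarith
qed

text \<open>The argument of \<open>hoop_integrals\<close> on single circles. Since \<open>p\<close> has mean zero on almost every circle, the
  line integrals of \<open>w\<close> are bounded in \<open>L\<^sup>2\<close> with respect to \<open>z\<close> and not just in \<open>L\<^sup>1\<close>.\<close>

lemma hoop_lines:
  "AE z in Leb (-1/2) (1/2). (\<integral>\<theta>. \<bar>w (prod.swap (z, \<theta>))\<bar> \<partial>Leb 0 (2*pi))\<^sup>2
     \<le> (\<integral>\<theta>. 2 * pi * (\<lambda>x. (p x + 1/2 * (gt x)\<^sup>2 + w x)\<^sup>2) (prod.swap (z, \<theta>)) \<partial>Leb 0 (2*pi))"
proof -
  let ?Q = "Rect (-1/2) (1/2) 0 (2*pi)"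
  let ?e = "\<lambda>x. p x + 1/2 * (gt x)\<^sup>2 + w x"
  have pm: "AE z in Leb (-1/2) (1/2). (\<integral>\<theta>. p (prod.swap (z, \<theta>)) \<partial>Leb 0 (2*pi)) = 0"
  proof (rule mean_zero_on_lines[OF swap_Omega(1)[OF integrability(6)]])
    fix \<alpha> assume a: "\<alpha> \<in> bumps (-1/2) (1/2)"
    have "continuous_on UNIV (\<lambda>x::point. \<alpha> (snd x))"
      using continuous_on_compose2[OF smooth1_continuous[OF bumpsD[OF a], of UNIV], of UNIV snd] by (simp add: continuous_on_snd)
    from swap_Omega(2)[OF integrable_Omega_continuous[OF this integrability(6)]] weak_partial_mean_zero[of e_z e_theta 1 "-1/2" \<alpha>, OF _ _ p] a
    show "(\<integral>x. p (prod.swap x) * \<alpha> (fst x) \<partial>?Q) = 0" by simp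
  qed
  have wp: "AE x in ?Q. 0 \<le> w (prod.swap x)"
  proof -
    have "(\<integral>x. \<bar>w (prod.swap x)\<bar> - w (prod.swap x) \<partial>?Q) = (\<integral>x. \<bar>w x\<bar> - w x \<partial>Omega_measure)"
      using swap_Omega(2)[of "\<lambda>x. \<bar>w x\<bar> - w x"] integrability(1) by simp
    also have "\<dots> = (\<integral>x. 0 \<partial>Omega_measure)"
      using w(2) integrability(1) by (intro integral_cong_AE) (auto elim!: eventually_mono)
    finally have "AE x in ?Q. \<bar>w (prod.swap x)\<bar> - w (prod.swap x) = 0"
      using swap_Omega(1)[OF integrability(1)] by (subst integral_nonneg_eq_0_iff_AE[symmetric]) auto
    then show ?thesis by eventually_elim linarith
  qed
  have ei: "integrable Omega_measure ?e" using integrability by simp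
  show ?thesis
    using pm Leb2.AE_pair[OF wp] Leb2.AE_integrable_fst'[OF swap_Omega(1)[OF integrability(1)]]
      Leb2.AE_integrable_fst'[OF swap_Omega(1)[OF integrability(3)]] Leb2.AE_integrable_fst'[OF swap_Omega(1)[OF integrability(6)]]
      Leb2.AE_integrable_fst'[OF swap_Omega(1)[OF eps_tt(1)]]
  proof eventually_elim
    case (elim z)
    let ?Y = "Leb 0 (2*pi)" and ?s = "\<lambda>f \<theta>. f (prod.swap (z, \<theta>)) :: real"
    have wabs: "(\<integral>\<theta>. \<bar>?s w \<theta>\<bar> \<partial>?Y) = (\<integral>\<theta>. ?s w \<theta> \<partial>?Y)"
      using elim(2,3) by (intro integral_cong_AE) (auto elim!: eventually_mono)
    have "0 \<le> (\<integral>\<theta>. (?s gt \<theta>)\<^sup>2 \<partial>?Y)" by simp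
    moreover have "(\<integral>\<theta>. ?s ?e \<theta> \<partial>?Y) = (\<integral>\<theta>. ?s p \<theta> \<partial>?Y) + 1/2 * (\<integral>\<theta>. (?s gt \<theta>)\<^sup>2 \<partial>?Y) + (\<integral>\<theta>. ?s w \<theta> \<partial>?Y)"
      using elim(3-5) by simp
    ultimately have "(\<integral>\<theta>. \<bar>?s w \<theta>\<bar> \<partial>?Y) \<le> (\<integral>\<theta>. ?s ?e \<theta> \<partial>?Y)"
      using elim(1) unfolding wabs by linarith
    then have "(\<integral>\<theta>. \<bar>?s w \<theta>\<bar> \<partial>?Y)\<^sup>2 \<le> (\<integral>\<theta>. ?s ?e \<theta> \<partial>?Y)\<^sup>2" by (intro power_mono) auto
    also have "\<dots> \<le> measure ?Y (space ?Y) * (\<integral>\<theta>. (?s ?e \<theta>)\<^sup>2 \<partial>?Y)"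
    proof (rule finite_measure_Cauchy_Schwarz[OF finite_measure_Leb])
      show "integrable ?Y (?s ?e)" using elim(3-5) by simp
      show "integrable ?Y (\<lambda>\<theta>. (?s ?e \<theta>)\<^sup>2)" using elim(6) by simp
      show "0 < measure ?Y (space ?Y)" by (simp add: measure_def emeasure_Leb)
    qed
    also have "measure ?Y (space ?Y) = 2 * pi" by (simp add: measure_def emeasure_Leb)
    finally show ?case by simp
  qed
qed

text \<open>Interpolation on circles that are cut into \<open>n\<close> arcs, with \<open>hoop_lines\<close> for the means over the arcs and
  \<open>hoop_integrals\<close> for the oscillation within them; the constant is \<open>2 (2 pi)\<^sup>2 6 \<le> 768\<close>.\<close>

lemma radial_L2_bound:
  assumes "n \<ge> 1"
  shows "(\<integral>x. (w x)\<^sup>2 \<partial>Omega_measure) \<le> 2 * real n * e + 768 * sqrt e / (real n)\<^sup>2"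
proof -
  let ?Q = "Rect (-1/2) (1/2) 0 (2*pi)"
  let ?e2 = "\<lambda>x. (p x + 1/2 * (gt x)\<^sup>2 + w x)\<^sup>2"
  define l where "l = (2 * pi - 0) / real n"
  have e2: "integrable Omega_measure (\<lambda>x. 2 * pi * ?e2 x)" using eps_tt(1) by simp
  have "(\<integral>x. (w (prod.swap x))\<^sup>2 \<partial>?Q) \<le> 2 / l * (\<integral>x. 2 * pi * ?e2 (prod.swap x) \<partial>?Q) + 2 * l\<^sup>2 * (\<integral>x. (gt (prod.swap x))\<^sup>2 \<partial>?Q)"
    using swap_Omega(1)[OF e2] hoop_lines assms
    by (intro interpolation_plane[OF sq_integrable_swap[OF w(1)] sq_integrable_swap[OF gt(1)]
          weak_dy_theta[OF weak_partial_periodic_interior[OF gt(2)]] _ _ l_def]) (auto simp: Basis_point)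
  then have "(\<integral>x. (w x)\<^sup>2 \<partial>Omega_measure) \<le> 2 / l * (\<integral>x. 2 * pi * ?e2 x \<partial>Omega_measure) + 2 * l\<^sup>2 * (\<integral>x. (gt x)\<^sup>2 \<partial>Omega_measure)"
    using swap_Omega(2)[OF integrability(2)] swap_Omega(2)[OF integrability(3)] swap_Omega(2)[OF e2] by simp
  also have "2 / l * (\<integral>x. 2 * pi * ?e2 x \<partial>Omega_measure) = 2 * real n * (\<integral>x. ?e2 x \<partial>Omega_measure)"
    using assms by (simp add: l_def)
  also have "\<dots> \<le> 2 * real n * e" using eps_tt(2) by (intro mult_left_mono) auto
  also have "2 * l\<^sup>2 * (\<integral>x. (gt x)\<^sup>2 \<partial>Omega_measure) \<le> (128 / (real n)\<^sup>2) * (6 * sqrt e)"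
  proof (intro mult_mono hoop_integrals(2))
    have "pi\<^sup>2 \<le> 4\<^sup>2" using pi_less_4 by (intro power_mono) auto
    then show "2 * l\<^sup>2 \<le> 128 / (real n)\<^sup>2" by (simp add: l_def power_divide power_mult_distrib divide_right_mono)
  qed auto
  finally show ?thesis by simp
qed

lemma axial_weak_derivatives: "weak_dy 0 (2*pi) (-1/2) (1/2) w gz" "weak_dy 0 (2*pi) (-1/2) (1/2) gz k"
  by (rule weak_dy_z[OF weak_partial_periodic_interior[OF gz(2)]], simp add: Basis_point)
     (rule weak_dy_z[OF weak_partial_periodic_interior[OF k(2)]], simp add: Basis_point)

text \<open>Periodicity makes the mean of \<open>gz\<close> vanish on almost every line. This excludes slopes that do not
  oscillate and removes the lower-order term from the interpolation inequalities.\<close>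

lemma axial_Poincare: "(\<integral>x. (gz x)\<^sup>2 \<partial>Omega_measure) \<le> (\<integral>x. (k x)\<^sup>2 \<partial>Omega_measure)"
proof -
  have gi: "integrable (Rect 0 (2*pi) (-1/2) (1/2)) gz" using gz by (simp add: sq_integrable_def Omega_measure_product)
  have "AE \<theta> in Leb 0 (2*pi). (\<integral>z. gz (\<theta>, z) \<partial>Leb (-1/2) (1/2)) = 0"
    by (rule mean_zero_on_lines[OF gi]) (use weak_partial_mean_zero[of e_theta e_z "2*pi" 0, OF _ _ gz(2)] in \<open>simp add: Omega_measure_product\<close>)
  from Poincare_plane[OF gz(1)[unfolded Omega_measure_product] k(1)[unfolded Omega_measure_product] axial_weak_derivatives(2) this]
  show ?thesis by (simp add: Omega_measure_product)
qed

lemma axial_slope_L2: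
  assumes "n \<ge> 1"
  shows "(\<integral>x. (gz x)\<^sup>2 \<partial>Omega_measure) \<le> 162 * (real n)\<^sup>2 * (\<integral>x. (w x)\<^sup>2 \<partial>Omega_measure) + 2 / (real n)\<^sup>2 * (\<integral>x. (k x)\<^sup>2 \<partial>Omega_measure)"
  using slope_plane_L2[OF w(1)[unfolded Omega_measure_product] gz(1)[unfolded Omega_measure_product]
      k(1)[unfolded Omega_measure_product] axial_weak_derivatives _ assms refl]
  by (simp add: Omega_measure_product power_divide)

lemma axial_slope_Linfty:
  assumes "n \<ge> 1" "AE x in Omega_measure. \<bar>gz x\<bar> \<le> m"
  shows "(\<integral>x. (gz x)\<^sup>2 \<partial>Omega_measure) \<le> 18 * m * real n * (\<integral>x. w x \<partial>Omega_measure) + 1 / (real n)\<^sup>2 * (\<integral>x. (k x)\<^sup>2 \<partial>Omega_measure)"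
proof -
  have "(\<integral>x. \<bar>w x\<bar> \<partial>Omega_measure) = (\<integral>x. w x \<partial>Omega_measure)"
    using w(2) integrability(1) by (intro integral_cong_AE) (auto elim!: eventually_mono)
  then show ?thesis
    using slope_plane_Linfty[OF w(1)[unfolded Omega_measure_product] gz(1)[unfolded Omega_measure_product]
      k(1)[unfolded Omega_measure_product] axial_weak_derivatives assms(2)[unfolded Omega_measure_product] _ assms(1) refl]
    by (simp add: Omega_measure_product power_divide)
qed

text \<open>The interval is divided into \<open>n\<close> blocks with \<open>n\<close> of the order of the typical wave number
  \<open>r = \<parallel>k\<parallel> / \<parallel>gz\<parallel>\<close>, just large enough for the curvature term in the slope estimates to be absorbed. A
  natural number of this order exists because \<open>r \<ge> 1\<close>, by \<open>axial_Poincare\<close>.\<close>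

lemma wavenumber:
  assumes "e \<le> lam\<^sup>2"
  obtains n r G where "G = (\<integral>x. (gz x)\<^sup>2 \<partial>Omega_measure)" "6 * lam \<le> G" "0 < G" "1 \<le> r"
    "r\<^sup>2 * G = (\<integral>x. (k x)\<^sup>2 \<partial>Omega_measure)" "n \<ge> 1" "2 * r \<le> real n" "real n \<le> 3 * r"
    "(\<integral>x. (k x)\<^sup>2 \<partial>Omega_measure) / (real n)\<^sup>2 \<le> G / 4" "h\<^sup>2 * (r\<^sup>2 * G) \<le> e"
proof -
  define G where "G = (\<integral>x. (gz x)\<^sup>2 \<partial>Omega_measure)"
  define B where "B = (\<integral>x. (k x)\<^sup>2 \<partial>Omega_measure)"
  have G: "6 * lam \<le> G" using axial_slope_lower[OF assms] by (simp add: G_def)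
  then have G0: "0 < G" using pos by linarith
  have GB: "G \<le> B" using axial_Poincare by (simp add: G_def B_def)
  define r where "r = sqrt (B / G)"
  have r1: "1 \<le> r" using GB G0 by (simp add: r_def)
  have r2: "r\<^sup>2 * G = B" using GB G0 by (simp add: r_def)
  define n where "n = nat \<lceil>2 * r\<rceil>"
  have n: "2 * r \<le> real n" "real n \<le> 3 * r" "n \<ge> 1" using r1 unfolding n_def by linarith+
  have "(2 * r)\<^sup>2 \<le> (real n)\<^sup>2" using n r1 by (intro power_mono) auto
  then have "B * 4 \<le> G * (real n)\<^sup>2" using G0 by (simp add: r2[symmetric] power_mult_distrib mult.commute mult_left_mono)
  then have "B / (real n)\<^sup>2 \<le> G / 4" using n(3) by (simp add: field_simps)
  then show ?thesis using that[of G r n] G G0 r1 r2 n bend by (simp add: G_def B_def)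
qed

text \<open>In terms of norms, \<open>\<parallel>gz\<parallel>\<^sup>3 \<lesssim> m \<parallel>w\<parallel>\<^sub>1 \<parallel>k\<parallel>\<close>, where \<open>\<parallel>gz\<parallel>\<^sup>2 \<gtrsim> lam\<close>,
  \<open>\<parallel>w\<parallel>\<^sub>1 \<lesssim> sqrt e\<close> and \<open>\<parallel>k\<parallel> \<le> sqrt e / h\<close>.\<close>

lemma lower_bound_Linfty:
  assumes "e \<le> lam\<^sup>2" "AE x in Omega_measure. \<bar>gz x\<bar> \<le> m" "0 \<le> m"
  shows "h * (lam * sqrt lam) \<le> 216 * m * e"
proof -
  obtain n r G where G: "G = (\<integral>x. (gz x)\<^sup>2 \<partial>Omega_measure)" "6 * lam \<le> G" "0 < G" "1 \<le> r"
    "r\<^sup>2 * G = (\<integral>x. (k x)\<^sup>2 \<partial>Omega_measure)" "n \<ge> 1" "2 * r \<le> real n" "real n \<le> 3 * r"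
    "(\<integral>x. (k x)\<^sup>2 \<partial>Omega_measure) / (real n)\<^sup>2 \<le> G / 4" "h\<^sup>2 * (r\<^sup>2 * G) \<le> e"
    by (rule wavenumber[OF assms(1)])
  have "18 * m * real n * (\<integral>x. w x \<partial>Omega_measure) \<le> 18 * m * (3 * r) * (3 * sqrt e)"
    using hoop_integrals(1) assms(3) G(4,8) integral_nonneg_AE[OF w(2)] by (intro mult_mono mult_left_mono) auto
  then have "G \<le> 216 * m * r * sqrt e"
  proof -
    have "1 / (real n)\<^sup>2 * (\<integral>x. (k x)\<^sup>2 \<partial>Omega_measure) \<le> G / 4" using G(9) by simp
    moreover have "18 * m * (3 * r) * (3 * sqrt e) = 162 * (m * r * sqrt e)" "216 * m * r * sqrt e = 216 * (m * r * sqrt e)" by auto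
    ultimately show ?thesis
      using axial_slope_Linfty[OF G(6) assms(2)] \<open>18 * m * real n * _ \<le> _\<close> unfolding G(1)[symmetric] by linarith
  qed
  have "h * r * sqrt G \<le> sqrt e"
    using G(10,4,3) pos by (intro real_le_rsqrt) (simp add: power_mult_distrib mult.assoc)
  have "h * (G * sqrt G) = G * (h * sqrt G)" by simp
  also have "\<dots> \<le> (216 * m * r * sqrt e) * (h * sqrt G)"
    using \<open>G \<le> _\<close> pos G(3) by (intro mult_right_mono) auto
  also have "\<dots> = 216 * m * sqrt e * (h * r * sqrt G)" by simp
  also have "\<dots> \<le> 216 * m * sqrt e * sqrt e"
    using \<open>h * r * sqrt G \<le> _\<close> pos assms(3) by (intro mult_left_mono) auto
  finally have "h * (G * sqrt G) \<le> 216 * m * e" using pos by (simp add: mult.assoc)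
  moreover have "lam * sqrt lam \<le> G * sqrt G" using G(2,3) pos by (intro mult_mono) auto
  ultimately show ?thesis using pos by (meson order_trans mult_left_mono less_imp_le)
qed

text \<open>In terms of norms, \<open>\<parallel>gz\<parallel>\<^sup>2 \<lesssim> \<parallel>w\<parallel> \<parallel>k\<parallel>\<close>. The norm of \<open>w\<close> is of the order \<open>e^(5/12)\<close>, which results from
  \<open>radial_L2_bound\<close> with about \<open>e^(-1/6)\<close> blocks, the number for which its two terms balance.\<close>

lemma lower_bound_L2:
  assumes "e \<le> lam\<^sup>2" "e \<le> 1"
  shows "(h * lam)\<^sup>2 \<le> 70000 * e powr (11/6)"
proof -
  obtain n r G where G: "G = (\<integral>x. (gz x)\<^sup>2 \<partial>Omega_measure)" "6 * lam \<le> G" "0 < G" "1 \<le> r"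
    "r\<^sup>2 * G = (\<integral>x. (k x)\<^sup>2 \<partial>Omega_measure)" "n \<ge> 1" "2 * r \<le> real n" "real n \<le> 3 * r"
    "(\<integral>x. (k x)\<^sup>2 \<partial>Omega_measure) / (real n)\<^sup>2 \<le> G / 4" "h\<^sup>2 * (r\<^sup>2 * G) \<le> e"
    by (rule wavenumber[OF assms(1)])
  define V where "V = (\<integral>x. (w x)\<^sup>2 \<partial>Omega_measure)"
  have V0: "0 \<le> V" by (simp add: V_def)
  have V: "V \<le> 772 * e powr (5/6)"
  proof -
    \<comment> \<open>The two terms \<open>n e\<close> and \<open>sqrt e / n\<^sup>2\<close> of \<open>radial_L2_bound\<close> balance at \<open>n = e^(-1/6)\<close>.\<close>
    define s where "s = e powr (-1/6)"
    have s1: "1 \<le> s" unfolding s_def using powr_le1[of "1/6" e] pos assms(2)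
      by (simp add: powr_minus one_le_inverse)
    define n where "n = nat \<lceil>s\<rceil>"
    have n: "s \<le> real n" "real n \<le> 2 * s" "n \<ge> 1" using s1 unfolding n_def by linarith+
    have "2 * real n * e \<le> 4 * (s * e)" using n(2) pos by simp
    moreover have "768 * sqrt e / (real n)\<^sup>2 \<le> 768 * sqrt e / s\<^sup>2"
      using n(1) s1 pos by (intro divide_left_mono power_mono mult_pos_pos) auto
    moreover have "s * e = e powr (5/6)"
      using pos powr_add[of e "-1/6" 1] by (simp add: s_def)
    moreover have "sqrt e / s\<^sup>2 = e powr (5/6)"
      using pos by (simp add: s_def powr_half_sqrt[symmetric] powr_powr powr_diff[symmetric] powr_realpow[symmetric])
    moreover have "768 * sqrt e / s\<^sup>2 = 768 * (sqrt e / s\<^sup>2)" by simp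
    ultimately show ?thesis using radial_L2_bound[OF n(3)] unfolding V_def by linarith
  qed
  have "162 * (real n)\<^sup>2 * V \<le> 162 * (9 * r\<^sup>2) * V"
  proof -
    have "(real n)\<^sup>2 \<le> (3 * r)\<^sup>2" using G(8) by (intro power_mono) auto
    then show ?thesis using V0 by (intro mult_right_mono) (auto simp: power_mult_distrib)
  qed
  then have g: "G \<le> 2916 * r\<^sup>2 * V"
  proof -
    have "2 / (real n)\<^sup>2 * (\<integral>x. (k x)\<^sup>2 \<partial>Omega_measure) = 2 * ((\<integral>x. (k x)\<^sup>2 \<partial>Omega_measure) / (real n)\<^sup>2)" by simp
    then have "2 / (real n)\<^sup>2 * (\<integral>x. (k x)\<^sup>2 \<partial>Omega_measure) \<le> G / 2" using G(9) by linarith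
    moreover have "162 * (9 * r\<^sup>2) * V = 1458 * (r\<^sup>2 * V)" "2916 * r\<^sup>2 * V = 2916 * (r\<^sup>2 * V)" by auto
    ultimately show ?thesis
      using axial_slope_L2[OF G(6)] \<open>162 * (real n)\<^sup>2 * V \<le> _\<close>
      unfolding G(1)[symmetric] V_def[symmetric] by linarith
  qed
  have "(h * lam)\<^sup>2 * 36 = h\<^sup>2 * (6 * lam)\<^sup>2" by (simp add: power_mult_distrib)
  also have "\<dots> \<le> h\<^sup>2 * (G * G)"
    using power_mono[OF G(2), of 2] pos by (intro mult_left_mono) (auto simp: power2_eq_square)
  also have "\<dots> \<le> h\<^sup>2 * (G * (2916 * r\<^sup>2 * V))" using g G(3) by (intro mult_left_mono) auto
  also have "\<dots> = 2916 * V * (h\<^sup>2 * (r\<^sup>2 * G))" by simp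
  also have "\<dots> \<le> 2916 * (772 * e powr (5/6)) * e" using V V0 G(3,10) pos by (intro mult_mono) auto
  also have "\<dots> = 2251152 * e powr (11/6)"
    using pos powr_add[of e "5/6" 1] by simp
  finally have "(h * lam)\<^sup>2 * 36 \<le> 2251152 * e powr (11/6)" .
  then show ?thesis using powr_ge_zero[of e "11/6"] by linarith
qed

end

section \<open>The minimum energy\<close>

text \<open>The weak derivatives on the torus, provided by membership in the Sobolev spaces, are identified with
  the representatives \<open>D\<close> that enter the energy; then every nonnegative part of the integrand is bounded by
  the energy.\<close>

lemma admissible_bounded_energy:
  assumes \<phi>: "\<phi> \<in> A_vKD lam 1 M" and E: "E_vKD h \<phi> \<le> ennreal e" and pos: "0 < e" "0 < h" "0 < lam"
  obtains w gt gz k p q u v where "bounded_energy w gt gz k p q u v lam h e" "AE x in Omega_measure. ereal \<bar>gz x\<bar> \<le> M"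
proof -
  define w where "w = comp_rho \<phi>"
  define u where "u = comp_theta \<phi>"
  define v where "v = (\<lambda>x. comp_z \<phi> x + lam * snd x)"
  have A: "H_per 2 w" "H_per 1 u" "H_per 1 v" "AE x in Omega_measure. 0 \<le> w x" "L_infty_norm (D e_z w) \<le> M"
    using \<phi> by (auto simp: A_vKD_def w_def u_def v_def)
  have B: "e_theta \<in> Basis" "e_z \<in> Basis" by (simp_all add: Basis_point)
  have neq: "e_theta \<noteq> e_z" by (simp add: e_theta_def e_z_def)
  have w: "L2 w" using A(1) by (simp add: numeral_2_eq_2)
  obtain gt where gt: "weak_partial periodic_tests e_theta w gt" "L2 gt"
    using A(1) B by (fastforce simp: numeral_2_eq_2)
  obtain gz where gz: "weak_partial periodic_tests e_z w gz" "H_per 1 gz"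
    using A(1) B by (fastforce simp: numeral_2_eq_2)
  have gz2: "L2 gz" using gz(2) by simp
  obtain k where k: "weak_partial periodic_tests e_z gz k" "L2 k" using gz(2) B by fastforce
  obtain p where p: "weak_partial periodic_tests e_theta u p" "L2 p" using A(2) B by fastforce
  obtain q where q: "weak_partial periodic_tests e_z v q" "L2 q" using A(3) B by fastforce
  note I = weak_partial_periodic_interior
  have Dw: "AE x in Omega_measure. D e_theta w x = gt x" "AE x in Omega_measure. D e_z w x = gz x"
    "AE x in Omega_measure. D e_theta u x = p x" "AE x in Omega_measure. D e_z (D e_z w) x = k x"
    by (rule D_weak_partial(2)[OF I[OF gt(1) B(1)]] D_weak_partial(2)[OF I[OF gz(1) B(2)]]
      D_weak_partial(2)[OF I[OF p(1) B(1)]] D_D_weak_partial[OF I[OF gz(1) B(2)] I[OF k(1) B(2)] B(2)])+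
  have "weak_partial interior_tests e_z (\<lambda>x. v x - lam * snd x) (\<lambda>x. q x - lam)"
    by (rule weak_partial_diff[OF I[OF q(1) B(2)] weak_partial_linear B(2)])
  moreover have "(\<lambda>x. v x - lam * snd x) = comp_z \<phi>" by (simp add: v_def)
  ultimately have Dz: "AE x in Omega_measure. D e_z (comp_z \<phi>) x = q x - lam" using D_weak_partial(2) by metis
  define E1 where "E1 = (\<lambda>x. p x + 1/2 * (gt x)\<^sup>2 + w x)"
  define E2 where "E2 = (\<lambda>x. q x - lam + 1/2 * (gz x)\<^sup>2)"
  let ?S = "\<lambda>x. strain_norm_sq \<phi> x + h\<^sup>2 * hessian_norm_sq (comp_rho \<phi>) x"
  have hess: "(D e_z (D e_z w) x)\<^sup>2 \<le> hessian_norm_sq w x" for x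
    using neq by (simp add: hessian_norm_sq_def Basis_point)
  have hess0: "0 \<le> h\<^sup>2 * hessian_norm_sq w x" for x
    using hess[of x] by (simp add: order_trans[OF zero_le_power2])
  have le: "AE x in Omega_measure. (E1 x)\<^sup>2 \<le> ?S x \<and> (E2 x)\<^sup>2 \<le> ?S x \<and> h\<^sup>2 * (k x)\<^sup>2 \<le> ?S x"
    using Dw Dz
  proof eventually_elim
    case (elim x)
    have "eps_theta_theta \<phi> x = E1 x" using elim(1,3) by (simp add: eps_theta_theta_def E1_def w_def u_def)
    moreover have "eps_z_z \<phi> x = E2 x" using elim(2,5) by (simp add: eps_z_z_def E2_def w_def)
    moreover have "h\<^sup>2 * (k x)\<^sup>2 \<le> h\<^sup>2 * hessian_norm_sq w x" using hess[of x] elim(4) by (intro mult_left_mono) auto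
    ultimately show ?case using hess0[of x] unfolding strain_norm_sq_def w_def[symmetric]
      by (auto intro: add_increasing2 add_increasing)
  qed
  have nn: "(\<integral>\<^sup>+x. ennreal (f x) \<partial>Omega_measure) \<le> ennreal e" if "AE x in Omega_measure. f x \<le> ?S x" for f
  proof -
    have "AE x in Omega_measure. ennreal (f x) \<le> ennreal (?S x)"
      using that by eventually_elim (rule ennreal_leI)
    then have "(\<integral>\<^sup>+x. ennreal (f x) \<partial>Omega_measure) \<le> E_vKD h \<phi>" unfolding E_vKD_def by (rule nn_integral_mono_AE)
    then show ?thesis using E by (rule order_trans)
  qed
  have sq: "sq_integrable Omega_measure w" "sq_integrable Omega_measure gt" "sq_integrable Omega_measure gz"
    "sq_integrable Omega_measure k" "sq_integrable Omega_measure p" "sq_integrable Omega_measure q"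
    using w gt gz2 k p q by (auto intro: L2_sq_integrable)
  have m: "E1 \<in> borel_measurable Omega_measure" "E2 \<in> borel_measurable Omega_measure" "k \<in> borel_measurable Omega_measure"
    using sq by (auto simp: E1_def E2_def sq_integrable_def)
  have m2: "(\<lambda>x. (E1 x)\<^sup>2) \<in> borel_measurable Omega_measure" "(\<lambda>x. (E2 x)\<^sup>2) \<in> borel_measurable Omega_measure"
     "(\<lambda>x. h\<^sup>2 * (k x)\<^sup>2) \<in> borel_measurable Omega_measure" using m by auto
  have n: "(\<integral>\<^sup>+x. ennreal ((E1 x)\<^sup>2) \<partial>Omega_measure) \<le> ennreal e" "(\<integral>\<^sup>+x. ennreal ((E2 x)\<^sup>2) \<partial>Omega_measure) \<le> ennreal e"
    "(\<integral>\<^sup>+x. ennreal (h\<^sup>2 * (k x)\<^sup>2) \<partial>Omega_measure) \<le> ennreal e"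
    by (rule nn, use le in \<open>auto elim!: eventually_mono\<close>)+
  note b1 = integrable_of_nn_integral_bound[OF m2(1) _ n(1) less_imp_le[OF pos(1)]]
  note b2 = integrable_of_nn_integral_bound[OF m2(2) _ n(2) less_imp_le[OF pos(1)]]
  note b3 = integrable_of_nn_integral_bound[OF m2(3) _ n(3) less_imp_le[OF pos(1)]]
  have "bounded_energy w gt gz k p q u v lam h e"
    by unfold_locales
       (use sq A gt gz k p q pos b1 b2 b3 in \<open>simp_all add: E1_def E2_def\<close>)
  moreover have "AE x in Omega_measure. ereal \<bar>gz x\<bar> \<le> M"
    using esssup_AE[where M=Omega_measure and f="\<lambda>x. ereal \<bar>D e_z w x\<bar>"] Dw(2)
  proof eventually_elim
    case (elim x)
    then show ?case using A(5) unfolding L_infty_norm_def by (auto intro: order_trans)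
  qed
  ultimately show ?thesis using that by blast
qed

lemma powr_12_11_le:
  assumes "(t :: real)\<^sup>2 \<le> 70000 * e powr (11/6)" "0 < e" "0 < t"
  shows "t powr (12/11) \<le> 70000 * e"
proof -
  have "t powr (12/11) = (t\<^sup>2) powr (6/11)" using assms(3) by (simp add: powr_powr flip: powr_numeral)
  also have "\<dots> \<le> (70000 * e powr (11/6)) powr (6/11)" using assms by (intro powr_mono2) auto
  also have "\<dots> = 70000 powr (6/11) * e" using assms(2) by (simp add: powr_mult powr_powr)
  also have "\<dots> \<le> 70000 powr 1 * e" using assms(2) by (intro mult_right_mono powr_mono) auto
  finally show ?thesis by simp
qed

lemma
  assumes \<phi>: "\<phi> \<in> A_vKD lam 1 M" and E: "E_vKD h \<phi> \<le> ennreal e" and par: "0 < e" "0 < h" "0 < lam" "lam \<le> 1/2"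
  shows energy_lower_bound_superlinear: "min ((h * lam) powr (12/11)) (lam\<^sup>2) \<le> 70000 * e"
    and energy_lower_bound_Lipschitz: "M = ereal m \<Longrightarrow> 0 \<le> m \<Longrightarrow> min (h * lam powr (3/2)) (lam\<^sup>2) \<le> (216 * m + 1) * e"
proof -
  obtain w gt gz k p q u v where be: "bounded_energy w gt gz k p q u v lam h e" and M: "AE x in Omega_measure. ereal \<bar>gz x\<bar> \<le> M"
    by (rule admissible_bounded_energy[OF \<phi> E par(1-3)])
  interpret bounded_energy w gt gz k p q u v lam h e by (rule be)
  have lam1: "lam\<^sup>2 \<le> 1" using par by (intro power_le_one) auto
  show "min ((h * lam) powr (12/11)) (lam\<^sup>2) \<le> 70000 * e"
  proof (cases "e \<le> lam\<^sup>2")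
    case True
    then have "(h * lam) powr (12/11) \<le> 70000 * e"
      using lower_bound_L2 lam1 pos by (intro powr_12_11_le) auto
    then show ?thesis by linarith
  next
    case False
    then show ?thesis using pos by linarith
  qed
  show "min (h * lam powr (3/2)) (lam\<^sup>2) \<le> (216 * m + 1) * e" if m: "M = ereal m" "0 \<le> m"
  proof (cases "e \<le> lam\<^sup>2")
    case True
    \<comment> \<open>The summand \<open>1\<close> in the constant \<open>216 * m + 1\<close> serves the case \<open>e > lam\<^sup>2\<close> below.\<close>
    have "AE x in Omega_measure. \<bar>gz x\<bar> \<le> m" using M m(1) by simp
    from lower_bound_Linfty[OF True this m(2)]
    have "h * (lam * sqrt lam) \<le> 216 * m * e" .
    moreover have "lam powr (3/2) = lam * sqrt lam"
      using pos powr_add[of lam 1 "1/2"] by (simp add: powr_half_sqrt)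
    ultimately have "h * lam powr (3/2) \<le> (216 * m + 1) * e" using pos by (simp add: distrib_right)
    then show ?thesis by linarith
  next
    case False
    moreover have "e \<le> (216 * m + 1) * e" using pos m(2) by (simp add: distrib_right)
    ultimately show ?thesis by linarith
  qed
qed

text \<open>A bound for every energy level \<open>e\<close> strictly above the energy of a competitor
  passes to the infimum. The level is taken positive, so that its negative powers make sense even if the
  energy vanishes.\<close>

lemma min_energy_ge:
  assumes "0 < C" and bound: "\<And>\<phi> e. \<phi> \<in> A_vKD lam 1 M \<Longrightarrow> E_vKD h \<phi> \<le> ennreal e \<Longrightarrow> 0 < e \<Longrightarrow> t \<le> C * e"
  shows "ennreal t \<le> ennreal C * min_E_vKD h lam 1 M"
proof (cases "t > 0")
  case True
  have "ennreal (t / C) \<le> min_E_vKD h lam 1 M" unfolding min_E_vKD_def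
  proof (rule INF_greatest, rule ccontr)
    fix \<phi> assume \<phi>: "\<phi> \<in> A_vKD lam 1 M" and "\<not> ennreal (t / C) \<le> E_vKD h \<phi>"
    then have lt: "E_vKD h \<phi> < ennreal (t / C)" by simp
    then obtain r where r: "E_vKD h \<phi> = ennreal r" "0 \<le> r" by (cases "E_vKD h \<phi>") auto
    have rt: "r < t / C" using lt r True assms(1) by (simp add: ennreal_less_iff)
    obtain e where e: "r < e" "e < t / C" using dense[OF rt] by blast
    then have e0: "0 < e" using r(2) by linarith
    have "t \<le> C * e" using bound[OF \<phi> _ e0] r e(1) by (simp add: ennreal_leI)
    then show False using e(2) assms(1) by (simp add: field_simps)
  qed
  then have "ennreal C * ennreal (t / C) \<le> ennreal C * min_E_vKD h lam 1 M" by (rule mult_left_mono) simp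
  then show ?thesis using assms(1) True by (simp flip: ennreal_mult)
qed (simp add: ennreal_neg)

lemma H_per_1_axial:
  assumes "\<And>z. (f has_real_derivative f' z) (at z)" "continuous_on UNIV f'" "f (1/2) = f (-1/2)"
  shows "H_per 1 (\<lambda>x. f (snd x))"
proof -
  have f: "continuous_on UNIV f" using assms(1) by (meson DERIV_isCont continuous_at_imp_continuous_on)
  have L: "L2 (\<lambda>x. g (snd x))" if "continuous_on UNIV g" for g
  proof -
    have "continuous_on UNIV (\<lambda>x::point. g (snd x))"
      by (intro continuous_on_compose2[OF that] continuous_intros) auto
    then show ?thesis using continuous_sq_integrable_Omega continuous_measurable_Omega by (auto simp: L2_def sq_integrable_def)
  qed
  show ?thesis unfolding One_nat_def H_per.simps
    using weak_partial_z_periodic[OF assms] weak_partial_theta_periodic[OF f] L[OF f] L[OF assms(2)] L[of "\<lambda>_. 0"]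
    by (auto simp: Basis_point)
qed

lemma H_per_2_axial:
  assumes "\<And>z. (f has_real_derivative f' z) (at z)" "\<And>z. (f' has_real_derivative f'' z) (at z)" "continuous_on UNIV f''"
    "f (1/2) = f (-1/2)" "f' (1/2) = f' (-1/2)"
  shows "H_per 2 (\<lambda>x. f (snd x))"
proof -
  have f: "continuous_on UNIV f" "continuous_on UNIV f'" using assms(1,2) by (meson DERIV_isCont continuous_at_imp_continuous_on)+
  have "H_per 1 (\<lambda>x. f (snd x))" by (rule H_per_1_axial[OF assms(1) f(2) assms(4)])
  then have L: "L2 (\<lambda>x. f (snd x))" by simp
  have "H_per 1 (\<lambda>x::point. (\<lambda>z. 0) (snd x))" by (rule H_per_1_axial[where f'="\<lambda>_. 0"]) auto
  then have 0: "H_per 1 (\<lambda>x::point. 0)" by simp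
  have 1: "H_per 1 (\<lambda>x. f' (snd x))" by (rule H_per_1_axial[OF assms(2,3,5)])
  have "2 = Suc 1" by simp
  then show ?thesis
    using weak_partial_z_periodic[OF assms(1) f(2) assms(4)] weak_partial_theta_periodic[OF f(1)] L 0 1
    by (simp only: H_per.simps Basis_point) blast
qed

lemma L_infty_norm_D_le:
  assumes "weak_partial interior_tests e F G" "\<And>x. x \<in> Omega \<Longrightarrow> \<bar>G x\<bar> \<le> b" "ereal b \<le> M"
  shows "L_infty_norm (D e F) \<le> M"
  unfolding L_infty_norm_def
proof (rule esssup_I)
  have "D e F \<in> borel_measurable Omega_measure"
    using D_weak_partial(1)[OF assms(1)] by (auto simp: weak_partial_def)
  then show "(\<lambda>x. ereal \<bar>D e F x\<bar>) \<in> borel_measurable Omega_measure" by simp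
  show "AE x in Omega_measure. ereal \<bar>D e F x\<bar> \<le> M"
    using D_weak_partial(2)[OF assms(1)] AE_space
  proof eventually_elim
    case (elim x)
    then have "ereal \<bar>D e F x\<bar> \<le> ereal b" using assms(2) by (simp add: space_Omega_measure)
    then show ?case using assms(3) by (rule order_trans)
  qed
qed

text \<open>For a displacement that depends on \<open>z\<close> alone and has no hoop component, the hoop strain is the radial
  displacement itself and the shear strain vanishes, so a pointwise bound on three terms suffices.\<close>

lemma axisymmetric_competitor:
  assumes f: "\<And>z. (f has_real_derivative f' z) (at z)" "\<And>z. (f' has_real_derivative f'' z) (at z)" "continuous_on UNIV f''"
    "f (1/2) = f (-1/2)" "f' (1/2) = f' (-1/2)"
    and g: "\<And>z. (g has_real_derivative g' z) (at z)" "continuous_on UNIV g'" "g (1/2) = g (-1/2)"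
    and bd: "\<And>z. 0 \<le> f z" "\<And>z. \<bar>f' z\<bar> \<le> 2" "\<And>z. \<bar>g' z - lam\<bar> \<le> 2" "2 \<le> M"
    and K: "\<And>z. (f z)\<^sup>2 + (g' z - lam + 1/2 * (f' z)\<^sup>2)\<^sup>2 + h\<^sup>2 * (f'' z)\<^sup>2 \<le> K"
  shows "min_E_vKD h lam 1 M \<le> ennreal (2 * pi * K)"
proof -
  define \<phi> :: displacement where "\<phi> = (\<lambda>x. (f (snd x), 0, g (snd x) - lam * snd x))"
  have comps: "comp_rho \<phi> = (\<lambda>x. f (snd x))" "comp_theta \<phi> = (\<lambda>x. 0)" "comp_z \<phi> = (\<lambda>x. g (snd x) - lam * snd x)"
    by (auto simp: \<phi>_def comp_rho_def comp_theta_def comp_z_def)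
  have B: "e_theta \<in> Basis" "e_z \<in> Basis" by (simp_all add: Basis_point)
  have neq: "e_theta \<noteq> e_z" by (simp add: e_theta_def e_z_def)
  have fc: "continuous_on UNIV f" "continuous_on UNIV f'" using f(1,2) by (meson DERIV_isCont continuous_at_imp_continuous_on)+
  have gl: "((\<lambda>z. g z - lam * z) has_real_derivative g' z - lam) (at z)" for z
    by (auto intro!: derivative_eq_intros g(1))
  have glc: "continuous_on UNIV (\<lambda>z. g' z - lam)" "continuous_on UNIV (\<lambda>z. g z - lam * z)"
    by (intro continuous_intros g(2), intro continuous_at_imp_continuous_on ballI DERIV_isCont[OF gl])
  have wp: "weak_partial interior_tests e_theta (\<lambda>x. f (snd x)) (\<lambda>x. 0)"
    "weak_partial interior_tests e_z (\<lambda>x. f (snd x)) (\<lambda>x. f' (snd x))"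
    "weak_partial interior_tests e_theta (\<lambda>x. f' (snd x)) (\<lambda>x. 0)"
    "weak_partial interior_tests e_z (\<lambda>x. f' (snd x)) (\<lambda>x. f'' (snd x))"
    "weak_partial interior_tests e_theta (\<lambda>x. 0) (\<lambda>x. 0)"
    "weak_partial interior_tests e_z (\<lambda>x. 0) (\<lambda>x. 0)"
    "weak_partial interior_tests e_theta (\<lambda>x. g (snd x) - lam * snd x) (\<lambda>x. 0)"
    "weak_partial interior_tests e_z (\<lambda>x. g (snd x) - lam * snd x) (\<lambda>x. g' (snd x) - lam)"
    using weak_partial_theta_interior[OF fc(1)] weak_partial_z_interior[OF f(1) fc(2)]
      weak_partial_theta_interior[OF fc(2)] weak_partial_z_interior[OF f(2,3)]
      weak_partial_theta_interior[of "\<lambda>_. 0"] weak_partial_z_interior[of "\<lambda>_. 0" "\<lambda>_. 0"]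
      weak_partial_theta_interior[OF glc(2)] weak_partial_z_interior[OF gl glc(1)] by auto
  note Dw = D_weak_partial(2)[OF wp(1)] D_weak_partial(2)[OF wp(2)] D_weak_partial(2)[OF wp(5)] D_weak_partial(2)[OF wp(6)]
    D_weak_partial(2)[OF wp(7)] D_weak_partial(2)[OF wp(8)]
  note DDw = D_D_weak_partial[OF wp(1) wp(5) B(1)] D_D_weak_partial[OF wp(1) wp(6) B(2)]
    D_D_weak_partial[OF wp(2) wp(3) B(1)] D_D_weak_partial[OF wp(2) wp(4) B(2)]
  have M2: "ereal 2 \<le> M" using bd(4) by simp
  have M0: "ereal 0 \<le> M" by (rule order_trans[OF _ M2]) simp
  have "L_infty_norm (D i F) \<le> M" if "i \<in> {e_theta, e_z}" "F \<in> {comp_rho \<phi>, comp_theta \<phi>, comp_z \<phi>}" for i F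
    using that unfolding comps
    using L_infty_norm_D_le[OF wp(1) _ M0] L_infty_norm_D_le[OF wp(2) _ M2] L_infty_norm_D_le[OF wp(5) _ M0]
      L_infty_norm_D_le[OF wp(6) _ M0] L_infty_norm_D_le[OF wp(7) _ M0] L_infty_norm_D_le[OF wp(8) _ M2] bd by auto
  moreover have "H_per 1 (\<lambda>x. comp_z \<phi> x + lam * snd x)"
    using H_per_1_axial[OF g] by (simp add: comps)
  moreover have "H_per 1 (comp_theta \<phi>)"
    using H_per_1_axial[of "\<lambda>_. 0" "\<lambda>_. 0"] by (simp add: comps)
  moreover have "H_per 2 (comp_rho \<phi>)" unfolding comps by (rule H_per_2_axial[OF f])
  ultimately have \<phi>: "\<phi> \<in> A_vKD lam 1 M"
    unfolding A_vKD_def using bd(1) by (simp add: comps)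
  have S: "AE x in Omega_measure. strain_norm_sq \<phi> x + h\<^sup>2 * hessian_norm_sq (comp_rho \<phi>) x \<le> K"
    using Dw DDw
  proof eventually_elim
    case (elim x)
    have "strain_norm_sq \<phi> x = (f (snd x))\<^sup>2 + (g' (snd x) - lam + 1/2 * (f' (snd x))\<^sup>2)\<^sup>2"
      using elim by (simp add: strain_norm_sq_def eps_theta_theta_def eps_theta_z_def eps_z_z_def comps)
    moreover have "hessian_norm_sq (comp_rho \<phi>) x = (f'' (snd x))\<^sup>2"
      using elim neq by (simp add: hessian_norm_sq_def Basis_point comps)
    ultimately show ?case using K[of "snd x"] by simp
  qed
  have "min_E_vKD h lam 1 M \<le> E_vKD h \<phi>" unfolding min_E_vKD_def by (rule INF_lower[OF \<phi>])
  also have "\<dots> \<le> (\<integral>\<^sup>+x. ennreal K \<partial>Omega_measure)"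
    unfolding E_vKD_def using S by (intro nn_integral_mono_AE) (auto elim!: eventually_mono intro: ennreal_leI)
  also have "\<dots> = ennreal K * emeasure Omega_measure Omega" by (simp add: space_Omega_measure)
  also have "emeasure Omega_measure Omega = ennreal (2 * pi)"
    using finite_measure.emeasure_eq_measure[OF finite_measure_Omega, of Omega] by (simp add: measure_Omega)
  also have "ennreal K * ennreal (2 * pi) = ennreal (2 * pi * K)"
    by (subst ennreal_mult''[symmetric]) (auto simp: mult.commute)
  finally show ?thesis .
qed

lemma compression_upper_bound:
  assumes "0 < lam" "lam \<le> 1/2" "2 \<le> M" shows "min_E_vKD h lam 1 M \<le> ennreal (2 * pi * lam\<^sup>2)"
  by (rule axisymmetric_competitor[where f="\<lambda>_. 0" and f'="\<lambda>_. 0" and f''="\<lambda>_. 0" and g="\<lambda>_. 0" and g'="\<lambda>_. 0"])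
     (use assms in auto)

text \<open>Wrinkles of slope \<open>2 sqrt lam sin (\<omega> z)\<close> absorb the compression exactly: half the squared slope has
  mean \<open>lam\<close>, and the oscillating rest is compensated by an axial displacement, so the axial strain vanishes.
  The amplitude is of the order \<open>sqrt lam / \<omega>\<close>. Thus the hoop strain costs \<open>lam / \<omega>\<^sup>2\<close> and bending costs
  \<open>h\<^sup>2 lam \<omega>\<^sup>2\<close>, and these balance at \<open>\<omega>\<^sup>2\<close> of the order \<open>1/h\<close>. The slopes stay below \<open>2\<close> because \<open>lam \<le> 1/2\<close>.\<close>

lemma wrinkling_upper_bound:
  assumes lam: "0 < lam" "lam \<le> 1/2" and h: "0 < h" "h \<le> 1/2" and M: "2 \<le> M"
  shows "min_E_vKD h lam 1 M \<le> ennreal (2 * pi * (1025 * (h * lam)))"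
proof -
  define n where "n = nat \<lceil>1 / sqrt h\<rceil>"
  have sh: "0 < sqrt h" "sqrt h \<le> 1" using h by auto
  then have "1 \<le> 1 / sqrt h" by simp
  then have n: "1 / sqrt h \<le> real n" "real n \<le> 2 / sqrt h" "1 \<le> n" unfolding n_def by linarith+
  define \<omega> where "\<omega> = 2 * pi * real n"
  have \<omega>: "0 < \<omega>" using n(3) by (simp add: \<omega>_def)
  \<comment> \<open>The amplitude for which the slope of \<open>a (1 - cos (\<omega> z))\<close> is \<open>2 sqrt lam sin (\<omega> z)\<close>.\<close>
  define a where "a = 2 * sqrt lam / \<omega>"
  have nh: "1 / (real n)\<^sup>2 \<le> h" "(real n)\<^sup>2 \<le> 4 / h"
  proof -
    have "(1 / sqrt h)\<^sup>2 \<le> (real n)\<^sup>2" "(real n)\<^sup>2 \<le> (2 / sqrt h)\<^sup>2" using n sh by (intro power_mono; simp)+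
    then show "1 / (real n)\<^sup>2 \<le> h" "(real n)\<^sup>2 \<le> 4 / h" using h n(3) by (auto simp: power_divide field_simps)
  qed
  have pi2: "4 \<le> pi\<^sup>2" "pi\<^sup>2 \<le> 16" using power_mono[of 2 pi 2] power_mono[of pi 4 2] pi_less_4 pi_gt3 by auto
  have sq: "(sqrt lam)\<^sup>2 = lam" using lam by simp
  let ?f = "\<lambda>z. a * (1 - cos (\<omega> * z))" and ?f' = "\<lambda>z. 2 * sqrt lam * sin (\<omega> * z)"
    and ?f'' = "\<lambda>z. 2 * sqrt lam * \<omega> * cos (\<omega> * z)"
    and ?g = "\<lambda>z. lam * sin (2 * \<omega> * z) / (2 * \<omega>)" and ?g' = "\<lambda>z. lam * cos (2 * \<omega> * z)"
  have a\<omega>: "a * \<omega> = 2 * sqrt lam" using \<omega> by (simp add: a_def)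
  have d1: "(?f has_real_derivative ?f' z) (at z)" for z
    unfolding a\<omega>[symmetric] by (auto intro!: derivative_eq_intros)
  have d2: "(?f' has_real_derivative ?f'' z) (at z)" for z
    by (auto intro!: derivative_eq_intros)
  have d3: "(?g has_real_derivative ?g' z) (at z)" for z
    using \<omega> by (auto intro!: derivative_eq_intros)
  have c: "continuous_on UNIV ?f''" "continuous_on UNIV ?g'" by (intro continuous_intros)+
  have e1: "?f (1/2) = ?f (-1/2)" by simp
  have half: "\<omega> * (1/2) = real n * pi" "2 * \<omega> * (1/2) = real (2 * n) * pi" by (simp_all add: \<omega>_def)
  have s0: "sin (\<omega> * (1/2)) = 0" "sin (2 * \<omega> * (1/2)) = 0"
    unfolding half by (rule sin_npi)+
  have sneg: "sin (\<omega> * (-1/2)) = - sin (\<omega> * (1/2))" "sin (2 * \<omega> * (-1/2)) = - sin (2 * \<omega> * (1/2))"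
    by (simp_all flip: sin_minus)
  have e2: "?f' (1/2) = ?f' (-1/2)" unfolding sneg s0 by simp
  have e3: "?g (1/2) = ?g (-1/2)" unfolding sneg s0 by simp
  have b1: "0 \<le> ?f z" for z using \<omega> lam by (simp add: a_def)
  have b2: "\<bar>?f' z\<bar> \<le> 2" for z
  proof -
    have "sqrt lam \<le> 1" using lam by simp
    from mult_mono[OF this abs_sin_le_one[of "\<omega> * z"]] lam show ?thesis by (simp add: abs_mult)
  qed
  have b3: "\<bar>?g' z - lam\<bar> \<le> 2" for z
  proof -
    have "\<bar>?g' z\<bar> \<le> lam"
      using lam mult_left_mono[OF abs_cos_le_one[of "2 * \<omega> * z"], of lam] by (simp add: abs_mult)
    then show ?thesis using lam by linarith
  qed
  have b4: "(?f z)\<^sup>2 + (?g' z - lam + 1/2 * (?f' z)\<^sup>2)\<^sup>2 + h\<^sup>2 * (?f'' z)\<^sup>2 \<le> 1025 * (h * lam)" for z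
  proof -
    have "cos (2 * \<omega> * z) = 1 - 2 * (sin (\<omega> * z))\<^sup>2" using cos_double_sin[of "\<omega> * z"] by (simp add: mult.assoc)
    then have strain: "?g' z - lam + 1/2 * (?f' z)\<^sup>2 = 0"
      by (simp only: power_mult_distrib sq) (simp add: algebra_simps)
    have "0 \<le> 1 - cos (\<omega> * z)" "1 - cos (\<omega> * z) \<le> 2" using cos_le_one[of "\<omega> * z"] cos_ge_minus_one[of "\<omega> * z"] by linarith+
    then have "(1 - cos (\<omega> * z))\<^sup>2 \<le> 2\<^sup>2" by (rule power_mono[rotated])
    then have "(?f z)\<^sup>2 \<le> a\<^sup>2 * 4" unfolding power_mult_distrib by (intro mult_left_mono) auto
    also have "a\<^sup>2 * 4 = 4 * lam / pi\<^sup>2 * (1 / (real n)\<^sup>2)" using lam by (simp add: a_def \<omega>_def power_divide power_mult_distrib)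
    also have "\<dots> \<le> lam * h"
    proof (rule mult_mono[OF _ nh(1)])
      have "4 * lam \<le> lam * pi\<^sup>2" using mult_left_mono[OF pi2(1), of lam] lam by simp
      then show "4 * lam / pi\<^sup>2 \<le> lam" by (subst pos_divide_le_eq) auto
    qed (use lam in auto)
    finally have stretch: "(?f z)\<^sup>2 \<le> lam * h" .
    have "(cos (\<omega> * z))\<^sup>2 \<le> 1" by (simp add: abs_square_le_1)
    then have "h\<^sup>2 * (?f'' z)\<^sup>2 \<le> h\<^sup>2 * (4 * lam * \<omega>\<^sup>2 * 1)"
      unfolding power_mult_distrib sq using lam by (intro mult_left_mono mult_mono) auto
    also have "\<dots> = 16 * h\<^sup>2 * lam * pi\<^sup>2 * (real n)\<^sup>2" by (simp add: \<omega>_def power_mult_distrib)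
    also have "\<dots> \<le> 16 * h\<^sup>2 * lam * 16 * (4 / h)"
      using pi2 nh(2) lam h by (intro mult_mono) auto
    also have "\<dots> = 1024 * (lam * h)" using h by (simp add: power2_eq_square)
    finally have "h\<^sup>2 * (?f'' z)\<^sup>2 \<le> 1024 * (lam * h)" .
    with stretch show ?thesis unfolding strain by (simp add: mult.commute)
  qed
  show ?thesis by (rule axisymmetric_competitor[OF d1 d2 c(1) e1 e2 d3 c(2) e3 b1 b2 b3 M b4])
qed

lemma energy_upper_bound:
  assumes "0 < lam" "lam \<le> 1/2" "0 < h" "h \<le> 1/2" "2 \<le> M"
  shows "min_E_vKD h lam 1 M \<le> ennreal (8200 * min (h * lam) (lam\<^sup>2))"
proof -
  have "2 * pi * (1025 * (h * lam)) \<le> 8200 * (h * lam)"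
    using mult_right_mono[of "2 * pi * 1025" 8200 "h * lam"] pi_less_4 assms by (simp add: mult.assoc)
  then have 1: "min_E_vKD h lam 1 M \<le> ennreal (8200 * (h * lam))"
    using wrinkling_upper_bound[OF assms] ennreal_leI order_trans by blast
  have "2 * pi * lam\<^sup>2 \<le> 8200 * lam\<^sup>2" using pi_less_4 by (intro mult_right_mono) auto
  then have 2: "min_E_vKD h lam 1 M \<le> ennreal (8200 * lam\<^sup>2)"
    using compression_upper_bound[OF assms(1,2,5), of h] ennreal_leI order_trans by blast
  show ?thesis using 1 2 by (cases "h * lam \<le> lam\<^sup>2") auto
qed

theorem theorem1p5:
  shows
    "(\<forall>m::real. 2 \<le> m \<longrightarrow>
       (\<exists>C>0::real. \<forall>h\<in>{0<..1/2::real}. \<forall>lam\<in>{0<..1/2::real}.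
          ennreal (min (max (h * lam powr (3/2)) ((h * lam) powr (12/11))) (lam\<^sup>2))
            \<le> ennreal C * min_E_vKD h lam 1 (ereal m)))
     \<and>
     (\<exists>C>0::real. \<forall>m::real. 2 \<le> m \<longrightarrow>
       (\<forall>h\<in>{0<..1/2::real}. \<forall>lam\<in>{0<..1/2::real}.
          min_E_vKD h lam 1 (ereal m) \<le> ennreal (C * min (h * lam) (lam\<^sup>2))))
     \<and>
     (\<exists>C>0::real. \<forall>h\<in>{0<..1/2::real}. \<forall>lam\<in>{0<..1/2::real}.
        ennreal (min ((h * lam) powr (12/11)) (lam\<^sup>2))
          \<le> ennreal C * min_E_vKD h lam 1 \<infinity>)
     \<and>
     (\<exists>C>0::real. \<forall>h\<in>{0<..1/2::real}. \<forall>lam\<in>{0<..1/2::real}.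
        min_E_vKD h lam 1 \<infinity> \<le> ennreal (C * min (h * lam) (lam\<^sup>2)))"
proof (intro conjI allI impI)
  fix m :: real assume m: "2 \<le> m"
  define C where "C = 70000 + (216 * m + 1)"
  have "0 < C" using m by (simp add: C_def)
  moreover have "ennreal (min (max (h * lam powr (3/2)) ((h * lam) powr (12/11))) (lam\<^sup>2))
            \<le> ennreal C * min_E_vKD h lam 1 (ereal m)" if "h \<in> {0<..1/2}" "lam \<in> {0<..1/2}" for h lam
  proof (rule min_energy_ge[OF \<open>0 < C\<close>])
    fix \<phi> e assume "\<phi> \<in> A_vKD lam 1 (ereal m)" "E_vKD h \<phi> \<le> ennreal e" "0 < e"
    then have b: "min ((h * lam) powr (12/11)) (lam\<^sup>2) \<le> 70000 * e" "min (h * lam powr (3/2)) (lam\<^sup>2) \<le> (216 * m + 1) * e"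
      using energy_lower_bound_superlinear[of \<phi> lam "ereal m" h e]
        energy_lower_bound_Lipschitz[of \<phi> lam "ereal m" h e m] that m by auto
    have "0 \<le> 70000 * e" "0 \<le> (216 * m + 1) * e" using \<open>0 < e\<close> m by auto
    then have "70000 * e \<le> C * e" "(216 * m + 1) * e \<le> C * e" by (auto simp: C_def distrib_right)
    then show "min (max (h * lam powr (3/2)) ((h * lam) powr (12/11))) (lam\<^sup>2) \<le> C * e"
      using b unfolding min_def max_def by (auto split: if_splits)
  qed
  ultimately show "\<exists>C>0::real. \<forall>h\<in>{0<..1/2::real}. \<forall>lam\<in>{0<..1/2::real}.
          ennreal (min (max (h * lam powr (3/2)) ((h * lam) powr (12/11))) (lam\<^sup>2))
            \<le> ennreal C * min_E_vKD h lam 1 (ereal m)" by blast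
next
  have "\<forall>m::real. 2 \<le> m \<longrightarrow> (\<forall>h\<in>{0<..1/2::real}. \<forall>lam\<in>{0<..1/2::real}.
          min_E_vKD h lam 1 (ereal m) \<le> ennreal (8200 * min (h * lam) (lam\<^sup>2)))"
    by (intro allI impI ballI energy_upper_bound) auto
  then show "\<exists>C>0::real. \<forall>m::real. 2 \<le> m \<longrightarrow> (\<forall>h\<in>{0<..1/2::real}. \<forall>lam\<in>{0<..1/2::real}.
          min_E_vKD h lam 1 (ereal m) \<le> ennreal (C * min (h * lam) (lam\<^sup>2)))" by (intro exI[of _ 8200]) simp
next
  have "\<forall>h\<in>{0<..1/2::real}. \<forall>lam\<in>{0<..1/2::real}.
        ennreal (min ((h * lam) powr (12/11)) (lam\<^sup>2)) \<le> ennreal 70000 * min_E_vKD h lam 1 \<infinity>"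
    by (intro ballI min_energy_ge energy_lower_bound_superlinear) auto
  then show "\<exists>C>0::real. \<forall>h\<in>{0<..1/2::real}. \<forall>lam\<in>{0<..1/2::real}.
        ennreal (min ((h * lam) powr (12/11)) (lam\<^sup>2)) \<le> ennreal C * min_E_vKD h lam 1 \<infinity>" by (intro exI[of _ 70000]) simp
next
  have "\<forall>h\<in>{0<..1/2::real}. \<forall>lam\<in>{0<..1/2::real}.
        min_E_vKD h lam 1 \<infinity> \<le> ennreal (8200 * min (h * lam) (lam\<^sup>2))"
    by (intro ballI energy_upper_bound) auto
  then show "\<exists>C>0::real. \<forall>h\<in>{0<..1/2::real}. \<forall>lam\<in>{0<..1/2::real}.
        min_E_vKD h lam 1 \<infinity> \<le> ennreal (C * min (h * lam) (lam\<^sup>2))" by (intro exI[of _ 8200]) simp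
qed

end
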